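(* Let $h(z)\in\mathbb{C}[[z]]$ satisfy $h(z)h(-z)=1$. There exists a weak quantum vertex algebra structure on the vacuum $\mathcal{A}(h)$-module $(V_{\mathcal{A}(h)},\mathbf{1})$, which is uniquely determined by the condition that $\mathbf{1}$ is the vacuum vector and $$Y(e(-1)\mathbf{1},x)=e(x),\quad Y(f(-1)\mathbf{1},x)=f(x),\quad Y(\psi(-1)\mathbf{1},x)=\psi(x).$$ Furthermore, for every restricted $\mathcal{A}(h)$-module $W$, there exists a $V_{\mathcal{A}(h)}$-module structure $Y_W(\cdot,x)$ on $W$, which is uniquely determined by $$Y_W(e(-1)\mathbf{1},x)=e(x),\quad Y_W(f(-1)\mathbf{1},x)=f(x),\quad Y_W(\psi(-1)\mathbf{1},x)=\psi(x).$$
   Context: All vector spaces are over $\mathbb{C}$. Binomial expressions such as $(x_1-x_2)^n$ are expanded in nonnegative powers of the second variable; $\delta(x)=\sum_{n\in\mathbb{Z}}x^n$. **The algebra $\mathcal{A}(h)$.** Let $h(z)\in\mathbb{C}[[z]]$ with $h(z)h(-z)=1$. $\mathcal{A}(h)$ is the associative unital algebra with generators $e_n,f_n,\psi_n$ ($n\in\mathbb{Z}$) and relations $e(z)e(w)=h(w-z)e(w)e(z)$, $f(z)f(w)=h(z-w)f(w)f(z)$, $\psi(z)e(w)=h(w-z)e(w)\psi(z)$, $\psi(z)f(w)=h(z-w)f(w)\psi(z)$, $[e(z),f(w)]=z^{-1}\delta(w/z)\psi(z)$, $[\psi(z),\psi(w)]=0$, where $a(x)=\sum_{n\in\mathbb{Z}}a_nx^{-n-1}$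 for $a=e,f,\psi$, and $h(z-w),h(w-z)\in\mathbb{C}[[z,w]]$. We also write $a(n)$ for $a_n$. The relations involve infinite sums, so $\mathcal{A}(h)$ is regarded as a topological algebra. A restricted $\mathcal{A}(h)$-module is an $\mathcal{A}(h)$-module $W$, continuous for the discrete topology on $W$, such that for all $w\in W$ and $a\in\{e,f,\psi\}$, $a_nw=0$ for $n$ sufficiently large (the relations then are identities of operators in which all sums are finite on each vector). A vacuum vector in an $\mathcal{A}(h)$-module is a nonzero vector $v$ with $a_nv=0$ for $a\in\{e,f,\psi\}$, $n\ge 0$; a vacuum $\mathcal{A}(h)$-module is an $\mathcal{A}(h)$-module together with a vacuum vector generating it. **The module $V_{\mathcal{A}(h)}$.** Let $U$ be the vector space with basis $\{e,f,\psi\}$, $\mathfrak{T}=T(U\otimes\mathbb{C}[t,t^{-1}])$ the tensor algebra, $\mathbb{Z}$-graded by $\deg(u\otimes t^n)=-n$, with $u(n)=u_n$ denoting $u\otimes t^n$. Let $d$ be the derivation of $\mathfrak{T}$ with $d(u\otimes t^n)=-n(u\otimes t^{n-1})$. Put $\mathfrak{T}_-=\sum_{n\ge1}\mathfrak{T}_{-n}$ (negative-degree part), $J=\mathfrak{T}\,\mathbb{C}[d]\mathfrak{T}_-$ (a left ideal), and $V_{\mathfrak{T}}=\mathfrak{T}/J$, a left $\mathfrak{T}$-module on which for each $w$, $u(n)w=0$ for $n$ large. $V_{\mathcal{A}(h)}$ is the quotient of the $\mathfrak{T}$-module $V_{\mathfrak{T}}$ by the submodule corresponding to the defining relations of $\mathcal{A}(h)$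 (generated by all coefficients of the relations applied to all vectors). $\mathbf{1}$ is the image of $1$; $(V_{\mathcal{A}(h)},\mathbf{1})$ is a vacuum $\mathcal{A}(h)$-module. **Weak quantum vertex algebras and modules.** A weak quantum vertex algebra is a vector space $V$ with a linear map $Y(\cdot,x):V\to\mathrm{Hom}(V,V((x)))$, $v\mapsto Y(v,x)=\sum_n v_nx^{-n-1}$, and a vector $\mathbf{1}\in V$ such that $Y(\mathbf{1},x)v=v$, $Y(v,x)\mathbf{1}\in V[[x]]$ and $\lim_{x\to0}Y(v,x)\mathbf{1}=v$ for all $v\in V$, and for all $u,v\in V$ there is $\sum_{i=1}^r v^{(i)}\otimes u^{(i)}\otimes f_i(x)\in V\otimes V\otimes\mathbb{C}((x))$ with $$x_0^{-1}\delta\Big(\tfrac{x_1-x_2}{x_0}\Big)Y(u,x_1)Y(v,x_2)-x_0^{-1}\delta\Big(\tfrac{x_2-x_1}{-x_0}\Big)\sum_{i=1}^r f_i(-x_0)Y(v^{(i)},x_2)Y(u^{(i)},x_1)=x_2^{-1}\delta\Big(\tfrac{x_1-x_0}{x_2}\Big)Y(Y(u,x_0)v,x_2).$$ A $V$-module is a vector space $W$ with a linear map $Y_W(\cdot,x):V\to\mathrm{Hom}(W,W((x)))$ such that $Y_W(\mathbf{1},x)=1_W$ and for $u,v\in V$, $w\in W$ there is $l\ge 0$ with $(x_0+x_2)^lY_W(u,x_0+x_2)Y_W(v,x_2)w=(x_0+x_2)^lY_W(Y(u,x_0)v,x_2)w$. *)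

theory Defs
  imports
    "HOL-Library.Poly_Mapping"
    "HOL-Computational_Algebra.Formal_Laurent_Series"
begin

section \<open>The tensor algebra\<close>

datatype gen = E | F | Psi

text \<open>The letter \<open>(u, n)\<close> stands for \<open>u(n) = u \<otimes> t^n\<close>. As these letters form a basis of
  \<open>U \<otimes> \<complex>[t, t\<^sup>-\<^sup>1]\<close>, the tensor algebra is the monoid algebra over \<open>\<complex>\<close> of the free monoid of words,
  with the convolution product of \<^typ>\<open>'a \<Rightarrow>\<^sub>0 'b\<close>.\<close>

datatype fword = Fword (letters: "(gen \<times> int) list")

instantiation fword :: monoid_add
begin

definition zero_fword :: fword where "0 = Fword []"

definition plus_fword :: "fword \<Rightarrow> fword \<Rightarrow> fword"
  where "v + w = Fword (letters v @ letters w)"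

instance by standard (simp_all add: zero_fword_def plus_fword_def)

end

type_synonym tens = "fword \<Rightarrow>\<^sub>0 complex"

definition tscale :: "complex \<Rightarrow> tens \<Rightarrow> tens"
  where "tscale c p = Poly_Mapping.single 0 c * p"

definition tgen :: "gen \<Rightarrow> int \<Rightarrow> tens"
  where "tgen u n = Poly_Mapping.single (Fword [(u, n)]) 1"

global_interpretation tens: vector_space tscale
  by standard (simp_all add: tscale_def distrib_left distrib_right single_add
      mult_single flip: mult.assoc)

definition word_deg :: "fword \<Rightarrow> int"
  where "word_deg w = sum_list (map (\<lambda>(u, n). - n) (letters w))"

definition tens_neg :: "tens set"
  where "tens_neg = {p. \<forall>w \<in> Poly_Mapping.keys p. word_deg w < 0}"

fun deriv_word :: "(gen \<times> int) list \<Rightarrow> tens" where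
  "deriv_word [] = 0"
| "deriv_word ((u, n) # w) =
     tscale (- of_int n) (tgen u (n - 1)) * Poly_Mapping.single (Fword w) 1
     + tgen u n * deriv_word w"

definition tens_d :: "tens \<Rightarrow> tens"
  where "tens_d p =
    (\<Sum>w \<in> Poly_Mapping.keys p. tscale (Poly_Mapping.lookup p w) (deriv_word (letters w)))"

definition tens_J :: "tens set"
  where "tens_J = tens.span {a * (tens_d ^^ k) b | a k b. b \<in> tens_neg}"

lemma tens_induct [case_names zero single add]:
  fixes p :: tens
  assumes "P 0" and "\<And>w c. P (Poly_Mapping.single w c)"
    and "\<And>p q. P p \<Longrightarrow> P q \<Longrightarrow> P (p + q)"
  shows "P p"
proof (induction p rule: update_induct)
  case const
  show ?case by (rule assms)
next
  case (update p w c)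
  have "Poly_Mapping.update w c p = p + Poly_Mapping.single w c"
    using update(1)
    by (intro poly_mapping_eqI) (auto simp: lookup_update lookup_add lookup_single in_keys_iff when_def)
  with update assms show ?case by simp
qed

lemma tscale_mult: "tscale c p * q = tscale c (p * q)"
  by (simp add: tscale_def mult.assoc)

lemma single_0_commute: "Poly_Mapping.single 0 c * p = p * Poly_Mapping.single (0::fword) (c::complex)"
proof (induction p rule: tens_induct)
  case (single w c')
  show ?case by (simp add: mult_single mult.commute)
qed (simp_all add: distrib_left distrib_right)

lemma mult_tscale: "p * tscale c q = tscale c (p * q)"
  unfolding tscale_def by (metis mult.assoc single_0_commute)

lemma tens_J_diff: "a \<in> tens_J \<Longrightarrow> b \<in> tens_J \<Longrightarrow> a - b \<in> tens_J"
  unfolding tens_J_def by (rule tens.span_diff)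

lemma tens_J_add: "a \<in> tens_J \<Longrightarrow> b \<in> tens_J \<Longrightarrow> a + b \<in> tens_J"
  unfolding tens_J_def by (rule tens.span_add)

lemma tens_J_0: "0 \<in> tens_J"
  unfolding tens_J_def by (rule tens.span_zero)

lemma tens_J_scale: "a \<in> tens_J \<Longrightarrow> tscale c a \<in> tens_J"
  unfolding tens_J_def by (rule tens.span_scale)

lemma tens_J_mult:
  assumes "b \<in> tens_J"
  shows "a * b \<in> tens_J"
  using assms unfolding tens_J_def
proof (induction rule: tens.span_induct_alt)
  case base
  show ?case by (simp add: tens.span_zero)
next
  case (step c x y)
  from step(1) obtain a' k b where x: "x = a' * (tens_d ^^ k) b" and b: "b \<in> tens_neg"
    by blast
  have "a * x = (a * a') * (tens_d ^^ k) b" by (simp add: x mult.assoc)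
  with b have "a * x \<in> tens.span {a * (tens_d ^^ k) b | a k b. b \<in> tens_neg}"
    by (blast intro: tens.span_base)
  with step(2) show ?case
    by (simp add: distrib_left mult_tscale tens.span_add tens.span_scale)
qed

lemma tens_neg_subset_J: "tens_neg \<subseteq> tens_J"
proof
  fix b assume "b \<in> tens_neg"
  moreover have "b = 1 * (tens_d ^^ 0) b" by simp
  ultimately show "b \<in> tens_J" unfolding tens_J_def by (blast intro: tens.span_base)
qed

text \<open>\<^const>\<open>tens_d\<close> is the derivation with \<open>d (u(n)) = - n u(n - 1)\<close>.\<close>

lemma tens_d_superset:
  assumes "finite A" "Poly_Mapping.keys p \<subseteq> A"
  shows "tens_d p = (\<Sum>w\<in>A. tscale (Poly_Mapping.lookup p w) (deriv_word (letters w)))"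
  unfolding tens_d_def
  by (rule sum.mono_neutral_left) (use assms in \<open>auto simp: in_keys_iff\<close>)

lemma tens_d_add: "tens_d (p + q) = tens_d p + tens_d q"
proof -
  let ?A = "Poly_Mapping.keys p \<union> Poly_Mapping.keys q"
  have "Poly_Mapping.keys (p + q) \<subseteq> ?A" by (rule Poly_Mapping.keys_add)
  then show ?thesis
    by (simp add: tens_d_superset[of ?A] lookup_add tens.scale_left_distrib sum.distrib)
qed

lemma tens_d_0: "tens_d 0 = 0"
  by (simp add: tens_d_def)

lemma tens_d_single: "tens_d (Poly_Mapping.single w c) = tscale c (deriv_word (letters w))"
  by (simp add: tens_d_superset[of "{w}"])

lemma tens_d_tgen: "tens_d (tgen u n) = tscale (- of_int n) (tgen u (n - 1))"
  by (simp add: tgen_def[of u n] tens_d_single flip: zero_fword_def)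

lemma deriv_word_append:
  "deriv_word (v @ w) = deriv_word v * Poly_Mapping.single (Fword w) 1
     + Poly_Mapping.single (Fword v) 1 * deriv_word w"
proof (induction v rule: deriv_word.induct)
  case 1
  show ?case by (simp flip: zero_fword_def)
next
  case (2 u n v)
  have *: "Poly_Mapping.single (Fword x) 1 * Poly_Mapping.single (Fword y) 1
      = Poly_Mapping.single (Fword (x @ y)) (1::complex)" for x y
    by (simp add: mult_single plus_fword_def)
  have "tgen u n * Poly_Mapping.single (Fword v) 1 = Poly_Mapping.single (Fword ((u, n) # v)) 1"
    using *[of "[(u, n)]" v] by (simp add: tgen_def)
  then show ?case
    by (simp add: 2 * distrib_left left_diff_distrib mult.assoc
        flip: mult.assoc[of "tgen u n" "Poly_Mapping.single (Fword v) 1"])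
qed

lemma tens_d_mult: "tens_d (p * q) = tens_d p * q + p * tens_d q"
proof (induction p rule: tens_induct)
  case (single v c)
  show ?case
  proof (induction q rule: tens_induct)
    case (single w c')
    have *: "Poly_Mapping.single x b = tscale b (Poly_Mapping.single x 1)" for x b
      by (simp add: tscale_def mult_single)
    have "tens_d (Poly_Mapping.single v c * Poly_Mapping.single w c')
        = tscale (c * c') (deriv_word (letters v @ letters w))"
      by (simp add: mult_single tens_d_single plus_fword_def)
    also have "\<dots> = tscale c (deriv_word (letters v)) * tscale c' (Poly_Mapping.single w 1)
        + tscale c (Poly_Mapping.single v 1) * tscale c' (deriv_word (letters w))"
      by (simp add: deriv_word_append tens.scale_right_distrib tscale_mult mult_tscale mult.commute)
    finally show ?case
      by (simp add: tens_d_single flip: *)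
  qed (simp_all add: distrib_left tens_d_add tens_d_0)
qed (simp_all add: distrib_right tens_d_add tens_d_0)

section \<open>The left module \<open>V_T = T / J\<close>\<close>

definition tens_cong :: "tens \<Rightarrow> tens \<Rightarrow> bool"
  where "tens_cong a b \<longleftrightarrow> a - b \<in> tens_J"

quotient_type VT = tens / tens_cong
proof (rule equivpI)
  show "reflp tens_cong" by (simp add: reflp_def tens_cong_def tens_J_0)
  show "symp tens_cong"
    unfolding symp_def tens_cong_def by (metis diff_0 minus_diff_eq tens_J_0 tens_J_diff)
  show "transp tens_cong"
    unfolding transp_def tens_cong_def by (metis diff_add_cancel add_diff_eq tens_J_add)
qed

instantiation VT :: ab_group_add
begin

lift_definition zero_VT :: VT is 0 .

lift_definition plus_VT :: "VT \<Rightarrow> VT \<Rightarrow> VT" is "(+)"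
  unfolding tens_cong_def by (metis add_diff_add tens_J_add)

lift_definition minus_VT :: "VT \<Rightarrow> VT \<Rightarrow> VT" is "(-)"
proof -
  fix a b c d :: tens
  assume "tens_cong a b" "tens_cong c d"
  then have "(a - b) - (c - d) \<in> tens_J" unfolding tens_cong_def by (rule tens_J_diff)
  then show "tens_cong (a - c) (b - d)" by (simp add: tens_cong_def algebra_simps)
qed

lift_definition uminus_VT :: "VT \<Rightarrow> VT" is uminus
proof -
  fix a b :: tens
  assume "tens_cong a b"
  then have "0 - (a - b) \<in> tens_J" unfolding tens_cong_def by (rule tens_J_diff[OF tens_J_0])
  then show "tens_cong (- a) (- b)" by (simp add: tens_cong_def)
qed

instance proof
  fix a b c :: VT
  show "a + b + c = a + (b + c)" by transfer (simp add: tens_cong_def tens_J_0 add.assoc)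
  show "a + b = b + a" by transfer (simp add: tens_cong_def tens_J_0 add.commute)
  show "0 + a = a" by transfer (simp add: tens_cong_def tens_J_0)
  show "- a + a = 0" by transfer (simp add: tens_cong_def tens_J_0)
  show "a - b = a + - b" by transfer (simp add: tens_cong_def tens_J_0)
qed

end

lift_definition VT_one :: VT is "1 :: tens" .

lift_definition VT_scale :: "complex \<Rightarrow> VT \<Rightarrow> VT" is tscale
  unfolding tens_cong_def by (metis tens.scale_right_diff_distrib tens_J_scale)

lifting_forget poly_mapping.lifting

lift_definition VT_act :: "tens \<Rightarrow> VT \<Rightarrow> VT" is "(*)"
  unfolding tens_cong_def by (metis right_diff_distrib tens_J_mult)

global_interpretation VT: vector_space VT_scale
  by standard (transfer; simp add: tens_cong_def tens_J_0 tens.scale_right_distrib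
      tens.scale_left_distrib)+

lemma VT_truncation: "\<exists>N. \<forall>n\<ge>N. VT_act (tgen u n) w = 0"
proof (transfer fixing: u)
  fix p :: tens
  define N where "N = Max (insert 0 (word_deg ` Poly_Mapping.keys p)) + 1"
  have "tgen u n * p \<in> tens_neg" if "n \<ge> N" for n
    unfolding tens_neg_def
  proof safe
    fix w assume "w \<in> Poly_Mapping.keys (tgen u n * p)"
    then obtain w' where w': "w' \<in> Poly_Mapping.keys p" and w: "w = Fword [(u, n)] + w'"
      using keys_mult[of "tgen u n" p] by (auto simp: tgen_def split: if_splits)
    have "word_deg w' \<le> Max (insert 0 (word_deg ` Poly_Mapping.keys p))"
      using w' by (intro Max_ge) auto
    with that show "word_deg w < 0"
      by (simp add: w plus_fword_def N_def word_deg_def)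
  qed
  then show "\<exists>N. \<forall>n\<ge>N. tens_cong (tgen u n * p) 0"
    using tens_neg_subset_J by (auto simp: tens_cong_def)
qed

section \<open>The relations of \<open>A(h)\<close>\<close>

text \<open>\<open>fdiff_coeff h i j\<close> is the coefficient of \<open>x^i y^j\<close> in \<open>h(x - y)\<close>.\<close>

definition fdiff_coeff :: "complex fps \<Rightarrow> nat \<Rightarrow> nat \<Rightarrow> complex"
  where "fdiff_coeff h i j = fps_nth h (i + j) * of_nat ((i + j) choose j) * (-1) ^ j"

text \<open>For an operator family \<open>a u n = u(n)\<close>, the pairs (left-hand side, right-hand side) of the
  coefficients of \<open>z^(-m-1) w^(-n-1)\<close> in the six defining relations, applied to a vector \<open>x\<close>. In a
  product \<open>h(\<plusminus>(z - w)) b(w) a(z)\<close> the monomial \<open>z^i w^j\<close> of the first factor is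
  matched with \<open>b(n + j) a(m + i)\<close>. The sums over \<open>(i, j)\<close> have finite support as soon as
  each \<open>a u n x\<close> vanishes for large \<open>n\<close>; \<^const>\<open>Sum_any\<close> is the sum over the support.\<close>

definition Ah_relations ::
  "complex fps \<Rightarrow> (complex \<Rightarrow> 'w \<Rightarrow> 'w) \<Rightarrow> (gen \<Rightarrow> int \<Rightarrow> 'w \<Rightarrow> 'w::ab_group_add)
    \<Rightarrow> int \<Rightarrow> int \<Rightarrow> 'w \<Rightarrow> ('w \<times> 'w) set"
  where "Ah_relations h s a m n x =
   {(a E m (a E n x),
       Sum_any (\<lambda>(i, j). s (fdiff_coeff h j i) (a E (n + int j) (a E (m + int i) x)))),
    (a F m (a F n x),
       Sum_any (\<lambda>(i, j). s (fdiff_coeff h i j) (a F (n + int j) (a F (m + int i) x)))),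
    (a Psi m (a E n x),
       Sum_any (\<lambda>(i, j). s (fdiff_coeff h j i) (a E (n + int j) (a Psi (m + int i) x)))),
    (a Psi m (a F n x),
       Sum_any (\<lambda>(i, j). s (fdiff_coeff h i j) (a F (n + int j) (a Psi (m + int i) x)))),
    (a E m (a F n x) - a F n (a E m x), a Psi (m + n) x),
    (a Psi m (a Psi n x) - a Psi n (a Psi m x), 0)}"

definition restricted_Ah_module ::
  "complex fps \<Rightarrow> (complex \<Rightarrow> 'w \<Rightarrow> 'w) \<Rightarrow> (gen \<Rightarrow> int \<Rightarrow> 'w \<Rightarrow> 'w::ab_group_add) \<Rightarrow> bool"
  where "restricted_Ah_module h s a \<longleftrightarrow>
    vector_space s \<and>
    (\<forall>u n. Vector_Spaces.linear s s (a u n)) \<and>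
    (\<forall>u w. \<exists>N. \<forall>n\<ge>N. a u n w = 0) \<and>
    (\<forall>m n w. \<forall>(l, r) \<in> Ah_relations h s a m n w. l = r)"

definition Ah_submodule :: "complex fps \<Rightarrow> VT set"
  where "Ah_submodule h = VT.span
    {VT_act b (l - r) | b l r.
      \<exists>m n w. (l, r) \<in> Ah_relations h VT_scale (\<lambda>u k. VT_act (tgen u k)) m n w}"

text \<open>A HOL type cannot depend on \<open>h\<close>, so the quotient module \<open>V_T / Ah_submodule h\<close> is
  given by its quotient map: \<open>is_VAh h s a vac\<close> says that the vector space with scalar
  multiplication \<open>s\<close>, the operators \<open>a u n = u(n)\<close> and the vector \<open>vac\<close> is
  this quotient, with the induced action of the tensor algebra and \<open>vac\<close> the image of \<open>1\<close>.\<close>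

definition is_VAh ::
  "complex fps \<Rightarrow> (complex \<Rightarrow> 'v \<Rightarrow> 'v) \<Rightarrow> (gen \<Rightarrow> int \<Rightarrow> 'v \<Rightarrow> 'v::ab_group_add) \<Rightarrow> 'v \<Rightarrow> bool"
  where "is_VAh h s a vac \<longleftrightarrow>
    (\<exists>\<pi> :: VT \<Rightarrow> 'v.
      Vector_Spaces.linear VT_scale s \<pi> \<and> surj \<pi> \<and>
      {x. \<pi> x = 0} = Ah_submodule h \<and>
      (\<forall>u n x. a u n (\<pi> x) = \<pi> (VT_act (tgen u n) x)) \<and>
      vac = \<pi> VT_one)"

section \<open>Weak quantum vertex algebras and their modules\<close>

text \<open>A map \<open>Y(\<sqdot>, x)\<close> is represented by its modes: \<open>Y v n w\<close> is \<open>v\<^sub>n w\<close>, the coefficient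
  of \<open>x^(-n-1)\<close> in \<open>Y(v, x) w\<close>. The predicate says that \<open>Y(\<sqdot>, x)\<close> is a linear map
  from \<open>V\<close> to \<open>Hom(W, W((x)))\<close>.\<close>

definition field_map ::
  "(complex \<Rightarrow> 'v \<Rightarrow> 'v) \<Rightarrow> (complex \<Rightarrow> 'w \<Rightarrow> 'w)
    \<Rightarrow> ('v::ab_group_add \<Rightarrow> int \<Rightarrow> 'w \<Rightarrow> 'w::ab_group_add) \<Rightarrow> bool"
  where "field_map s t Y \<longleftrightarrow>
    (\<forall>n w. Vector_Spaces.linear s t (\<lambda>v. Y v n w)) \<and>
    (\<forall>v n. Vector_Spaces.linear t t (Y v n)) \<and>
    (\<forall>v w. \<exists>N. \<forall>n\<ge>N. Y v n w = 0)"

text \<open>\<open>bdiff n i\<close> is the coefficient of \<open>x^(n-i) y^i\<close> in \<open>(x - y)^n\<close>.\<close>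

definition bdiff :: "int \<Rightarrow> nat \<Rightarrow> complex"
  where "bdiff n i = (of_int n gchoose i) * (-1) ^ i"

text \<open>The coefficients of \<open>x\<^sub>0^(-l-1) x\<^sub>1^(-p-1) x\<^sub>2^(-q-1)\<close> in the three terms of the
  Jacobi identity, applied to \<open>w\<close>. In the first term
  \<open>x\<^sub>0^(-1) \<delta>((x\<^sub>1 - x\<^sub>2)/x\<^sub>0)\<close> contributes \<open>x\<^sub>0^(-l-1) (x\<^sub>1 - x\<^sub>2)^l\<close>.
  In the second, with \<open>f(-x\<^sub>0)\<close> contributing \<open>f\<^sub>k (-1)^k x\<^sub>0^k\<close>, the delta function contributes
  \<open>(-1)^n x\<^sub>0^(-n-1) (x\<^sub>2 - x\<^sub>1)^n\<close> for \<open>n = l + k\<close>. In the third,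
  \<open>x\<^sub>2^(-1) \<delta>((x\<^sub>1 - x\<^sub>0)/x\<^sub>2)\<close> contributes \<open>x\<^sub>2^(-n-1) (x\<^sub>1 - x\<^sub>0)^n\<close>, where the
  exponent of \<open>x\<^sub>1\<close> forces \<open>n = i - p - 1\<close> for the summand containing \<open>x\<^sub>0^i\<close>.
  All supports are finite when \<^const>\<open>field_map\<close> holds.\<close>

definition jacobi_1 ::
  "(complex \<Rightarrow> 'v \<Rightarrow> 'v) \<Rightarrow> ('v \<Rightarrow> int \<Rightarrow> 'v \<Rightarrow> 'v::ab_group_add)
    \<Rightarrow> 'v \<Rightarrow> 'v \<Rightarrow> int \<Rightarrow> int \<Rightarrow> int \<Rightarrow> 'v \<Rightarrow> 'v"
  where "jacobi_1 s Y u v l p q w =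
    Sum_any (\<lambda>i::nat. s (bdiff l i) (Y u (p + l - int i) (Y v (q + int i) w)))"

definition jacobi_2 ::
  "(complex \<Rightarrow> 'v \<Rightarrow> 'v) \<Rightarrow> ('v \<Rightarrow> int \<Rightarrow> 'v \<Rightarrow> 'v::ab_group_add)
    \<Rightarrow> complex fls \<Rightarrow> 'v \<Rightarrow> 'v \<Rightarrow> int \<Rightarrow> int \<Rightarrow> int \<Rightarrow> 'v \<Rightarrow> 'v"
  where "jacobi_2 s Y f v u l p q w =
    Sum_any (\<lambda>(k::int, i::nat).
      s (fls_nth f k * (-1) powi k * (-1) powi (l + k) * bdiff (l + k) i)
        (Y v (q + (l + k) - int i) (Y u (p + int i) w)))"

definition jacobi_3 ::
  "(complex \<Rightarrow> 'v \<Rightarrow> 'v) \<Rightarrow> ('v \<Rightarrow> int \<Rightarrow> 'v \<Rightarrow> 'v::ab_group_add)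
    \<Rightarrow> 'v \<Rightarrow> 'v \<Rightarrow> int \<Rightarrow> int \<Rightarrow> int \<Rightarrow> 'v \<Rightarrow> 'v"
  where "jacobi_3 s Y u v l p q w =
    Sum_any (\<lambda>i::nat. s (bdiff (int i - p - 1) i) (Y (Y u (l + int i) v) (p + q - int i) w))"

definition weak_quantum_vertex_algebra ::
  "(complex \<Rightarrow> 'v \<Rightarrow> 'v) \<Rightarrow> ('v \<Rightarrow> int \<Rightarrow> 'v \<Rightarrow> 'v::ab_group_add) \<Rightarrow> 'v \<Rightarrow> bool"
  where "weak_quantum_vertex_algebra s Y vac \<longleftrightarrow>
    vector_space s \<and> field_map s s Y \<and>
    (\<forall>v n. Y vac n v = (if n = -1 then v else 0)) \<and>
    (\<forall>v. (\<forall>n\<ge>0. Y v n vac = 0) \<and> Y v (-1) vac = v) \<and>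
    (\<forall>u v. \<exists>(r::nat) (v' :: nat \<Rightarrow> 'v) (u' :: nat \<Rightarrow> 'v) (f :: nat \<Rightarrow> complex fls).
      \<forall>l p q w.
        jacobi_1 s Y u v l p q w - (\<Sum>i<r. jacobi_2 s Y (f i) (v' i) (u' i) l p q w)
          = jacobi_3 s Y u v l p q w)"

text \<open>A series in \<open>x\<^sub>0, x\<^sub>2\<close> is the function taking \<open>b, c\<close> to its coefficient of
  \<open>x\<^sub>0^b x\<^sub>2^c\<close>. The first definition is multiplication by \<open>(x\<^sub>0 + x\<^sub>2)^l\<close>; the second is
  \<open>Y\<^sub>W(u, x\<^sub>0 + x\<^sub>2) Y\<^sub>W(v, x\<^sub>2) w\<close>, where \<open>u\<^sub>m (x\<^sub>0 + x\<^sub>2)^(-m-1)\<close> with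
  \<open>-m-1 = b + i\<close> contributes the monomial \<open>x\<^sub>0^b x\<^sub>2^i\<close>.\<close>

definition mult_bsum ::
  "(complex \<Rightarrow> 'w \<Rightarrow> 'w) \<Rightarrow> nat \<Rightarrow> (int \<Rightarrow> int \<Rightarrow> 'w::ab_group_add) \<Rightarrow> int \<Rightarrow> int \<Rightarrow> 'w"
  where "mult_bsum t l G b c =
    (\<Sum>j\<le>l. t (of_nat (l choose j)) (G (b - int (l - j)) (c - int j)))"

definition assoc_product ::
  "(complex \<Rightarrow> 'w \<Rightarrow> 'w) \<Rightarrow> ('v \<Rightarrow> int \<Rightarrow> 'w \<Rightarrow> 'w::ab_group_add)
    \<Rightarrow> 'v \<Rightarrow> 'v \<Rightarrow> 'w \<Rightarrow> int \<Rightarrow> int \<Rightarrow> 'w"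
  where "assoc_product t YW u v w b c =
    Sum_any (\<lambda>i::nat. t (of_int (b + int i) gchoose i)
      (YW u (- (b + int i) - 1) (YW v (- (c - int i) - 1) w)))"

definition assoc_iterate ::
  "('v \<Rightarrow> int \<Rightarrow> 'v \<Rightarrow> 'v) \<Rightarrow> ('v \<Rightarrow> int \<Rightarrow> 'w \<Rightarrow> 'w) \<Rightarrow> 'v \<Rightarrow> 'v \<Rightarrow> 'w \<Rightarrow> int \<Rightarrow> int \<Rightarrow> 'w"
  where "assoc_iterate Y YW u v w b c = YW (Y u (- b - 1) v) (- c - 1) w"

definition wqva_module ::
  "(complex \<Rightarrow> 'v \<Rightarrow> 'v) \<Rightarrow> ('v \<Rightarrow> int \<Rightarrow> 'v \<Rightarrow> 'v::ab_group_add) \<Rightarrow> 'v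
    \<Rightarrow> (complex \<Rightarrow> 'w \<Rightarrow> 'w) \<Rightarrow> ('v \<Rightarrow> int \<Rightarrow> 'w \<Rightarrow> 'w::ab_group_add) \<Rightarrow> bool"
  where "wqva_module s Y vac t YW \<longleftrightarrow>
    vector_space t \<and> field_map s t YW \<and>
    (\<forall>w n. YW vac n w = (if n = -1 then w else 0)) \<and>
    (\<forall>u v w. \<exists>l. mult_bsum t l (assoc_product t YW u v w)
                = mult_bsum t l (assoc_iterate Y YW u v w))"

end

theory Submission
  imports Defs
begin

text \<open>Composition with the translation \<open>a(z) \<mapsto> a(z + y)\<close> shows that a vacuum-like vector of a
  restricted module \<open>U\<close> determines a map from \<open>V\<close> to \<open>U[[y]]\<close>: the vacuum module is universal. To
  define \<open>Y\<^sub>W(\<sqdot>, x) w\<close> for arbitrary \<open>w\<close>, multiply \<open>e\<close>, \<open>f\<close>, \<open>\<psi>\<close> by \<open>z^l\<close>, \<open>z^l\<close>, \<open>z^(2 l)\<close>, which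
  preserves the relations and for large \<open>l\<close> makes \<open>w\<close> vacuum-like, and undo the effect by twisting
  \<open>V[x\<^sup>-\<^sup>1]\<close> with powers of \<open>z + x\<close>. This gives associativity of a generator with any vector,
  hence, by induction along the generation of \<open>V\<close>, weak associativity
  of any two vectors on any restricted module. The Jacobi identity then follows from a
  skew symmetry \<open>exp(x D) Y(u, -x) v = \<Sum> f\<^sub>i(x) Y(x\<^sub>i, x) y\<^sub>i\<close>. For a generator \<open>u\<close> it is obtained by
  induction on \<open>v\<close> from the defining relations, and for general \<open>u\<close> from the locality of the generators
  that this case provides. Uniqueness holds because associativity with the generators
  determines a vertex operator map recursively.\<close>

section \<open>Expansions in two variables\<close>

text \<open>Every identity is treated through functionals \<open>x0^l x1^p x2^q\<close> with
  \<open>x0 = x1 - x2\<close>. Products and iterates expand them in different directions, so the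
  argument rests on a recursion shared by all terms and on cancelling powers such as
  \<open>(z + x)^k\<close>. Cancellation is legitimate only for families that vanish for large
  values of one index, and many auxiliary lemmas supply such truncation. The tensor quotient divides
  by all \<open>d\<close>-derivatives of tensors of negative degree. Power series in an extra
  variable y make \<open>d\<close> act as d/dy, so the kernel of evaluation is visibly stable under
  \<open>d\<close>. The factor given to psi must be the product of those given to e and f: the delta
  function in the commutator identifies their two variables. No derivation D on V is given; it is
  read off from \<open>Y(u,x)1 = exp(xD)u\<close>. The power needed for associativity with a
  generator depends on the vector acted on, so no single power serves all coefficients of
  \<open>Y(v,x2)w\<close>. Passing to two arbitrary vectors with a bound free of the other exponents
  therefore needs a nested induction.\<close>

lemma Sum_any_lessThan:
  fixes f :: "nat \<Rightarrow> 'a::comm_monoid_add"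
  assumes "\<And>i. i \<ge> N \<Longrightarrow> f i = 0"
  shows "Sum_any f = sum f {..<N}"
  by (rule Sum_any.expand_superset) (use assms not_le in auto)

lemma bdiff_0 [simp]: "bdiff n 0 = 1"
  by (simp add: bdiff_def)

lemma bdiff_Suc_add: "bdiff (n + 1) (Suc i) = bdiff n (Suc i) - bdiff n i"
proof -
  have "(((of_int n :: complex) + 1) gchoose (Suc i)) = (of_int n gchoose i) + (of_int n gchoose (Suc i))"
    by (rule gbinomial_Suc_Suc)
  then show ?thesis by (simp add: bdiff_def algebra_simps)
qed

text \<open>Upper negation. It turns the coefficient of \<open>(x1 - x0)^(i - p - 1)\<close> in the
  third Jacobi term into that of \<open>(x2 + x0)^p\<close>.\<close>

lemma bdiff_neg: "bdiff (int i - p - 1) i = (of_int p gchoose i)"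
proof -
  have "((of_int p :: complex) gchoose i) = (- 1) ^ i * ((of_nat i - of_int p - 1) gchoose i)"
    by (rule gbinomial_negated_upper)
  then show ?thesis by (simp add: bdiff_def mult.commute)
qed

text \<open>The expansion of a product in nonnegative powers of the second variable: \<open>twist t G n m l\<close>
  is the coefficient functional \<open>(x - y)^n x^m y^l\<close>.\<close>

definition twist ::
  "(complex \<Rightarrow> 'w \<Rightarrow> 'w) \<Rightarrow> (int \<Rightarrow> int \<Rightarrow> 'w::ab_group_add) \<Rightarrow> int \<Rightarrow> int \<Rightarrow> int \<Rightarrow> 'w"
  where "twist t G n m l = Sum_any (\<lambda>i. t (bdiff n i) (G (m + n - int i) (l + int i)))"

text \<open>By \<open>bdiff_neg\<close> this is the functional \<open>x0^l (x2 + x0)^p x2^q\<close>,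
  the counterpart of \<open>twist\<close> for a series \<open>K\<close> in \<open>x0\<close> and
  \<open>x2\<close>. The shape of the coefficient is that of \<open>jacobi_3\<close>.\<close>

definition iter ::
  "(complex \<Rightarrow> 'w \<Rightarrow> 'w) \<Rightarrow> (int \<Rightarrow> int \<Rightarrow> 'w::ab_group_add) \<Rightarrow> int \<Rightarrow> int \<Rightarrow> int \<Rightarrow> 'w"
  where "iter t K l p q = Sum_any (\<lambda>i. t (bdiff (int i - p - 1) i) (K (l + int i) (p + q - int i)))"

locale cspace = vector_space t for t :: "complex \<Rightarrow> 'w::ab_group_add \<Rightarrow> 'w"
begin

lemma twist_sum:
  assumes "\<And>N j. j \<ge> L \<Longrightarrow> G N j = 0" "L \<le> l + int K"
  shows "twist t G n m l = (\<Sum>i<K. t (bdiff n i) (G (m + n - int i) (l + int i)))"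
  unfolding twist_def by (rule Sum_any_lessThan) (use assms in auto)

lemma iter_sum:
  assumes "\<And>j N. j \<ge> L \<Longrightarrow> K j N = 0" "L \<le> l + int M"
  shows "iter t K l p q
    = (\<Sum>i<M. t (of_int p gchoose i) (K (l + int i) (p + q - int i)))"
  unfolding iter_def bdiff_neg by (rule Sum_any_lessThan) (use assms in auto)

text \<open>Pascal's rule, that is, one factor \<open>x - y\<close> multiplied out. Together with
  \<open>iter_rec\<close> it shows that products and iterates obey the same law for
  \<open>x0 = x1 - x2\<close>; the bound \<open>L\<close> makes all sums involved finite.\<close>

lemma twist_rec:
  assumes "\<And>N j. j \<ge> L \<Longrightarrow> G N j = 0"
  shows "twist t G (n + 1) m l = twist t G n (m + 1) l - twist t G n m (l + 1)"
proof -
  define K where "K = nat (L - l)"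
  have K: "L \<le> l + int K" "L \<le> l + int (Suc K)" "L \<le> (l + 1) + int K" unfolding K_def by auto
  have "twist t G n (m + 1) l
    = t (bdiff n 0) (G (m + n + 1) l)
      + (\<Sum>i<K. t (bdiff n (Suc i)) (G (m + n - int i) (l + 1 + int i)))"
    by (subst twist_sum[OF assms K(2)], assumption, subst sum.lessThan_Suc_shift) (simp add: algebra_simps)
  moreover have "twist t G (n + 1) m l
    = t (bdiff n 0) (G (m + n + 1) l)
      + (\<Sum>i<K. t (bdiff (n + 1) (Suc i)) (G (m + n - int i) (l + 1 + int i)))"
    by (subst twist_sum[OF assms K(2)], assumption, subst sum.lessThan_Suc_shift) (simp add: algebra_simps)
  moreover have "twist t G n m (l + 1)
    = (\<Sum>i<K. t (bdiff n i) (G (m + n - int i) (l + 1 + int i)))"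
    by (subst twist_sum[OF assms K(3)], assumption) simp
  ultimately show ?thesis
    by (simp add: bdiff_Suc_add scale_left_diff_distrib sum_subtractf)
qed

lemma iter_rec:
  assumes "\<And>j N. j \<ge> L \<Longrightarrow> K j N = 0"
  shows "iter t K (l + 1) p q = iter t K l (p + 1) q - iter t K l p (q + 1)"
proof -
  define M where "M = nat (L - l)"
  have M: "L \<le> l + int M" "L \<le> l + int (Suc M)" "L \<le> (l + 1) + int M" unfolding M_def by auto
  have "iter t K l (p + 1) q = K l (p + q + 1)
      + (\<Sum>i<M. t (of_int (p + 1) gchoose (Suc i)) (K (l + 1 + int i) (p + q - int i)))"
    by (subst iter_sum[OF assms M(2)], assumption, subst sum.lessThan_Suc_shift) (simp add: algebra_simps)
  moreover have "iter t K l p (q + 1) = K l (p + q + 1)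
      + (\<Sum>i<M. t (of_int p gchoose (Suc i)) (K (l + 1 + int i) (p + q - int i)))"
    by (subst iter_sum[OF assms M(2)], assumption, subst sum.lessThan_Suc_shift) (simp add: algebra_simps)
  moreover have "iter t K (l + 1) p q
      = (\<Sum>i<M. t (of_int p gchoose i) (K (l + 1 + int i) (p + q - int i)))"
    by (subst iter_sum[OF assms M(3)], assumption) simp
  ultimately show ?thesis
    by (simp add: gbinomial_Suc_Suc scale_left_distrib sum.distrib)
qed

lemma twist_0:
  assumes "\<And>N j. j \<ge> L \<Longrightarrow> G N j = 0"
  shows "twist t G 0 m l = G m l"
proof -
  have "twist t G 0 m l = (\<Sum>i<Suc (nat (L - l)). t (bdiff 0 i) (G (m + 0 - int i) (l + int i)))"
    by (rule twist_sum[OF assms]) auto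
  also have "\<dots> = G m l"
    by (subst sum.lessThan_Suc_shift) (simp add: bdiff_def)
  finally show ?thesis .
qed

lemma iter_0:
  assumes "\<And>j N. j \<ge> L \<Longrightarrow> K j N = 0"
  shows "iter t K l 0 q = K l q"
proof -
  have "iter t K l 0 q
    = (\<Sum>i<Suc (nat (L - l)). t (of_int 0 gchoose i) (K (l + int i) (0 + q - int i)))"
    by (rule iter_sum[OF assms]) auto
  also have "\<dots> = K l q"
    by (subst sum.lessThan_Suc_shift) simp
  finally show ?thesis .
qed

lemma twist_eq_0:
  assumes "\<And>N j. j \<ge> L \<Longrightarrow> G N j = 0" "l \<ge> L"
  shows "twist t G n m l = 0"
  using twist_sum[OF assms(1), where K = 0 and l = l] assms(2) by simp

lemma iter_eq_0:
  assumes "\<And>j N. j \<ge> L \<Longrightarrow> K j N = 0" "l \<ge> L"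
  shows "iter t K l p q = 0"
  using iter_sum[OF assms(1), where M = 0 and l = l] assms(2) by simp

end

text \<open>\<open>zbin s\<close> is multiplication by \<open>(x + y)^s\<close>.\<close>

fun zbin :: "nat \<Rightarrow> (int \<Rightarrow> int \<Rightarrow> 'w::ab_group_add) \<Rightarrow> int \<Rightarrow> int \<Rightarrow> 'w" where
  "zbin 0 f n p = f n p"
| "zbin (Suc s) f n p = zbin s f (n + 1) p + zbin s f n (p + 1)"

text \<open>The hypothesis says that the sum of the two variables acts on \<open>T\<close> as the
  variable counted by \<open>p\<close>, so its s-th power raises \<open>p\<close> by
  \<open>s\<close>.\<close>

lemma zbin_rec:
  assumes "\<And>n p j. T (n + 1) p j + T n p (j + 1) = T n (p + 1) j"
  shows "zbin s (\<lambda>n j. T n p j) n j = T n (p + int s) j"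
proof (induction s arbitrary: n j p)
  case (Suc s)
  have "T (n + 1) (p + int s) j + T n (p + int s) (j + 1) = T n (p + int s + 1) j" by (rule assms)
  then show ?case by (simp add: Suc add_ac)
qed simp

lemma zbin_zbin: "zbin r (zbin s f) n p = zbin (r + s) f n p"
  by (induction r arbitrary: n p) auto

lemma zbin_diff: "zbin s (\<lambda>n p. f n p - g n p) n p = zbin s f n p - zbin s g n p"
proof (induction s arbitrary: n p)
  case (Suc s)
  show ?case by (simp only: zbin.simps Suc) simp
qed simp

text \<open>Multiplication by \<open>(x + y)^s\<close> is triangular in the first index: at the
  topmost nonzero row only the pure power of y survives. This is how factors
  \<open>(x + y)^s\<close> are cancelled.\<close>

lemma zbin_lead:
  assumes "\<And>n' p. n' > n \<Longrightarrow> p \<ge> p0 \<Longrightarrow> f n' p = 0" "p \<ge> p0"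
  shows "zbin s f n p = f n (p + int s)"
proof -
  have *: "zbin s f n' p = 0" if "n' > n" "p \<ge> p0" for n' p s
    using that by (induction s arbitrary: n' p) (auto simp: assms(1))
  show ?thesis
    using assms(2) by (induction s arbitrary: p) (auto simp: * add_ac)
qed

lemma (in cspace) zbin_sum:
  "zbin s f n p = (\<Sum>i\<le>s. t (of_nat (s choose i)) (f (n + int i) (p + int (s - i))))"
proof (induction s arbitrary: n p)
  case (Suc s)
  have "zbin (Suc s) f n p
     = (\<Sum>i\<le>s. t (of_nat (s choose i)) (f (n + int (Suc i)) (p + int (s - i))))
     + (\<Sum>i\<le>s. t (of_nat (s choose i)) (f (n + int i) (p + int (Suc s - i))))"
    by (auto simp: Suc add_ac Suc_diff_le intro!: arg_cong2[where f = "(+)"] sum.cong)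
  also have "(\<Sum>i\<le>s. t (of_nat (s choose i)) (f (n + int i) (p + int (Suc s - i))))
     = (\<Sum>i\<le>Suc s. t (of_nat (s choose i)) (f (n + int i) (p + int (Suc s - i))))"
    by simp
  also have "\<dots> = f n (p + int (Suc s)) +
      (\<Sum>i\<le>s. t (of_nat (s choose Suc i)) (f (n + int (Suc i)) (p + int (s - i))))"
    by (subst sum.atMost_Suc_shift) simp
  finally show ?case
    by (subst sum.atMost_Suc_shift) (simp add: scale_left_distrib sum.distrib add_ac)
qed simp

section \<open>Power series in a linear form, acting on doubly indexed families\<close>

lemma fps_nth_compose_uminus_X: "fps_nth (f oo (- fps_X)) r = (- 1) ^ r * fps_nth (f :: complex fps) r"
proof -
  have "- fps_X = fps_const (- 1) * (fps_X :: complex fps)"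
    by (simp flip: fps_const_neg)
  then show ?thesis by (simp only: fps_compose_linear) simp
qed

text \<open>With \<open>e = -1\<close> this is multiplication by \<open>w - z\<close>, the argument
  of h in the relations; with \<open>e = 1\<close> it is multiplication by
  \<open>z + x\<close>.\<close>

definition shift2 ::
  "(complex \<Rightarrow> 'w \<Rightarrow> 'w) \<Rightarrow> complex \<Rightarrow> (int \<Rightarrow> int \<Rightarrow> 'w::ab_group_add) \<Rightarrow> int \<Rightarrow> int \<Rightarrow> 'w"
  where "shift2 t e f m n = f m (n + 1) + t e (f (m + 1) n)"

text \<open>The bound is on the total degree \<open>i + j\<close> above the corner
  \<open>(m, n)\<close>, because the r-th power of a linear form reaches exactly the diagonal
  \<open>i + j = r\<close>.\<close>

definition vanish_above :: "(int \<Rightarrow> int \<Rightarrow> 'w::zero) \<Rightarrow> int \<Rightarrow> int \<Rightarrow> nat \<Rightarrow> bool"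
  where "vanish_above f m n N \<longleftrightarrow> (\<forall>i j. N \<le> i + j \<longrightarrow> f (m + int i) (n + int j) = 0)"

definition bounded2 :: "(int \<Rightarrow> int \<Rightarrow> 'w::zero) \<Rightarrow> bool"
  where "bounded2 f \<longleftrightarrow> (\<forall>m n. \<exists>N. vanish_above f m n N)"

text \<open>The action of \<open>g(y + e x)\<close>, for a power series \<open>g\<close>, where \<open>x\<close> and \<open>y\<close> raise the first and the
  second index.\<close>

definition fps_act ::
  "(complex \<Rightarrow> 'w \<Rightarrow> 'w) \<Rightarrow> complex fps \<Rightarrow> complex \<Rightarrow> (int \<Rightarrow> int \<Rightarrow> 'w::ab_group_add) \<Rightarrow> int \<Rightarrow> int \<Rightarrow> 'w"
  where "fps_act t g e f m n = Sum_any (\<lambda>r. t (fps_nth g r) ((shift2 t e ^^ r) f m n))"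

lemma vanish_above_mono: "vanish_above f m n N \<Longrightarrow> N \<le> K \<Longrightarrow> vanish_above f m n K"
  by (auto simp: vanish_above_def)

lemma vanish_above_add:
  "vanish_above f m n N \<Longrightarrow> vanish_above f (m + int i) (n + int j) (N - (i + j))"
  unfolding vanish_above_def
proof (intro allI impI)
  fix i' j' assume *: "\<forall>i j. N \<le> i + j \<longrightarrow> f (m + int i) (n + int j) = 0" "N - (i + j) \<le> i' + j'"
  from *(2) have "N \<le> (i + i') + (j + j')" by simp
  with *(1) have "f (m + int (i + i')) (n + int (j + j')) = 0" by blast
  then show "f (m + int i + int i') (n + int j + int j') = 0" by (simp add: add_ac)
qed

lemma vanish_above_shift:
  assumes "vanish_above f m n N"
  shows "vanish_above f (m + int i) (n + int j) N"
  using vanish_above_mono[OF vanish_above_add[OF assms, of i j], of N] by simp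

text \<open>These are the truncation properties of a product of two fields: the inner operator kills
  the vector for large index, and over the finitely many remaining inner indices the outer bound can
  be taken uniform.\<close>

lemma bounded2I:
  assumes "\<And>k n. k \<ge> M \<Longrightarrow> f k n = 0" and "\<And>m. \<exists>J. \<forall>k\<ge>m. \<forall>n\<ge>J. f k n = 0"
  shows "bounded2 f"
  unfolding bounded2_def vanish_above_def
proof (intro allI)
  fix m n
  obtain J where J: "\<And>k n. k \<ge> m \<Longrightarrow> n \<ge> J \<Longrightarrow> f k n = 0" using assms(2) by blast
  show "\<exists>N. \<forall>i j. N \<le> i + j \<longrightarrow> f (m + int i) (n + int j) = 0"
  proof (intro exI allI impI)
    fix i j assume *: "nat (M - m) + nat (J - n) \<le> i + j"
    show "f (m + int i) (n + int j) = 0"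
    proof (cases "m + int i \<ge> M")
      case True then show ?thesis by (rule assms(1))
    next
      case False
      with * have "n + int j \<ge> J" by linarith
      then show ?thesis by (intro J) auto
    qed
  qed
qed

lemma ex_uniform_bound:
  assumes "finite A" "\<And>k. k \<in> A \<Longrightarrow> \<exists>J::int. \<forall>n\<ge>J. P k n"
  shows "\<exists>J. \<forall>k\<in>A. \<forall>n\<ge>J. P k n"
  using assms
proof (induction A rule: finite_induct)
  case (insert x B)
  have "\<exists>J. \<forall>k\<in>B. \<forall>n\<ge>J. P k n" by (rule insert.IH) (rule insert.prems, simp)
  then obtain J where J: "\<forall>k\<in>B. \<forall>n\<ge>J. P k n" ..
  have "\<exists>J. \<forall>n\<ge>J. P x n" by (rule insert.prems) simp
  then obtain J' where J': "\<forall>n\<ge>J'. P x n" ..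
  have "\<forall>k\<in>insert x B. \<forall>n\<ge>max J J'. P k n" using J J' by simp
  then show ?case ..
qed auto

context cspace
begin

lemma shift2_pow_sum:
  "(shift2 t e ^^ r) f m n = (\<Sum>i\<le>r. t (of_nat (r choose i) * e ^ i) (f (m + int i) (n + int (r - i))))"
proof (induction r arbitrary: m n)
  case (Suc r)
  let ?c = "\<lambda>r i. of_nat (r choose i) * e ^ i"
  have "(shift2 t e ^^ Suc r) f m n = (shift2 t e ^^ r) f m (n + 1) + t e ((shift2 t e ^^ r) f (m + 1) n)"
    by (simp add: shift2_def)
  also have "t e ((shift2 t e ^^ r) f (m + 1) n)
     = (\<Sum>i\<le>r. t (of_nat (r choose i) * e ^ Suc i) (f (m + int (Suc i)) (n + int (r - i))))"
    by (simp add: Suc scale_sum_right mult_ac add_ac)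
  also have "(shift2 t e ^^ r) f m (n + 1)
     = (\<Sum>i\<le>Suc r. t (?c r i) (f (m + int i) (n + int (Suc r - i))))"
    by (simp add: Suc binomial_eq_0 add_ac of_nat_diff, intro sum.cong) (auto simp: of_nat_diff algebra_simps)
  also have "\<dots> = f m (n + int (Suc r)) +
      (\<Sum>i\<le>r. t (?c r (Suc i)) (f (m + int (Suc i)) (n + int (r - i))))"
    by (subst sum.atMost_Suc_shift) simp
  finally show ?case
    by (subst sum.atMost_Suc_shift) (simp add: scale_left_distrib sum.distrib add_ac distrib_right)
qed simp

lemma shift2_pow_eq_0:
  assumes "vanish_above f m n N" "N \<le> r"
  shows "(shift2 t e ^^ r) f m n = 0"
  unfolding shift2_pow_sum
proof (intro sum.neutral ballI)
  fix i assume "i \<in> {..r}"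
  with assms(2) have "N \<le> i + (r - i)" by auto
  with assms(1) have "f (m + int i) (n + int (r - i)) = 0" by (simp only: vanish_above_def)
  then show "t (of_nat (r choose i) * e ^ i) (f (m + int i) (n + int (r - i))) = 0" by simp
qed

lemma fps_act_sum:
  assumes "vanish_above f m n N" "N \<le> K"
  shows "fps_act t g e f m n = (\<Sum>r<K. t (fps_nth g r) ((shift2 t e ^^ r) f m n))"
  unfolding fps_act_def
  by (rule Sum_any_lessThan) (use assms shift2_pow_eq_0 in auto)

lemma shift2_pow_commute_index:
  "(shift2 t e ^^ r) f (m + a) (n + b) = (shift2 t e ^^ r) (\<lambda>m n. f (m + a) (n + b)) m n"
  by (simp add: shift2_pow_sum add_ac)

lemma fps_act_commute_index:
  "fps_act t g e f (m + a) (n + b) = fps_act t g e (\<lambda>m n. f (m + a) (n + b)) m n"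
  by (simp add: fps_act_def shift2_pow_commute_index)

lemma vanish_above_shift2_pow:
  "vanish_above f m n N \<Longrightarrow> vanish_above ((shift2 t e ^^ r) f) m n (N - r)"
  unfolding vanish_above_def
proof (intro allI impI)
  fix i j assume *: "\<forall>i j. N \<le> i + j \<longrightarrow> f (m + int i) (n + int j) = 0" "N - r \<le> i + j"
  show "(shift2 t e ^^ r) f (m + int i) (n + int j) = 0"
    unfolding shift2_pow_sum
  proof (intro sum.neutral ballI)
    fix x assume "x \<in> {..r}"
    with *(2) have "N \<le> (i + x) + (j + (r - x))" by auto
    with *(1) have "f (m + int (i + x)) (n + int (j + (r - x))) = 0" by blast
    then show "t (of_nat (r choose x) * e ^ x) (f (m + int i + int x) (n + int j + int (r - x))) = 0"
      by (simp add: add_ac)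
  qed
qed

lemma vanish_above_fps_act:
  assumes "vanish_above f m n N"
  shows "vanish_above (fps_act t g e f) m n N"
  unfolding vanish_above_def
proof (intro allI impI)
  fix i j assume "N \<le> i + j"
  then have "vanish_above f (m + int i) (n + int j) 0"
    using vanish_above_add[OF assms, of i j] by simp
  then show "fps_act t g e f (m + int i) (n + int j) = 0"
    by (simp add: fps_act_sum[of _ _ _ 0 0])
qed

lemma bounded2_fps_act: "bounded2 f \<Longrightarrow> bounded2 (fps_act t g e f)"
  unfolding bounded2_def using vanish_above_fps_act by blast

lemma shift2_pow_sum_fun:
  "(shift2 t e ^^ r) (\<lambda>m n. \<Sum>k\<in>A. t (c k) (f k m n)) m n
    = (\<Sum>k\<in>A. t (c k) ((shift2 t e ^^ r) (f k) m n))"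
  by (simp add: shift2_pow_sum scale_sum_right mult_ac sum.swap[of _ A])

lemma shift2_pow_diff:
  "(shift2 t e ^^ r) (\<lambda>m n. f m n - g m n) m n = (shift2 t e ^^ r) f m n - (shift2 t e ^^ r) g m n"
  by (simp add: shift2_pow_sum scale_right_diff_distrib sum_subtractf)

lemma shift2_pow_add:
  "(shift2 t e ^^ r) (\<lambda>m n. f m n + g m n) m n = (shift2 t e ^^ r) f m n + (shift2 t e ^^ r) g m n"
  by (simp add: shift2_pow_sum scale_right_distrib sum.distrib)

lemma shift2_pow_cong:
  assumes "\<And>i j. f (m + int i) (n + int j) = g (m + int i) (n + int j)"
  shows "(shift2 t e ^^ r) f m n = (shift2 t e ^^ r) g m n"
  unfolding shift2_pow_sum assms ..

lemma shift2_pow_fps_act: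
  assumes "bounded2 f"
  shows "(shift2 t e ^^ r) (fps_act t g e f) m n = fps_act t g e ((shift2 t e ^^ r) f) m n"
proof -
  obtain N where N: "vanish_above f m n N" using assms by (auto simp: bounded2_def)
  have "fps_act t g e f (m + int i) (n + int j)
      = (\<Sum>k<N. t (fps_nth g k) ((shift2 t e ^^ k) f (m + int i) (n + int j)))" for i j
    by (rule fps_act_sum[OF vanish_above_shift[OF N] order_refl])
  then have "(shift2 t e ^^ r) (fps_act t g e f) m n
      = (shift2 t e ^^ r) (\<lambda>m n. \<Sum>k<N. t (fps_nth g k) ((shift2 t e ^^ k) f m n)) m n"
    by (rule shift2_pow_cong)
  also have "\<dots> = (\<Sum>k<N. t (fps_nth g k) ((shift2 t e ^^ r) ((shift2 t e ^^ k) f) m n))"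
    by (rule shift2_pow_sum_fun)
  also have "\<dots> = (\<Sum>k<N. t (fps_nth g k) ((shift2 t e ^^ k) ((shift2 t e ^^ r) f) m n))"
    by (simp flip: funpow_add[THEN fun_cong, unfolded o_apply] add: add.commute)
  also have "\<dots> = fps_act t g e ((shift2 t e ^^ r) f) m n"
    by (rule fps_act_sum[symmetric, OF vanish_above_shift2_pow[OF N]]) simp
  finally show ?thesis .
qed

lemma fps_act_one: "fps_act t 1 e f m n = f m n"
proof -
  have "fps_act t 1 e f m n = (\<Sum>r<Suc 0. t (fps_nth 1 r) ((shift2 t e ^^ r) f m n))"
    unfolding fps_act_def by (rule Sum_any_lessThan) auto
  then show ?thesis by simp
qed

text \<open>Regroups the finite double sum along diagonals, as in the Cauchy product. It lets
  \<open>h(t) h(-t) = 1\<close> invert a relation.\<close>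

lemma fps_act_mult:
  assumes "bounded2 f"
  shows "fps_act t g1 e (fps_act t g2 e f) m n = fps_act t (g1 * g2) e f m n"
proof -
  obtain N where N: "vanish_above f m n N" using assms by (auto simp: bounded2_def)
  let ?S = "\<lambda>r. (shift2 t e ^^ r) f m n"
  have *: "(shift2 t e ^^ r) (fps_act t g2 e f) m n = (\<Sum>k<N. t (fps_nth g2 k) (?S (r + k)))" for r
  proof -
    have "(shift2 t e ^^ r) (fps_act t g2 e f) m n = fps_act t g2 e ((shift2 t e ^^ r) f) m n"
      by (rule shift2_pow_fps_act[OF assms])
    also have "\<dots> = (\<Sum>k<N. t (fps_nth g2 k) ((shift2 t e ^^ k) ((shift2 t e ^^ r) f) m n))"
      by (rule fps_act_sum[OF vanish_above_shift2_pow[OF N]]) simp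
    finally show ?thesis
      by (simp flip: funpow_add[THEN fun_cong, unfolded o_apply] add: add.commute)
  qed
  have z: "?S r = 0" if "r \<ge> N" for r using shift2_pow_eq_0[OF N that] .
  have "fps_act t g1 e (fps_act t g2 e f) m n
      = (\<Sum>r<N. t (fps_nth g1 r) (\<Sum>k<N. t (fps_nth g2 k) (?S (r + k))))"
    by (simp add: fps_act_sum[OF vanish_above_fps_act[OF N] order_refl] *)
  also have "\<dots> = (\<Sum>(r, k)\<in>{..<N} \<times> {..<N}. t (fps_nth g1 r * fps_nth g2 k) (?S (r + k)))"
    by (simp add: scale_sum_right sum.cartesian_product)
  also have "\<dots> = (\<Sum>(r, k)\<in>{(r, k). r + k < N}. t (fps_nth g1 r * fps_nth g2 k) (?S (r + k)))"
    by (rule sum.mono_neutral_right) (auto, metis z not_less)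
  also have "\<dots> = (\<Sum>q<N. \<Sum>r\<le>q. t (fps_nth g1 r * fps_nth g2 (q - r)) (?S q))"
    by (subst sum.triangle_reindex) simp
  also have "\<dots> = fps_act t (g1 * g2) e f m n"
    by (simp add: fps_act_sum[OF N order_refl] fps_mult_nth scale_sum_left atLeast0AtMost)
  finally show ?thesis .
qed

text \<open>Exchanging the variables replaces \<open>w - z\<close> by \<open>z - w\<close>, hence
  g(t) by g(-t).\<close>

lemma fps_act_transpose:
  "fps_act t g (- 1) (\<lambda>m n. f n m) m n = fps_act t (g oo (- fps_X)) (- 1) f n m"
proof -
  have "(shift2 t (- 1) ^^ r) (\<lambda>m n. f n m) m n = t ((- 1) ^ r) ((shift2 t (- 1) ^^ r) f n m)" for r
    by (induction r arbitrary: m n) (auto simp: shift2_def scale_right_diff_distrib algebra_simps)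
  then show ?thesis
    by (simp add: fps_act_def fps_nth_compose_uminus_X mult.commute)
qed

text \<open>In this form the coefficients of the relations of \<open>A(h)\<close> appear.\<close>

lemma fps_act_double_sum:
  assumes "vanish_above f m n N"
  shows "fps_act t g (- 1) f m n
    = (\<Sum>(i, j)\<in>{(i, j). i + j < N}. t (fdiff_coeff g j i) (f (m + int i) (n + int j)))"
proof -
  have "fps_act t g (- 1) f m n
    = (\<Sum>r<N. \<Sum>i\<le>r. t (fdiff_coeff g (r - i) i) (f (m + int i) (n + int (r - i))))"
    by (auto simp: fps_act_sum[OF assms order_refl] shift2_pow_sum scale_sum_right fdiff_coeff_def mult_ac
        intro!: sum.cong)
  also have "\<dots> = (\<Sum>(i, j)\<in>{(i, j). i + j < N}. t (fdiff_coeff g j i) (f (m + int i) (n + int j)))"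
    by (subst sum.triangle_reindex) simp
  finally show ?thesis .
qed

lemma fps_act_Sum_any:
  assumes "vanish_above f m n N"
  shows "fps_act t g (- 1) f m n
    = Sum_any (\<lambda>(i, j). t (fdiff_coeff g j i) (f (m + int i) (n + int j)))"
proof -
  have fin: "finite {(i, j). i + j < N}"
    by (rule finite_subset[of _ "{..<N} \<times> {..<N}"]) auto
  show ?thesis unfolding fps_act_double_sum[OF assms]
    by (rule Sum_any.expand_superset[symmetric, OF fin])
      (use assms in \<open>auto simp: vanish_above_def not_less intro: ccontr\<close>)
qed

end

section \<open>The defining relations\<close>

text \<open>With \<open>h(t) h(-t) = 1\<close> the six relations imply, for all \<open>u, v\<close>, that
  \<open>u(z) v(w) = gfac h u v (w - z) v(w) u(z)\<close> up to the delta function term with factor \<open>geps u v\<close>.\<close>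

definition gfac :: "complex fps \<Rightarrow> gen \<Rightarrow> gen \<Rightarrow> complex fps"
  where "gfac h u v =
    (if (u, v) \<in> {(E, E), (E, Psi), (Psi, E)} then h
     else if (u, v) \<in> {(F, F), (F, Psi), (Psi, F)} then h oo (- fps_X) else 1)"

definition geps :: "gen \<Rightarrow> gen \<Rightarrow> complex"
  where "geps u v = (if (u, v) = (E, F) then 1 else if (u, v) = (F, E) then - 1 else 0)"

locale op_family = cspace t for t :: "complex \<Rightarrow> 'w::ab_group_add \<Rightarrow> 'w" +
  fixes b :: "gen \<Rightarrow> int \<Rightarrow> 'w \<Rightarrow> 'w"
  assumes b_linear: "Vector_Spaces.linear t t (b u n)"
    and b_trunc: "\<exists>N. \<forall>n\<ge>N. b u n w = 0"
begin

lemma b_add: "b u n (x + y) = b u n x + b u n y"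
  and b_scale: "b u n (t c x) = t c (b u n x)"
  using b_linear[of u n] by (simp_all add: Vector_Spaces.linear_iff)

lemma b_0 [simp]: "b u n 0 = 0"
  using b_scale[of u n 0 0] by simp

lemma b_sum: "b u n (sum f A) = (\<Sum>k\<in>A. b u n (f k))"
  by (induction A rule: infinite_finite_induct) (auto simp: b_add)

lemma b_trunc2: "\<exists>J. \<forall>k\<ge>m. \<forall>n\<ge>J. b v n (b u k x) = 0"
proof -
  obtain M where M: "\<And>k. k \<ge> M \<Longrightarrow> b u k x = 0" using b_trunc by blast
  have "\<exists>J. \<forall>k\<in>{m..M}. \<forall>n\<ge>J. b v n (b u k x) = 0"
    by (rule ex_uniform_bound) (auto intro: b_trunc)
  then obtain J where "\<forall>k\<in>{m..M}. \<forall>n\<ge>J. b v n (b u k x) = 0" ..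
  then have "\<forall>k\<ge>m. \<forall>n\<ge>J. b v n (b u k x) = 0"
    using M by (metis atLeastAtMost_iff b_0 linear)
  then show ?thesis ..
qed

lemma b_bounded2: "bounded2 (\<lambda>m n. b v n (b u m x))"
proof -
  obtain M where "\<And>k. k \<ge> M \<Longrightarrow> b u k x = 0" using b_trunc by blast
  then show ?thesis by (intro bounded2I[of M] b_trunc2) simp
qed

end

locale Ah_module = op_family t b for t :: "complex \<Rightarrow> 'w::ab_group_add \<Rightarrow> 'w" and b +
  fixes h :: "complex fps"
  assumes rel: "b u m (b v n x) = fps_act t (gfac h u v) (- 1) (\<lambda>m n. b v n (b u m x)) m n
      + t (geps u v) (b Psi (m + n) x)"

lemma fdiff_coeff_flip: "fdiff_coeff (h oo (- fps_X)) j i = fdiff_coeff h i j"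
proof -
  have *: "(i + j choose j) = (i + j choose i)" by (metis add_diff_cancel_left' binomial_symmetric le_add1)
  have "(- 1) ^ (i + j) * (- 1) ^ i = ((- 1) ^ j :: complex)"
    by (simp add: power_add mult_ac flip: power_mult_distrib)
  with * show ?thesis
    by (simp add: fdiff_coeff_def fps_nth_compose_uminus_X add.commute[of j i] mult_ac)
qed

lemma compose_uminus_X_twice: "(h oo (- fps_X)) oo (- fps_X) = (h :: complex fps)"
  by (rule fps_ext) (simp add: fps_nth_compose_uminus_X flip: mult.assoc power_add)

lemma (in op_family) fps_act_op_Sum_any:
  "fps_act t g (- 1) (\<lambda>m n. b v n (b u m x)) m n
    = Sum_any (\<lambda>(i, j). t (fdiff_coeff g j i) (b v (n + int j) (b u (m + int i) x)))"
proof -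
  obtain N where "vanish_above (\<lambda>m n. b v n (b u m x)) m n N"
    using b_bounded2[of v u x] by (auto simp: bounded2_def)
  from fps_act_Sum_any[OF this, of g] show ?thesis .
qed

lemma (in op_family) Ah_relations_fps_act:
  "Ah_relations h t b m n x =
   {(b E m (b E n x), fps_act t h (- 1) (\<lambda>m n. b E n (b E m x)) m n),
    (b F m (b F n x), fps_act t (h oo (- fps_X)) (- 1) (\<lambda>m n. b F n (b F m x)) m n),
    (b Psi m (b E n x), fps_act t h (- 1) (\<lambda>m n. b E n (b Psi m x)) m n),
    (b Psi m (b F n x), fps_act t (h oo (- fps_X)) (- 1) (\<lambda>m n. b F n (b Psi m x)) m n),
    (b E m (b F n x) - b F n (b E m x), b Psi (m + n) x),
    (b Psi m (b Psi n x) - b Psi n (b Psi m x), 0)}"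
  by (simp only: Ah_relations_def fps_act_op_Sum_any fdiff_coeff_flip)

text \<open>The six relations omit the orders e psi, f psi and f e. The first two follow by
  inverting the series, the last from the commutator with opposite sign.\<close>

lemma restricted_imp_Ah_module:
  assumes h: "h * (h oo (- fps_X)) = 1" and W: "restricted_Ah_module h t b"
  shows "Ah_module t b h"
proof -
  interpret vector_space t using W by (simp add: restricted_Ah_module_def)
  interpret op_family t b
    by (intro op_family.intro cspace.intro op_family_axioms.intro)
      (use W in \<open>auto simp: restricted_Ah_module_def\<close>)
  have *: "l = r" if "(l, r) \<in> Ah_relations h t b m n x" for l r m n x
  proof -
    have "\<forall>(l, r) \<in> Ah_relations h t b m n x. l = r"
      using W by (simp add: restricted_Ah_module_def)
    with that show ?thesis by fast
  qed
  have rels: "b E m (b E n x) = fps_act t h (- 1) (\<lambda>m n. b E n (b E m x)) m n"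
    "b F m (b F n x) = fps_act t (h oo (- fps_X)) (- 1) (\<lambda>m n. b F n (b F m x)) m n"
    "b Psi m (b E n x) = fps_act t h (- 1) (\<lambda>m n. b E n (b Psi m x)) m n"
    "b Psi m (b F n x) = fps_act t (h oo (- fps_X)) (- 1) (\<lambda>m n. b F n (b Psi m x)) m n"
    "b E m (b F n x) = b F n (b E m x) + b Psi (m + n) x"
    "b Psi m (b Psi n x) = b Psi n (b Psi m x)" for m n x
  proof -
    note r = *[of _ _ m n x, unfolded Ah_relations_fps_act]
    show "b E m (b E n x) = fps_act t h (- 1) (\<lambda>m n. b E n (b E m x)) m n" by (rule r) simp
    show "b F m (b F n x) = fps_act t (h oo (- fps_X)) (- 1) (\<lambda>m n. b F n (b F m x)) m n" by (rule r) simp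
    show "b Psi m (b E n x) = fps_act t h (- 1) (\<lambda>m n. b E n (b Psi m x)) m n" by (rule r) simp
    show "b Psi m (b F n x) = fps_act t (h oo (- fps_X)) (- 1) (\<lambda>m n. b F n (b Psi m x)) m n"
      by (rule r) simp
    have "b E m (b F n x) - b F n (b E m x) = b Psi (m + n) x" by (rule r) simp
    then show "b E m (b F n x) = b F n (b E m x) + b Psi (m + n) x" by (simp add: algebra_simps)
    have "b Psi m (b Psi n x) - b Psi n (b Psi m x) = 0" by (rule r) simp
    then show "b Psi m (b Psi n x) = b Psi n (b Psi m x)" by simp
  qed
  \<comment> \<open>Solves psi v = R v psi for v psi by multiplying with the inverse series S;
    exchanging the roles of the variables turns S(t) into S(-t).\<close>
  have swap: "b v m (b Psi n x) = fps_act t (S oo (- fps_X)) (- 1) (\<lambda>m n. b Psi n (b v m x)) m n"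
    if R: "\<And>m n. b Psi m (b v n x) = fps_act t R (- 1) (\<lambda>m n. b v n (b Psi m x)) m n"
      and RS: "S * R = 1" for v R S m n x
  proof -
    have "fps_act t (S oo (- fps_X)) (- 1) (\<lambda>m n. b Psi n (b v m x)) m n
      = fps_act t S (- 1) (\<lambda>m n. b Psi m (b v n x)) n m"
      by (simp add: fps_act_transpose[where f = "\<lambda>m n. b Psi m (b v n x)"] compose_uminus_X_twice)
    also have "\<dots> = b v m (b Psi n x)"
    proof -
      have "(\<lambda>m n. b Psi m (b v n x)) = fps_act t R (- 1) (\<lambda>m n. b v n (b Psi m x))"
        by (intro ext R)
      then show ?thesis by (simp only: fps_act_mult[OF b_bounded2] RS fps_act_one)
    qed
    finally show ?thesis by simp
  qed
  have h': "(h oo (- fps_X)) * h = 1" using h by (simp add: mult.commute)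
  show ?thesis
  proof unfold_locales
    fix u v :: gen and m n x
    show "b u m (b v n x) = fps_act t (gfac h u v) (- 1) (\<lambda>m n. b v n (b u m x)) m n
      + t (geps u v) (b Psi (m + n) x)"
      using rels[of m n x] swap[OF rels(3) h', of m n x] swap[OF rels(4) h, of m n x] rels(5)[of n m x]
      by (cases u; cases v)
        (auto simp: gfac_def geps_def fps_act_one compose_uminus_X_twice add.commute)
  qed
qed

section \<open>Translation by a formal variable\<close>

lemma sum_triangle_swap:
  "(\<Sum>i\<le>c::nat. \<Sum>j\<le>c - i. g i j) = (\<Sum>j\<le>c. \<Sum>i\<le>c - j. g i j :: 'a::comm_monoid_add)"
proof -
  have "(\<Sum>i\<le>c. \<Sum>j\<le>c - i. g i j) = (\<Sum>(i, j)\<in>Sigma {..c} (\<lambda>i. {..c - i}). g i j)"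
    by (rule sum.Sigma) auto
  also have "\<dots> = (\<Sum>(j, i)\<in>Sigma {..c} (\<lambda>j. {..c - j}). g i j)"
    by (rule sum.reindex_bij_witness[of _ prod.swap prod.swap]) auto
  also have "\<dots> = (\<Sum>j\<le>c. \<Sum>i\<le>c - j. g i j)"
    by (rule sum.Sigma[symmetric]) auto
  finally show ?thesis .
qed

lemma sum_triangle_diag:
  "(\<Sum>i\<le>c::nat. \<Sum>j\<le>c - i. g i j) = (\<Sum>r\<le>c. \<Sum>i\<le>r. g i (r - i) :: 'a::comm_monoid_add)"
proof -
  have "(\<Sum>i\<le>c. \<Sum>j\<le>c - i. g i j) = (\<Sum>(i, j)\<in>Sigma {..c} (\<lambda>i. {..c - i}). g i j)"
    by (rule sum.Sigma) auto
  also have "Sigma {..c} (\<lambda>i. {..c - i}) = {(i, j). i + j \<le> c}" by auto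
  finally show ?thesis by (simp add: sum.triangle_reindex_eq)
qed

lemma bdiff_Vandermonde: "(\<Sum>i\<le>r. bdiff m i * bdiff n (r - i)) = bdiff (m + n) r"
proof -
  have "(\<Sum>i\<le>r. bdiff m i * bdiff n (r - i))
      = (\<Sum>i\<le>r. ((of_int m gchoose i) * (of_int n gchoose (r - i))) * (- 1) ^ r)"
    by (intro sum.cong) (auto simp: bdiff_def mult_ac simp flip: power_add)
  also have "\<dots> = bdiff (m + n) r"
    using gbinomial_Vandermonde[of "of_int m :: complex" "of_int n" r]
    by (simp add: bdiff_def atLeast0AtMost flip: sum_distrib_right)
  finally show ?thesis .
qed

text \<open>Translation \<open>a(z) \<mapsto> a(z + y)\<close>, acting on power series in \<open>y\<close>.\<close>

definition trans1 where
  "trans1 t \<Phi> c m n = (\<Sum>i\<le>c. t (bdiff m i) (\<Phi> (c - i) (m - int i) n))"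

definition trans2 where
  "trans2 t \<Phi> c m n = (\<Sum>i\<le>c. t (bdiff n i) (\<Phi> (c - i) m (n - int i)))"

definition ymult :: "(nat \<Rightarrow> int \<Rightarrow> int \<Rightarrow> 'w::zero) \<Rightarrow> nat \<Rightarrow> int \<Rightarrow> int \<Rightarrow> 'w" where
  "ymult \<Phi> c m n = (case c of 0 \<Rightarrow> 0 | Suc k \<Rightarrow> \<Phi> k m n)"

context cspace
begin

text \<open>Raising the first index is multiplication by z, which translation turns into z + y; the
  second summand is the y.\<close>

lemma trans1_shift: "trans1 t (\<lambda>k m n. \<Phi> k (m + 1) n) c m n
    = trans1 t \<Phi> c (m + 1) n + ymult (trans1 t \<Phi>) c m n"
proof (cases c)
  case (Suc k)
  then show ?thesis
    by (simp only: trans1_def ymult_def sum.atMost_Suc_shift nat.case)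
      (simp add: bdiff_Suc_add[unfolded add.commute[of _ 1]] scale_left_diff_distrib sum_subtractf algebra_simps)
qed (simp add: trans1_def ymult_def)

lemma trans2_shift: "trans2 t (\<lambda>k m n. \<Phi> k m (n + 1)) c m n
    = trans2 t \<Phi> c m (n + 1) + ymult (trans2 t \<Phi>) c m n"
proof (cases c)
  case (Suc k)
  then show ?thesis
    by (simp only: trans2_def ymult_def sum.atMost_Suc_shift nat.case)
      (simp add: bdiff_Suc_add[unfolded add.commute[of _ 1]] scale_left_diff_distrib sum_subtractf algebra_simps)
qed (simp add: trans2_def ymult_def)

lemma trans1_ymult: "trans1 t (ymult \<Phi>) c m n = ymult (trans1 t \<Phi>) c m n"
proof (cases c)
  case (Suc k)
  have "trans1 t (ymult \<Phi>) c m n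
      = (\<Sum>i\<le>k. t (bdiff m i) (ymult \<Phi> (Suc k - i) (m - int i) n))"
    by (simp add: trans1_def ymult_def Suc)
  also have "\<dots> = (\<Sum>i\<le>k. t (bdiff m i) (\<Phi> (k - i) (m - int i) n))"
    by (intro sum.cong) (auto simp: ymult_def Suc_diff_le)
  finally show ?thesis by (simp add: Suc ymult_def trans1_def)
qed (simp add: trans1_def ymult_def)

lemma trans1_add: "trans1 t (\<lambda>k m n. \<Phi> k m n + \<Psi> k m n) c m n = trans1 t \<Phi> c m n + trans1 t \<Psi> c m n"
  by (simp add: trans1_def scale_right_distrib sum.distrib)

lemma trans1_diff: "trans1 t (\<lambda>k m n. \<Phi> k m n - \<Psi> k m n) c m n = trans1 t \<Phi> c m n - trans1 t \<Psi> c m n"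
  by (simp add: trans1_def scale_right_diff_distrib sum_subtractf)

lemma trans2_diff: "trans2 t (\<lambda>k m n. \<Phi> k m n - \<Psi> k m n) c m n = trans2 t \<Phi> c m n - trans2 t \<Psi> c m n"
  by (simp add: trans2_def scale_right_diff_distrib sum_subtractf)

lemma trans_swap: "trans1 t (trans2 t \<Phi>) c m n = trans2 t (trans1 t \<Phi>) c m n"
  unfolding trans1_def trans2_def scale_sum_right
  by (subst sum_triangle_swap) (simp add: mult.commute diff_diff_eq add.commute)

text \<open>\<open>w - z\<close> is invariant under translation.\<close>

lemma trans_shift2:
  "trans1 t (trans2 t (\<lambda>k. shift2 t (- 1) (\<Phi> k))) c m n = shift2 t (- 1) (trans1 t (trans2 t \<Phi>) c) m n"
proof -
  let ?T = "\<lambda>\<Phi>. trans1 t (trans2 t \<Phi>)"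
  have 1: "?T (\<lambda>k m n. \<Phi> k (m + 1) n) c m n = ?T \<Phi> c (m + 1) n + ymult (?T \<Phi>) c m n"
  proof -
    have "trans2 t (\<lambda>k m n. \<Phi> k (m + 1) n) = (\<lambda>k m n. trans2 t \<Phi> k (m + 1) n)"
      by (simp add: trans2_def fun_eq_iff)
    then show ?thesis by (simp add: trans1_shift)
  qed
  have 2: "?T (\<lambda>k m n. \<Phi> k m (n + 1)) c m n = ?T \<Phi> c m (n + 1) + ymult (?T \<Phi>) c m n"
  proof -
    have "trans2 t (\<lambda>k m n. \<Phi> k m (n + 1)) = (\<lambda>k m n. trans2 t \<Phi> k m (n + 1) + ymult (trans2 t \<Phi>) k m n)"
      by (simp add: trans2_shift fun_eq_iff)
    moreover have "trans1 t (\<lambda>k m n. trans2 t \<Phi> k m (n + 1)) c m n = ?T \<Phi> c m (n + 1)"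
      by (simp add: trans1_def)
    ultimately show ?thesis by (simp add: trans1_add trans1_ymult)
  qed
  have "trans2 t (\<lambda>k. shift2 t (- 1) (\<Phi> k))
      = (\<lambda>k m n. trans2 t (\<lambda>k m n. \<Phi> k m (n + 1)) k m n - trans2 t (\<lambda>k m n. \<Phi> k (m + 1) n) k m n)"
    unfolding trans2_diff[symmetric] by (simp add: shift2_def[abs_def])
  then show ?thesis
    using 1 2 by (simp add: trans1_diff shift2_def)
qed

lemma trans_shift2_pow:
  "trans1 t (trans2 t (\<lambda>k. (shift2 t (- 1) ^^ r) (\<Phi> k))) c m n
    = (shift2 t (- 1) ^^ r) (trans1 t (trans2 t \<Phi>) c) m n"
proof (induction r arbitrary: m n)
  case (Suc r)
  have "trans1 t (trans2 t (\<lambda>k. (shift2 t (- 1) ^^ Suc r) (\<Phi> k))) c m n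
     = shift2 t (- 1) (trans1 t (trans2 t (\<lambda>k. (shift2 t (- 1) ^^ r) (\<Phi> k))) c) m n"
    by (simp add: trans_shift2)
  also have "trans1 t (trans2 t (\<lambda>k. (shift2 t (- 1) ^^ r) (\<Phi> k))) c
     = (shift2 t (- 1) ^^ r) (trans1 t (trans2 t \<Phi>) c)"
    by (intro ext Suc)
  finally show ?case by simp
qed simp

end

section \<open>Universality of the vacuum module\<close>

text \<open>The modes of \<open>u(z + y)\<close>, acting on power series in \<open>y\<close>.\<close>

definition transl ::
  "(complex \<Rightarrow> 'w \<Rightarrow> 'w) \<Rightarrow> (gen \<Rightarrow> int \<Rightarrow> 'w \<Rightarrow> 'w::ab_group_add) \<Rightarrow> gen \<Rightarrow> int \<Rightarrow> (nat \<Rightarrow> 'w) \<Rightarrow> nat \<Rightarrow> 'w"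
  where "transl t b u n x c = (\<Sum>i\<le>c. t (bdiff n i) (b u (n - int i) (x (c - i))))"

definition const_series :: "'w::zero \<Rightarrow> nat \<Rightarrow> 'w"
  where "const_series x c = (if c = 0 then x else 0)"

definition wdeg :: "(gen \<times> int) list \<Rightarrow> int"
  where "wdeg w = sum_list (map (\<lambda>(u, n). - n) w)"

lemma wdeg_simps [simp]: "wdeg [] = 0" "wdeg ((u, n) # w) = wdeg w - n"
  by (simp_all add: wdeg_def)

definition word_act ::
  "(complex \<Rightarrow> 'w \<Rightarrow> 'w) \<Rightarrow> (gen \<Rightarrow> int \<Rightarrow> 'w \<Rightarrow> 'w::ab_group_add) \<Rightarrow> 'w \<Rightarrow> (gen \<times> int) list \<Rightarrow> nat \<Rightarrow> 'w"
  where "word_act t b \<xi> w = foldr (\<lambda>(u, n). transl t b u n) w (const_series \<xi>)"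

lemma word_act_simps [simp]:
  "word_act t b \<xi> [] = const_series \<xi>"
  "word_act t b \<xi> ((u, n) # w) = transl t b u n (word_act t b \<xi> w)"
  by (simp_all add: word_act_def)

text \<open>The span of words bounded both in length and in degree. The degree decides vanishing;
  the length is the induction parameter that keeps reordering well-founded.\<close>

inductive word_filt ::
  "(complex \<Rightarrow> 'w \<Rightarrow> 'w) \<Rightarrow> (gen \<Rightarrow> int \<Rightarrow> 'w \<Rightarrow> 'w::ab_group_add) \<Rightarrow> 'w \<Rightarrow> nat \<Rightarrow> int \<Rightarrow> (nat \<Rightarrow> 'w) \<Rightarrow> bool"
  for t b \<xi> k d where
  word: "length w \<le> k \<Longrightarrow> wdeg w \<le> d \<Longrightarrow> word_filt t b \<xi> k d (word_act t b \<xi> w)"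
| zero: "word_filt t b \<xi> k d (\<lambda>_. 0)"
| add: "word_filt t b \<xi> k d x \<Longrightarrow> word_filt t b \<xi> k d y \<Longrightarrow> word_filt t b \<xi> k d (\<lambda>c. x c + y c)"
| scale: "word_filt t b \<xi> k d x \<Longrightarrow> word_filt t b \<xi> k d (\<lambda>c. t r (x c))"

lemma word_filt_sum:
  assumes "finite A" "\<And>i. i \<in> A \<Longrightarrow> word_filt t b \<xi> k d (f i)"
  shows "word_filt t b \<xi> k d (\<lambda>c. \<Sum>i\<in>A. f i c)"
  using assms by (induction A rule: finite_induct) (auto intro: word_filt.intros)

lemma word_filt_mono:
  "word_filt t b \<xi> k d x \<Longrightarrow> k \<le> k' \<Longrightarrow> d \<le> d' \<Longrightarrow> word_filt t b \<xi> k' d' x"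
  by (induction rule: word_filt.induct) (auto intro: word_filt.intros)

context op_family
begin

lemma transl_add: "transl t b u n (\<lambda>c. x c + y c) = (\<lambda>c. transl t b u n x c + transl t b u n y c)"
  by (rule ext) (simp add: transl_def b_add scale_right_distrib sum.distrib)

lemma transl_scale: "transl t b u n (\<lambda>c. t r (x c)) = (\<lambda>c. t r (transl t b u n x c))"
  by (rule ext) (simp add: transl_def b_scale scale_sum_right mult.commute)

lemma transl_0: "transl t b u n (\<lambda>_. 0) = (\<lambda>_. 0)"
  by (rule ext) (simp add: transl_def)

lemma transl_transl:
  "transl t b u m (transl t b v n x) c = trans1 t (trans2 t (\<lambda>k m n. b u m (b v n (x k)))) c m n"
  by (simp add: transl_def trans1_def trans2_def b_sum b_scale)

lemma transl_transl':
  "transl t b v n (transl t b u m x) c = trans1 t (trans2 t (\<lambda>k m n. b v n (b u m (x k)))) c m n"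
  unfolding trans_swap by (simp add: transl_def trans1_def trans2_def b_sum b_scale)

text \<open>At \<open>y^c\<close> only the mode \<open>m - c\<close> contributes. It is nonnegative
  for \<open>c \<le> m\<close>, and for larger \<open>c\<close> its coefficient binom(m, c)
  vanishes.\<close>

lemma transl_const_eq_0:
  assumes "\<And>u n. n \<ge> 0 \<Longrightarrow> b u n \<xi> = 0" "m \<ge> 0"
  shows "transl t b u m (const_series \<xi>) = (\<lambda>_. 0)"
proof
  fix c
  have "transl t b u m (const_series \<xi>) c = (\<Sum>i\<in>{c}. t (bdiff m i) (b u (m - int i) (const_series \<xi> (c - i))))"
    unfolding transl_def by (rule sum.mono_neutral_right) (auto simp: const_series_def)
  also have "\<dots> = t (bdiff m c) (b u (m - int c) \<xi>)" by (simp add: const_series_def)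
  also have "\<dots> = 0"
  proof (cases "int c \<le> m")
    case True then show ?thesis by (simp add: assms)
  next
    case False
    then obtain k where k: "m = int k" "k < c" using assms(2) by (metis nat_0_le nat_int not_le zless_nat_conj zless_nat_eq_int_zless)
    then have "(of_int m gchoose c) = (0::complex)"
      by (simp add: binomial_gbinomial[symmetric] binomial_eq_0)
    then show ?thesis by (simp add: bdiff_def)
  qed
  finally show "transl t b u m (const_series \<xi>) c = 0" .
qed

lemma word_filt_transl:
  "word_filt t b \<xi> k d x \<Longrightarrow> word_filt t b \<xi> (Suc k) (d - m) (transl t b u m x)"
proof (induction rule: word_filt.induct)
  case (word w)
  then have "word_filt t b \<xi> (Suc k) (d - m) (word_act t b \<xi> ((u, m) # w))"
    by (intro word_filt.word) auto
  then show ?case by simp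
qed (auto simp: transl_0 transl_add transl_scale intro: word_filt.intros)

end

context Ah_module
begin

text \<open>The relation is summed over the shifted indices. Powers of \<open>w - z\<close> pass
  through the translation by \<open>trans_shift2_pow\<close>, and the two translation sums of the
  delta term merge by Vandermonde.\<close>

lemma transl_rel:
  assumes "vanish_above (\<lambda>m n. transl t b v n (transl t b u m x) c) m n N"
  shows "transl t b u m (transl t b v n x) c
    = fps_act t (gfac h u v) (- 1) (\<lambda>m n. transl t b v n (transl t b u m x) c) m n
      + t (geps u v) (transl t b Psi (m + n) x c)"
proof -
  let ?g = "gfac h u v" and ?S = "shift2 t (- 1)"
  define \<Phi> where "\<Phi> k m n = b v n (b u m (x k))" for k m n
  define \<Psi> where "\<Psi> k m n = b Psi (m + n) (x k)" for k m n
  have bd: "bounded2 (\<Phi> k)" for k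
    unfolding \<Phi>_def by (rule b_bounded2)
  \<comment> \<open>Only finitely many shifted corners contribute to \<open>y^c\<close>, so one
    truncation of the power series serves all of them.\<close>
  have "\<exists>K. \<forall>k\<le>c. \<forall>i\<le>c. \<forall>j\<le>c. vanish_above (\<Phi> k) (m - int i) (n - int j) K"
  proof -
    have "\<exists>K. vanish_above (\<Phi> k) (m - int i) (n - int j) K" for k i j
      using bd by (auto simp: bounded2_def)
    then obtain K where K: "\<And>k i j. vanish_above (\<Phi> k) (m - int i) (n - int j) (K k i j)" by metis
    let ?B = "Max ((\<lambda>(k, i, j). K k i j) ` ({..c} \<times> {..c} \<times> {..c}))"
    have "vanish_above (\<Phi> k) (m - int i) (n - int j) ?B" if "k \<le> c" "i \<le> c" "j \<le> c" for k i j
      by (rule vanish_above_mono[OF K]) (use that in \<open>force intro!: Max_ge\<close>)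
    then show ?thesis by blast
  qed
  then obtain K0 where K0: "\<And>k i j. k \<le> c \<Longrightarrow> i \<le> c \<Longrightarrow> j \<le> c \<Longrightarrow> vanish_above (\<Phi> k) (m - int i) (n - int j) K0"
    by blast
  define K where "K = max N K0"
  have K: "b u (m - int i) (b v (n - int j) (x k))
      = (\<Sum>r<K. t (fps_nth ?g r) ((?S ^^ r) (\<Phi> k) (m - int i) (n - int j))) + t (geps u v) (\<Psi> k (m - int i) (n - int j))"
    if "k \<le> c" "i \<le> c" "j \<le> c" for i j k
  proof -
    have "fps_act t ?g (- 1) (\<Phi> k) (m - int i) (n - int j)
      = (\<Sum>r<K. t (fps_nth ?g r) ((?S ^^ r) (\<Phi> k) (m - int i) (n - int j)))"
      by (rule fps_act_sum[OF K0[OF that]]) (simp add: K_def)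
    then show ?thesis
      by (subst rel) (simp add: \<Phi>_def[abs_def] \<Psi>_def)
  qed
  have T: "trans1 t (trans2 t (\<lambda>k m n. (\<Sum>r<K. t (fps_nth ?g r) ((?S ^^ r) (\<Phi> k) m n)) + t (geps u v) (\<Psi> k m n))) c m n
    = (\<Sum>r<K. t (fps_nth ?g r) (trans1 t (trans2 t (\<lambda>k. (?S ^^ r) (\<Phi> k))) c m n))
      + t (geps u v) (trans1 t (trans2 t \<Psi>) c m n)"
  proof -
    have s2: "trans2 t (\<lambda>k m n. (\<Sum>r<K. t (f r) (X r k m n)) + t e (Y k m n))
      = (\<lambda>k m n. (\<Sum>r<K. t (f r) (trans2 t (X r) k m n)) + t e (trans2 t Y k m n))" for f X e Y
      by (intro ext) (simp add: trans2_def scale_right_distrib sum.distrib scale_sum_right mult.commute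
          sum.swap[of _ "{..<K}"])
    have s1: "trans1 t (\<lambda>k m n. (\<Sum>r<K. t (f r) (X r k m n)) + t e (Y k m n))
      = (\<lambda>k m n. (\<Sum>r<K. t (f r) (trans1 t (X r) k m n)) + t e (trans1 t Y k m n))" for f X e Y
      by (intro ext) (simp add: trans1_def scale_right_distrib sum.distrib scale_sum_right mult.commute
          sum.swap[of _ "{..<K}"])
    show ?thesis by (simp only: s2 s1)
  qed
  have psi: "trans1 t (trans2 t \<Psi>) c m n = transl t b Psi (m + n) x c"
  proof -
    have "trans1 t (trans2 t \<Psi>) c m n
      = (\<Sum>i\<le>c. \<Sum>j\<le>c - i. t (bdiff m i * bdiff n j) (b Psi (m + n - int (i + j)) (x (c - (i + j)))))"
      by (simp add: trans1_def trans2_def \<Psi>_def scale_sum_right algebra_simps)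
    also have "\<dots> = (\<Sum>r\<le>c. \<Sum>i\<le>r. t (bdiff m i * bdiff n (r - i)) (b Psi (m + n - int r) (x (c - r))))"
      by (subst sum_triangle_diag) (auto intro!: sum.cong)
    also have "\<dots> = transl t b Psi (m + n) x c"
      by (simp add: transl_def bdiff_Vandermonde flip: scale_sum_left)
    finally show ?thesis .
  qed
  have "transl t b u m (transl t b v n x) c = trans1 t (trans2 t (\<lambda>k m n. b u m (b v n (x k)))) c m n"
    by (rule transl_transl)
  also have "\<dots> = trans1 t (trans2 t (\<lambda>k m n. (\<Sum>r<K. t (fps_nth ?g r) ((?S ^^ r) (\<Phi> k) m n)) + t (geps u v) (\<Psi> k m n))) c m n"
    unfolding trans1_def trans2_def by (intro sum.cong arg_cong2[where f = t] refl K) auto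
  also have "\<dots> = (\<Sum>r<K. t (fps_nth ?g r) ((?S ^^ r) (\<lambda>m n. transl t b v n (transl t b u m x) c) m n))
      + t (geps u v) (transl t b Psi (m + n) x c)"
    unfolding T psi trans_shift2_pow by (simp add: transl_transl' \<Phi>_def[abs_def])
  also have "(\<Sum>r<K. t (fps_nth ?g r) ((?S ^^ r) (\<lambda>m n. transl t b v n (transl t b u m x) c) m n))
    = fps_act t ?g (- 1) (\<lambda>m n. transl t b v n (transl t b u m x) c) m n"
    by (rule fps_act_sum[symmetric, OF assms]) (simp add: K_def)
  finally show ?thesis .
qed

text \<open>Moving a nonnegative mode to the right, past a word of length \<open>k\<close>, does not raise the degree;
  hence words of negative degree annihilate a vacuum vector.\<close>

lemma word_act_filt:
  assumes vac: "\<And>u n. n \<ge> 0 \<Longrightarrow> b u n \<xi> = 0"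
  shows "(\<forall>w. length w \<le> k \<longrightarrow> wdeg w < 0 \<longrightarrow> word_act t b \<xi> w = (\<lambda>_. 0)) \<and>
    (\<forall>w u m. length w \<le> k \<longrightarrow> m \<ge> 0 \<longrightarrow> word_filt t b \<xi> k (wdeg w - m) (transl t b u m (word_act t b \<xi> w)))"
proof (induction k)
  case 0
  show ?case
    by (auto simp: transl_const_eq_0[OF vac] intro: word_filt.zero)
next
  case (Suc k)
  have P: "word_act t b \<xi> w = (\<lambda>_. 0)" if "length w \<le> k" "wdeg w < 0" for w
    using Suc that by blast
  have Q: "word_filt t b \<xi> k (wdeg w - m) (transl t b u m (word_act t b \<xi> w))"
    if "length w \<le> k" "m \<ge> 0" for w u m using Suc that by blast
  have P': "x = (\<lambda>_. 0)" if "word_filt t b \<xi> k d x" "d < 0" for x d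
    using that by (induction rule: word_filt.induct) (auto simp: P)
  have Q': "word_filt t b \<xi> k (d - m) (transl t b u m x)" if "word_filt t b \<xi> k d x" "m \<ge> 0" for x d u m
    using that
  proof (induction rule: word_filt.induct)
    case (word w)
    then show ?case by (intro word_filt_mono[OF Q[OF word(1,3)]]) auto
  qed (auto simp: transl_0 transl_add transl_scale intro: word_filt.intros)
  \<comment> \<open>A nonnegative first letter is covered by \<open>Q\<close>, which keeps the
    length at \<open>k\<close>. Behind a negative first letter the rest of the word has degree even
    lower than the word, hence already vanishes.\<close>
  have P2: "word_act t b \<xi> w = (\<lambda>_. 0)" if len: "length w \<le> Suc k" and deg: "wdeg w < 0" for w
  proof (cases w)
    case (Cons um w')
    obtain u m where um: "um = (u, m)" by force
    show ?thesis
    proof (cases "m \<ge> 0")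
      case True
      then have "word_filt t b \<xi> k (wdeg w' - m) (transl t b u m (word_act t b \<xi> w'))"
        using Q[of w' m u] len Cons by simp
      then show ?thesis
        using P' deg Cons um by simp
    next
      case False
      then have "word_act t b \<xi> w' = (\<lambda>_. 0)" using P[of w'] len deg Cons um by simp
      then show ?thesis using Cons um by (simp add: transl_0)
    qed
  qed (use deg in simp)
  have Q2: "word_filt t b \<xi> (Suc k) (wdeg w - m) (transl t b u m (word_act t b \<xi> w))"
    if len: "length w \<le> Suc k" and m: "m \<ge> 0" for w u m
  proof (cases w)
    case Nil
    then show ?thesis by (simp add: transl_const_eq_0[OF vac m] word_filt.zero)
  next
    case (Cons vn w')
    obtain v n where vn: "vn = (v, n)" by force
    let ?x = "word_act t b \<xi> w'"
    let ?f = "\<lambda>c m n. transl t b v n (transl t b u m ?x) c"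
    have len': "length w' \<le> k" using len Cons by simp
    \<comment> \<open>For \<open>i \<ge> I\<close> the vector \<open>u(m + i) x\<close> has negative
      degree. For \<open>j \<ge> J\<close> the mode \<open>n + j\<close> is nonnegative, so
      \<open>Q'\<close> applies, and the total degree is negative. Outside the triangle
      \<open>i + j < I + J\<close> one of the two occurs.\<close>
    define I where "I = nat (wdeg w' - m + 1)"
    define J where "J = nat (wdeg w' - m + 1) + nat (- n) + nat (wdeg w' - m - n + 1)"
    have ux: "word_filt t b \<xi> k (wdeg w' - m - int i) (transl t b u (m + int i) ?x)" for i
      using Q[OF len', of "m + int i" u] m by (simp add: algebra_simps)
    have van: "vanish_above (?f c) m n (I + J)" for c
      unfolding vanish_above_def
    proof (intro allI impI)
      fix i j assume ij: "I + J \<le> i + j"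
      show "?f c (m + int i) (n + int j) = 0"
      proof (cases "I \<le> i")
        case True
        then have "transl t b u (m + int i) ?x = (\<lambda>_. 0)"
          by (intro P'[OF ux]) (simp add: I_def)
        then show ?thesis by (simp add: transl_0)
      next
        case False
        then have j: "J \<le> j" using ij by simp
        then have "n + int j \<ge> 0" by (simp add: J_def)
        from Q'[OF ux this] have "transl t b v (n + int j) (transl t b u (m + int i) ?x) = (\<lambda>_. 0)"
          by (rule P') (use j in \<open>simp add: J_def\<close>)
        then show ?thesis by simp
      qed
    qed
    have eq: "transl t b u m (transl t b v n ?x) = (\<lambda>c.
        (\<Sum>(i, j)\<in>{(i, j). i + j < I + J}. t (fdiff_coeff (gfac h u v) j i)
          (transl t b v (n + int j) (transl t b u (m + int i) ?x) c))
        + t (geps u v) (transl t b Psi (m + n) ?x c))"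
      by (rule ext, subst transl_rel[OF van], subst fps_act_double_sum[OF van]) simp
    have fin: "finite {(i, j). i + j < I + J}"
      by (rule finite_subset[of _ "{..<I + J} \<times> {..<I + J}"]) auto
    have "word_filt t b \<xi> (Suc k) (wdeg w' - m - n) (\<lambda>c.
        (\<Sum>(i, j)\<in>{(i, j). i + j < I + J}. t (fdiff_coeff (gfac h u v) j i)
          (transl t b v (n + int j) (transl t b u (m + int i) ?x) c))
        + t (geps u v) (transl t b Psi (m + n) ?x c))"
    proof (intro word_filt.add word_filt.scale)
      show "word_filt t b \<xi> (Suc k) (wdeg w' - m - n) (\<lambda>c. \<Sum>(i, j)\<in>{(i, j). i + j < I + J}.
         t (fdiff_coeff (gfac h u v) j i) (transl t b v (n + int j) (transl t b u (m + int i) ?x) c))"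
        unfolding case_prod_beta
      proof (rule word_filt_sum[OF fin[unfolded case_prod_beta]])
        fix ij
        show "word_filt t b \<xi> (Suc k) (wdeg w' - m - n) (\<lambda>c. t (fdiff_coeff (gfac h u v) (snd ij) (fst ij))
           (transl t b v (n + int (snd ij)) (transl t b u (m + int (fst ij)) ?x) c))"
          by (rule word_filt.scale, rule word_filt_mono[OF word_filt_transl[OF ux]]) auto
      qed
      \<comment> \<open>The delta term replaces two letters by the single letter psi(m + n) of the
        same total degree.\<close>
      have "word_filt t b \<xi> (Suc k) (wdeg w' - m - n) (word_act t b \<xi> ((Psi, m + n) # w'))"
        by (rule word_filt.word) (use len' in auto)
      then show "word_filt t b \<xi> (Suc k) (wdeg w' - m - n) (transl t b Psi (m + n) ?x)" by simp
    qed
    then show ?thesis using Cons vn by (simp add: eq algebra_simps)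
  qed
  show ?case using P2 Q2 by blast
qed

lemma word_act_neg:
  assumes vac: "\<And>u n. n \<ge> 0 \<Longrightarrow> b u n \<xi> = 0" and "wdeg w < 0"
  shows "word_act t b \<xi> w = (\<lambda>_. 0)"
  using word_act_filt[OF vac, of "length w"] assms(2) by blast

end

section \<open>From the tensor algebra to maps out of the vacuum module\<close>

lemma linear_fps_act:
  assumes lin: "Vector_Spaces.linear t s \<pi>" and f: "vanish_above f m n N"
  shows "\<pi> (fps_act t g e f m n) = fps_act s g e (\<lambda>m n. \<pi> (f m n)) m n"
proof -
  interpret L: Vector_Spaces.linear t s \<pi> by (rule lin)
  interpret T: cspace t ..
  interpret S: cspace s ..
  have f': "vanish_above (\<lambda>m n. \<pi> (f m n)) m n N"
    using f by (simp add: vanish_above_def L.zero)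
  have "\<pi> ((shift2 t e ^^ r) f m n) = (shift2 s e ^^ r) (\<lambda>m n. \<pi> (f m n)) m n" for r
    by (simp add: T.shift2_pow_sum S.shift2_pow_sum L.sum L.scale)
  then show ?thesis
    by (simp add: T.fps_act_sum[OF f order_refl] S.fps_act_sum[OF f' order_refl] L.sum L.scale)
qed

definition tens_eval ::
  "(complex \<Rightarrow> 'w \<Rightarrow> 'w) \<Rightarrow> (gen \<Rightarrow> int \<Rightarrow> 'w \<Rightarrow> 'w::ab_group_add) \<Rightarrow> 'w \<Rightarrow> tens \<Rightarrow> nat \<Rightarrow> 'w"
  where "tens_eval t b \<xi> p c =
    (\<Sum>w\<in>Poly_Mapping.keys p. t (Poly_Mapping.lookup p w) (word_act t b \<xi> (letters w) c))"

context op_family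
begin

lemma tens_eval_superset:
  assumes "finite A" "Poly_Mapping.keys p \<subseteq> A"
  shows "tens_eval t b \<xi> p c = (\<Sum>w\<in>A. t (Poly_Mapping.lookup p w) (word_act t b \<xi> (letters w) c))"
  unfolding tens_eval_def
  by (rule sum.mono_neutral_left) (use assms in \<open>auto simp: in_keys_iff\<close>)

lemma tens_eval_add: "tens_eval t b \<xi> (p + q) = (\<lambda>c. tens_eval t b \<xi> p c + tens_eval t b \<xi> q c)"
proof
  fix c
  let ?A = "Poly_Mapping.keys p \<union> Poly_Mapping.keys q"
  have "Poly_Mapping.keys (p + q) \<subseteq> ?A" by (rule Poly_Mapping.keys_add)
  then show "tens_eval t b \<xi> (p + q) c = tens_eval t b \<xi> p c + tens_eval t b \<xi> q c"
    by (simp add: tens_eval_superset[of ?A] lookup_add scale_left_distrib sum.distrib)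
qed

lemma tens_eval_0: "tens_eval t b \<xi> 0 = (\<lambda>_. 0)"
  by (rule ext) (simp add: tens_eval_def)

lemma tens_eval_single:
  "tens_eval t b \<xi> (Poly_Mapping.single w r) = (\<lambda>c. t r (word_act t b \<xi> (letters w) c))"
  by (rule ext) (simp add: tens_eval_superset[of "{w}"])

lemma tgen_mult_single:
  "tgen u n * Poly_Mapping.single w r = Poly_Mapping.single (Fword ((u, n) # letters w)) r"
  by (simp add: tgen_def mult_single plus_fword_def)

lemma tens_eval_tgen: "tens_eval t b \<xi> (tgen u n * p) = transl t b u n (tens_eval t b \<xi> p)"
  by (induction p rule: tens_induct)
    (simp_all add: tens_eval_0 transl_0 distrib_left tens_eval_add transl_add
      tgen_mult_single tens_eval_single transl_scale)

lemma tens_eval_scale: "tens_eval t b \<xi> (tscale r p) = (\<lambda>c. t r (tens_eval t b \<xi> p c))"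
proof (induction p rule: tens_induct)
  case (single w r')
  show ?case by (simp add: tens_eval_single tscale_def mult_single)
qed (simp_all add: tens_eval_0 tens.scale_right_distrib tens_eval_add scale_right_distrib)

lemma tens_eval_mult_eq_0:
  assumes "tens_eval t b \<xi> p = (\<lambda>_. 0)"
  shows "tens_eval t b \<xi> (q * p) = (\<lambda>_. 0)"
proof (induction q rule: tens_induct)
  case (single w r)
  have "tens_eval t b \<xi> (Poly_Mapping.single (Fword l) r * p) = (\<lambda>_. 0)" for l
  proof (induction l)
    case Nil
    have "Poly_Mapping.single (Fword []) r * p = tscale r p"
      by (simp add: tscale_def zero_fword_def)
    then show ?case by (simp add: tens_eval_scale assms)
  next
    case (Cons un l)
    obtain u n where un: "un = (u, n)" by force
    have "Poly_Mapping.single (Fword (un # l)) r * p = tgen u n * (Poly_Mapping.single (Fword l) r * p)"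
      using tgen_mult_single[of u n "Fword l" r] by (simp add: un flip: mult.assoc)
    then show ?case by (simp add: tens_eval_tgen Cons transl_0)
  qed
  from this[of "letters w"] show ?case by simp
qed (simp_all add: tens_eval_0 distrib_right tens_eval_add)

text \<open>The product rule for d/dy applied to u(z + y) x(y); the derivative of the field is read
  off from \<open>k binom(n, k) = n binom(n - 1, k - 1)\<close>.\<close>

lemma transl_deriv:
  "t (of_nat (Suc c)) (transl t b u n x (Suc c))
    = t (- of_int n) (transl t b u (n - 1) x c) + transl t b u n (\<lambda>c. t (of_nat (Suc c)) (x (Suc c))) c"
proof -
  let ?B = "\<lambda>i. b u (n - int i) (x (Suc c - i))"
  have abs: "of_nat (Suc i) * bdiff n (Suc i) = - of_int n * bdiff (n - 1) i" for i
    using gbinomial_absorption[of i "of_int n :: complex"] by (simp add: bdiff_def)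
  have "t (of_nat (Suc c)) (transl t b u n x (Suc c))
      = (\<Sum>i\<le>Suc c. t (of_nat i * bdiff n i) (?B i) + t (of_nat (Suc c - i) * bdiff n i) (?B i))"
    unfolding transl_def scale_sum_right
    by (intro sum.cong) (auto simp add: simp flip: scale_left_distrib distrib_right of_nat_add)
  also have "\<dots> = (\<Sum>i\<le>Suc c. t (of_nat i * bdiff n i) (?B i))
      + (\<Sum>i\<le>Suc c. t (of_nat (Suc c - i) * bdiff n i) (?B i))"
    by (rule sum.distrib)
  also have "(\<Sum>i\<le>Suc c. t (of_nat i * bdiff n i) (?B i)) = t (- of_int n) (transl t b u (n - 1) x c)"
    by (subst sum.atMost_Suc_shift) (simp only: abs, simp add: transl_def scale_sum_right algebra_simps)
  also have "(\<Sum>i\<le>Suc c. t (of_nat (Suc c - i) * bdiff n i) (?B i))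
      = transl t b u n (\<lambda>c. t (of_nat (Suc c)) (x (Suc c))) c"
    by (auto simp: transl_def b_scale Suc_diff_le mult.commute intro!: sum.cong)
  finally show ?thesis .
qed

lemma tens_eval_deriv_word:
  "tens_eval t b \<xi> (deriv_word l) c = t (of_nat (Suc c)) (word_act t b \<xi> l (Suc c))"
proof (induction l arbitrary: c)
  case (Cons un l)
  obtain u n where un: "un = (u, n)" by force
  have "tens_eval t b \<xi> (deriv_word l) = (\<lambda>c. t (of_nat (Suc c)) (word_act t b \<xi> l (Suc c)))"
    by (rule ext) (rule Cons)
  moreover have "tens_eval t b \<xi> (Poly_Mapping.single (Fword l) 1) = word_act t b \<xi> l"
    by (simp add: tens_eval_single)
  ultimately show ?case
    by (simp only: un deriv_word.simps tens_eval_add tens_eval_tgen tscale_mult tens_eval_scale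
        word_act_simps transl_deriv)
qed (simp add: tens_eval_0 const_series_def)

lemma tens_eval_d: "tens_eval t b \<xi> (tens_d p) = (\<lambda>c. t (of_nat (Suc c)) (tens_eval t b \<xi> p (Suc c)))"
proof (induction p rule: tens_induct)
  case (single w r)
  show ?case
    by (simp only: tens_d_single tens_eval_scale tens_eval_single tens_eval_deriv_word)
      (simp only: scale_scale mult.commute)
qed (simp_all only: tens_d_0 tens_eval_0 tens_d_add tens_eval_add scale_right_distrib scale_zero_right)

end

text \<open>Tensors of negative degree die by \<open>word_act_neg\<close>; by
  \<open>tens_eval_d\<close> the derivation becomes d/dy and preserves vanishing; left
  multiplication preserves it as well.\<close>

lemma (in Ah_module) tens_eval_J:
  assumes vac: "\<And>u n. n \<ge> 0 \<Longrightarrow> b u n \<xi> = 0" and "p \<in> tens_J"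
  shows "tens_eval t b \<xi> p = (\<lambda>_. 0)"
  using assms(2) unfolding tens_J_def
proof (induction rule: tens.span_induct_alt)
  case base
  show ?case by (rule tens_eval_0)
next
  case (step r x y)
  from step(1) obtain q k p where x: "x = q * (tens_d ^^ k) p" and p: "p \<in> tens_neg" by blast
  have "tens_eval t b \<xi> p = (\<lambda>_. 0)"
  proof
    fix c
    have "wdeg (letters w) < 0" if "w \<in> Poly_Mapping.keys p" for w
      using p that by (simp add: tens_neg_def wdeg_def word_deg_def)
    then show "tens_eval t b \<xi> p c = 0"
      by (simp add: tens_eval_def word_act_neg[OF vac])
  qed
  then have "tens_eval t b \<xi> ((tens_d ^^ k) p) = (\<lambda>_. 0)"
    by (induction k) (simp_all add: tens_eval_d)
  then show ?case
    by (simp only: x tens_eval_add tens_eval_scale tens_eval_mult_eq_0 step(2)) simp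
qed

lemma VT_op_family: "op_family VT_scale (\<lambda>u n. VT_act (tgen u n))"
proof (intro op_family.intro cspace.intro op_family_axioms.intro)
  show "vector_space VT_scale" ..
  fix u n w
  show "\<exists>N. \<forall>n\<ge>N. VT_act (tgen u n) w = 0" by (rule VT_truncation)
  have "VT_act p (x + y) = VT_act p x + VT_act p y" for p x y
    by transfer (simp add: tens_cong_def tens_J_0 distrib_left)
  moreover have "VT_act p (VT_scale r x) = VT_scale r (VT_act p x)" for p r x
    by transfer (simp add: tens_cong_def tens_J_0 mult_tscale)
  ultimately show "Vector_Spaces.linear VT_scale VT_scale (VT_act (tgen u n))"
    by (auto simp: Vector_Spaces.linear_iff VT.vector_space_axioms)
qed

interpretation VT: op_family VT_scale "\<lambda>u n. VT_act (tgen u n)"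
  by (rule VT_op_family)

lemma abs_VT_exhaust: obtains p where "x = abs_VT p"
  using Quotient3_abs_rep[OF Quotient3_VT, of x] by metis

text \<open>V is a quotient of the tensor algebra, so it is spanned by words applied to
  \<open>vac\<close>. This is the induction along generation used for both arguments of vertex
  operators.\<close>

lemma VAh_induct [consumes 1, case_names vac add scale op]:
  assumes V: "is_VAh h s a vac"
    and vac: "P vac" and add: "\<And>x y. P x \<Longrightarrow> P y \<Longrightarrow> P (x + y)"
    and scale: "\<And>r x. P x \<Longrightarrow> P (s r x)" and op: "\<And>u n x. P x \<Longrightarrow> P (a u n x)"
  shows "P v"
proof -
  from V obtain \<pi> where lin: "Vector_Spaces.linear VT_scale s \<pi>" and "surj \<pi>"
    and act: "\<And>u n x. a u n (\<pi> x) = \<pi> (VT_act (tgen u n) x)" and vac': "vac = \<pi> VT_one"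
    by (auto simp: is_VAh_def)
  interpret L: Vector_Spaces.linear VT_scale s \<pi> by (rule lin)
  have P0: "P 0" using scale[OF vac, of 0] by simp
  obtain x where v: "v = \<pi> x" using \<open>surj \<pi>\<close> by blast
  obtain p where x: "x = abs_VT p" by (rule abs_VT_exhaust)
  have "P (\<pi> (abs_VT p))"
  proof (induction p rule: tens_induct)
    case zero
    have "abs_VT 0 = 0" by (simp add: zero_VT_def)
    then show ?case by (simp add: L.zero P0)
  next
    case (single w r)
    have "P (\<pi> (abs_VT (Poly_Mapping.single (Fword l) 1)))" for l
    proof (induction l)
      case Nil
      have "abs_VT (Poly_Mapping.single (Fword []) 1) = VT_one"
        by (simp add: VT_one_def flip: zero_fword_def)
      then show ?case using vac vac' by simp
    next
      case (Cons un l)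
      obtain u n where un: "un = (u, n)" by force
      have "abs_VT (Poly_Mapping.single (Fword (un # l)) 1)
          = VT_act (tgen u n) (abs_VT (Poly_Mapping.single (Fword l) 1))"
        by (simp add: VT_act.abs_eq VT.tgen_mult_single un)
      then show ?case using op[OF Cons, of u n] act by simp
    qed
    then have "P (s r (\<pi> (abs_VT (Poly_Mapping.single (Fword (letters w)) 1))))" by (rule scale)
    moreover have "VT_scale r (abs_VT (Poly_Mapping.single w 1)) = abs_VT (Poly_Mapping.single w r)"
      by (simp add: VT_scale.abs_eq tscale_def mult_single)
    ultimately show ?case by (simp flip: L.scale)
  next
    case (add p q)
    have "abs_VT (p + q) = abs_VT p + abs_VT q" by (simp add: plus_VT.abs_eq)
    then show ?case using assms(3)[OF add] by (simp add: L.add)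
  qed
  then show ?thesis using v x by simp
qed

lemma VAh_op_family:
  assumes "is_VAh h s a vac"
  shows "op_family s a"
proof -
  from assms obtain \<pi> where lin: "Vector_Spaces.linear VT_scale s \<pi>" and "surj \<pi>"
    and act: "\<And>u n x. a u n (\<pi> x) = \<pi> (VT_act (tgen u n) x)"
    by (auto simp: is_VAh_def)
  interpret L: Vector_Spaces.linear VT_scale s \<pi> by (rule lin)
  show ?thesis
  proof (intro op_family.intro cspace.intro op_family_axioms.intro)
    show vs: "vector_space s" ..
    fix u n w
    obtain x where w: "w = \<pi> x" using \<open>surj \<pi>\<close> by blast
    obtain N where "\<And>n. n \<ge> N \<Longrightarrow> VT_act (tgen u n) x = 0" using VT_truncation by blast
    then show "\<exists>N. \<forall>n\<ge>N. a u n w = 0" by (intro exI[of _ N]) (auto simp: w act L.zero)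
    have "a u n (y + z) = a u n y + a u n z" for y z
    proof -
      obtain y' z' where "y = \<pi> y'" "z = \<pi> z'" using \<open>surj \<pi>\<close> by (metis surjD)
      then show ?thesis using VT.b_add by (simp add: act flip: L.add)
    qed
    moreover have "a u n (s r y) = s r (a u n y)" for r y
    proof -
      obtain y' where "y = \<pi> y'" using \<open>surj \<pi>\<close> by (metis surjD)
      then show ?thesis using VT.b_scale by (simp add: act flip: L.scale)
    qed
    ultimately show "Vector_Spaces.linear s s (a u n)"
      using vs by (auto simp: Vector_Spaces.linear_iff)
  qed
qed

lemma VT_act_1: "VT_act 1 x = x"
  by transfer (simp add: tens_cong_def tens_J_0)

lemma VAh_Ah_module:
  assumes h: "h * (h oo (- fps_X)) = 1" and V: "is_VAh h s a vac"
  shows "Ah_module s a h"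
proof (rule restricted_imp_Ah_module[OF h])
  from V obtain \<pi> where lin: "Vector_Spaces.linear VT_scale s \<pi>" and "surj \<pi>"
    and ker: "{x. \<pi> x = 0} = Ah_submodule h"
    and act: "\<And>u n x. a u n (\<pi> x) = \<pi> (VT_act (tgen u n) x)"
    by (auto simp: is_VAh_def)
  interpret L: Vector_Spaces.linear VT_scale s \<pi> by (rule lin)
  interpret op_family s a by (rule VAh_op_family[OF V])
  let ?b = "\<lambda>u n. VT_act (tgen u n)"
  have eq: "\<pi> l = \<pi> r" if "(l, r) \<in> Ah_relations h VT_scale ?b m n x" for l r m n x
  proof -
    \<comment> \<open>The submodule is generated by tensors applied to relations; the tensor 1 gives
      the relation itself.\<close>
    have "VT_act 1 (l - r) \<in> Ah_submodule h"
      unfolding Ah_submodule_def by (rule VT.span_base) (use that in blast)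
    then have "\<pi> (l - r) = 0" using ker VT_act_1 by auto
    then show ?thesis by (simp add: L.diff)
  qed
  have fa: "\<pi> (fps_act VT_scale g (- 1) (\<lambda>m n. ?b v n (?b u m x)) m n)
      = fps_act s g (- 1) (\<lambda>m n. a v n (a u m (\<pi> x))) m n" for g u v x m n
  proof -
    obtain N where "vanish_above (\<lambda>m n. ?b v n (?b u m x)) m n N"
      using VT.b_bounded2[of v u x] by (auto simp: bounded2_def)
    from linear_fps_act[OF lin this] show ?thesis by (simp add: act)
  qed
  have "l = r" if lr: "(l, r) \<in> Ah_relations h s a m n w" for l r m n w
  proof -
    obtain x where w: "w = \<pi> x" using \<open>surj \<pi>\<close> by (metis surjD)
    have "Ah_relations h s a m n w = (\<lambda>(l, r). (\<pi> l, \<pi> r)) ` Ah_relations h VT_scale ?b m n x"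
      unfolding Ah_relations_fps_act VT.Ah_relations_fps_act w
      by (simp only: image_insert image_empty prod.case fa act L.diff L.zero)
    with lr eq show ?thesis by auto
  qed
  then show "restricted_Ah_module h s a"
    unfolding restricted_Ah_module_def using b_linear b_trunc L.vs2.vector_space_axioms by blast
qed

lemma VAh_vac:
  assumes "is_VAh h s a vac" "n \<ge> 0"
  shows "a u n vac = 0"
proof -
  from assms(1) obtain \<pi> where lin: "Vector_Spaces.linear VT_scale s \<pi>"
    and act: "\<And>u n x. a u n (\<pi> x) = \<pi> (VT_act (tgen u n) x)" and vac: "vac = \<pi> VT_one"
    by (auto simp: is_VAh_def)
  interpret L: Vector_Spaces.linear VT_scale s \<pi> by (rule lin)
  have pos: "tgen u n \<in> tens_neg" if "n > 0" for n
    using that by (auto simp: tgen_def tens_neg_def word_deg_def)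
  have "tgen u n \<in> tens_J"
  proof (cases "n = 0")
    case True
    \<comment> \<open>The letter u(0) has degree 0, so it is not a tensor of negative degree; it
      lies in the ideal because \<open>d (u(1)) = - u(0)\<close>.\<close>
    have "1 * (tens_d ^^ 1) (tgen u 1) \<in> tens_J"
      unfolding tens_J_def
      by (rule tens.span_base, intro CollectI exI[of _ "1::tens"] exI[of _ "1::nat"] exI[of _ "tgen u 1"])
        (use pos[of 1] in simp)
    then have "tscale (- 1) (tgen u 0) \<in> tens_J" by (simp add: tens_d_tgen)
    from tens_J_scale[OF this, of "- 1"] show ?thesis using True by simp
  next
    case False
    then show ?thesis using pos assms(2) tens_neg_subset_J by auto
  qed
  then have "VT_act (tgen u n) VT_one = 0"
    by transfer (simp add: tens_cong_def)
  then show ?thesis by (simp add: vac act L.zero)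
qed

text \<open>Words are evaluated on \<open>\<xi>\<close> by translated modes. The result factors
  through the left ideal by \<open>tens_eval_J\<close> and through the relations by
  \<open>transl_rel\<close>, hence descends to V.\<close>

theorem VAh_universal:
  fixes s :: "complex \<Rightarrow> 'v::ab_group_add \<Rightarrow> 'v" and t :: "complex \<Rightarrow> 'w::ab_group_add \<Rightarrow> 'w"
  assumes V: "is_VAh h s a vac" and W: "Ah_module t b h"
    and vac: "\<And>u n. n \<ge> 0 \<Longrightarrow> b u n \<xi> = 0"
  obtains \<theta> :: "'v \<Rightarrow> nat \<Rightarrow> 'w" where
    "\<And>x y. \<theta> (x + y) = (\<lambda>c. \<theta> x c + \<theta> y c)" "\<And>r x. \<theta> (s r x) = (\<lambda>c. t r (\<theta> x c))"
    "\<theta> vac = const_series \<xi>" "\<And>u n x. \<theta> (a u n x) = transl t b u n (\<theta> x)"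
proof -
  from V obtain \<pi> where lin: "Vector_Spaces.linear VT_scale s \<pi>" and "surj \<pi>"
    and ker: "{x. \<pi> x = 0} = Ah_submodule h"
    and act: "\<And>u n x. a u n (\<pi> x) = \<pi> (VT_act (tgen u n) x)" and vac': "vac = \<pi> VT_one"
    by (auto simp: is_VAh_def)
  interpret L: Vector_Spaces.linear VT_scale s \<pi> by (rule lin)
  interpret Ah_module t b h by (rule W)
  let ?b = "\<lambda>u n. VT_act (tgen u n)"
  let ?ev = "tens_eval t b \<xi>"
  define \<phi> where "\<phi> x = ?ev (rep_VT x)" for x
  have \<phi>_abs: "\<phi> (abs_VT p) = ?ev p" for p
  proof -
    have "tens_cong (rep_VT (abs_VT p)) p"
      by (simp add: Quotient3_abs_rep[OF Quotient3_VT] flip: VT.abs_eq_iff)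
    then have "?ev (rep_VT (abs_VT p) - p) = (\<lambda>_. 0)"
      unfolding tens_cong_def by (intro tens_eval_J) (auto simp: vac)
    then have "?ev (rep_VT (abs_VT p) - p + p) = ?ev p"
      by (simp only: tens_eval_add) simp
    then show ?thesis by (simp add: \<phi>_def)
  qed
  have \<phi>_add: "\<phi> (x + y) = (\<lambda>c. \<phi> x c + \<phi> y c)" for x y
  proof -
    obtain p q where "x = abs_VT p" "y = abs_VT q" by (metis abs_VT_exhaust)
    then show ?thesis by (simp add: plus_VT.abs_eq \<phi>_abs tens_eval_add)
  qed
  have \<phi>_scale: "\<phi> (VT_scale r x) = (\<lambda>c. t r (\<phi> x c))" for x r
  proof -
    obtain p where "x = abs_VT p" by (metis abs_VT_exhaust)
    then show ?thesis by (simp add: VT_scale.abs_eq \<phi>_abs tens_eval_scale)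
  qed
  have \<phi>_act: "\<phi> (?b u n x) = transl t b u n (\<phi> x)" for x u n
  proof -
    obtain p where "x = abs_VT p" by (metis abs_VT_exhaust)
    then show ?thesis by (simp add: VT_act.abs_eq \<phi>_abs tens_eval_tgen)
  qed
  have \<phi>_0: "\<phi> 0 = (\<lambda>_. 0)" using \<phi>_scale[of 0 0] by simp
  have \<phi>_diff: "\<phi> (x - y) = (\<lambda>c. \<phi> x c - \<phi> y c)" for x y
    using \<phi>_add[of "x - y" y] by (auto simp: fun_eq_iff algebra_simps)
  have \<phi>_lin: "Vector_Spaces.linear VT_scale t (\<lambda>x. \<phi> x c)" for c
    using VT.vector_space_axioms vector_space_axioms
    by (auto simp: Vector_Spaces.linear_iff \<phi>_add \<phi>_scale)
  have fa: "\<phi> (?b u m (?b v n x)) c = \<phi> (fps_act VT_scale (gfac h u v) (- 1) (\<lambda>m n. ?b v n (?b u m x)) m n) c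
      + t (geps u v) (\<phi> (?b Psi (m + n) x) c)" for u v x m n c
  proof -
    obtain N where N: "vanish_above (\<lambda>m n. ?b v n (?b u m x)) m n N"
      using VT.b_bounded2[of v u x] by (auto simp: bounded2_def)
    \<comment> \<open>The truncation already present in the tensor module is carried over by
      \<open>\<phi>\<close>, with the same bound for every power of y.\<close>
    then have "vanish_above (\<lambda>m n. transl t b v n (transl t b u m (\<phi> x)) c) m n N"
      by (simp add: vanish_above_def \<phi>_0 flip: \<phi>_act)
    from transl_rel[OF this] linear_fps_act[OF \<phi>_lin N]
    show ?thesis by (simp add: \<phi>_act)
  qed
  have rel0: "\<phi> l = \<phi> r" if "(l, r) \<in> Ah_relations h VT_scale ?b m n x" for l r m n x
  proof
    fix c
    show "\<phi> l c = \<phi> r c"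
      using that fa[of E m E n x c] fa[of F m F n x c] fa[of Psi m E n x c] fa[of Psi m F n x c]
        fa[of E m F n x c] fa[of Psi m Psi n x c]
      unfolding VT.Ah_relations_fps_act
      by (auto simp: gfac_def geps_def VT.fps_act_one \<phi>_diff \<phi>_0)
  qed
  have act0: "\<phi> (VT_act p x) = (\<lambda>_. 0)" if "\<phi> x = (\<lambda>_. 0)" for p x
  proof -
    obtain q where x: "x = abs_VT q" by (metis abs_VT_exhaust)
    with that show ?thesis by (simp add: VT_act.abs_eq \<phi>_abs tens_eval_mult_eq_0)
  qed
  have sub: "\<phi> x = (\<lambda>_. 0)" if "x \<in> Ah_submodule h" for x
    using that unfolding Ah_submodule_def
  proof (induction rule: VT.span_induct_alt)
    case (step r x y)
    from step(1) obtain p l l' m n w where x: "x = VT_act p (l - l')"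
      and "(l, l') \<in> Ah_relations h VT_scale ?b m n w" by blast
    then have "\<phi> (l - l') = (\<lambda>_. 0)" using rel0 by (simp add: \<phi>_diff)
    then show ?case by (simp add: \<phi>_add \<phi>_scale step(2) x act0)
  qed (rule \<phi>_0)
  \<comment> \<open>Any preimage gives the same value, since \<open>\<phi>\<close> vanishes on the
    kernel of \<open>\<pi>\<close>.\<close>
  define \<theta> where "\<theta> v = \<phi> (SOME x. \<pi> x = v)" for v
  have \<theta>: "\<theta> (\<pi> x) = \<phi> x" for x
  proof -
    have "\<pi> (SOME y. \<pi> y = \<pi> x) = \<pi> x" by (rule someI) (rule refl)
    then have "\<pi> ((SOME y. \<pi> y = \<pi> x) - x) = 0" by (simp add: L.diff)
    then have "\<phi> ((SOME y. \<pi> y = \<pi> x) - x) = (\<lambda>_. 0)" using ker by (intro sub) blast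
    then show ?thesis unfolding \<phi>_diff \<theta>_def by (simp add: fun_eq_iff)
  qed
  show thesis
  proof (rule that[of \<theta>])
    show "\<theta> (x + y) = (\<lambda>c. \<theta> x c + \<theta> y c)" for x y
    proof -
      obtain x' y' where "x = \<pi> x'" "y = \<pi> y'" using \<open>surj \<pi>\<close> by (metis surjD)
      then show ?thesis by (simp add: \<theta> \<phi>_add flip: L.add)
    qed
    show "\<theta> (s r x) = (\<lambda>c. t r (\<theta> x c))" for r x
    proof -
      obtain x' where "x = \<pi> x'" using \<open>surj \<pi>\<close> by (metis surjD)
      then show ?thesis by (simp add: \<theta> \<phi>_scale flip: L.scale)
    qed
    show "\<theta> (a u n x) = transl t b u n (\<theta> x)" for u n x
    proof -
      obtain x' where "x = \<pi> x'" using \<open>surj \<pi>\<close> by (metis surjD)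
      then show ?thesis by (simp add: \<theta> \<phi>_act act)
    qed
    have one: "VT_one = abs_VT (Poly_Mapping.single (Fword []) 1)"
      by (simp add: VT_one_def flip: zero_fword_def)
    show "\<theta> vac = const_series \<xi>"
      unfolding vac' \<theta> one \<phi>_abs tens_eval_single by simp
  qed
qed

section \<open>Vertex operators on restricted modules\<close>

text \<open>The operators \<open>\<kappa> E i\<close>, \<open>\<kappa> F i\<close>, \<open>\<kappa> Psi i\<close> are the coefficients of commuting series \<open>p(z)\<close>, \<open>q(z)\<close>,
  \<open>p(z) q(z)\<close> by which \<open>e(z)\<close>, \<open>f(z)\<close>, \<open>\<psi>(z)\<close> are multiplied.\<close>

lemma (in Ah_module) Ah_module_mult:
  fixes \<kappa> :: "gen \<Rightarrow> nat \<Rightarrow> 'w \<Rightarrow> 'w"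
  assumes lin: "\<And>u i. Vector_Spaces.linear t t (\<kappa> u i)"
    and \<kappa>b: "\<And>u i v n x. \<kappa> u i (b v n x) = b v n (\<kappa> u i x)"
    and \<kappa>\<kappa>: "\<And>u i v j x. \<kappa> u i (\<kappa> v j x) = \<kappa> v j (\<kappa> u i x)"
    and \<kappa>Psi: "\<And>r x. \<kappa> Psi r x = (\<Sum>i\<le>r. \<kappa> E i (\<kappa> F (r - i) x))"
  shows "Ah_module t (\<lambda>u n x. Sum_any (\<lambda>i. \<kappa> u i (b u (n + int i) x))) h"
    (is "Ah_module t ?B h")
proof -
  have \<kappa>_add: "\<kappa> u i (x + y) = \<kappa> u i x + \<kappa> u i y" and \<kappa>_scale: "\<kappa> u i (t r x) = t r (\<kappa> u i x)" for u i x y r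
    using lin[of u i] by (simp_all add: Vector_Spaces.linear_iff)
  have \<kappa>_0 [simp]: "\<kappa> u i 0 = 0" for u i using \<kappa>_scale[of u i 0 0] by simp
  have \<kappa>_sum: "\<kappa> u i (sum f A) = (\<Sum>k\<in>A. \<kappa> u i (f k))" for u i A and f :: "'c \<Rightarrow> 'w"
    by (induction A rule: infinite_finite_induct) (auto simp: \<kappa>_add)
  have B_sum: "?B u n x = (\<Sum>i<K. \<kappa> u i (b u (n + int i) x))"
    if "\<And>k. k \<ge> n + int K \<Longrightarrow> b u k x = 0" for u n x K
    by (rule Sum_any_lessThan) (simp add: that)
  interpret B: op_family t ?B
  proof (intro op_family.intro cspace.intro op_family_axioms.intro vector_space_axioms)
    fix u n x
    obtain N where N: "\<And>k. k \<ge> N \<Longrightarrow> b u k x = 0" using b_trunc by blast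
    then have "?B u n x = 0" if "n \<ge> N" for n
      using B_sum[of n 0 u x] that by simp
    then show "\<exists>N. \<forall>n\<ge>N. ?B u n x = 0" by blast
    have "?B u n (x + y) = ?B u n x + ?B u n y" for x y
    proof -
      obtain N N' where N: "\<And>k. k \<ge> N \<Longrightarrow> b u k x = 0" "\<And>k. k \<ge> N' \<Longrightarrow> b u k y = 0" using b_trunc by metis
      define K where "K = nat (max N N' - n)"
      have "b u k x = 0" if "k \<ge> n + int K" for k
        by (rule N(1)) (use that in \<open>unfold K_def, linarith\<close>)
      moreover have "b u k y = 0" if "k \<ge> n + int K" for k
        by (rule N(2)) (use that in \<open>unfold K_def, linarith\<close>)
      ultimately have "?B u n x = (\<Sum>i<K. \<kappa> u i (b u (n + int i) x))"
        "?B u n y = (\<Sum>i<K. \<kappa> u i (b u (n + int i) y))"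
        "?B u n (x + y) = (\<Sum>i<K. \<kappa> u i (b u (n + int i) (x + y)))"
        by (intro B_sum; simp add: b_add)+
      then show ?thesis
        by (simp only: b_add \<kappa>_add sum.distrib)
    qed
    moreover have "?B u n (t r x) = t r (?B u n x)" for r x
    proof -
      obtain N where N: "\<And>k. k \<ge> N \<Longrightarrow> b u k x = 0" using b_trunc by metis
      have "b u k x = 0" if "k \<ge> n + int (nat (N - n))" for k
        by (rule N) (use that in linarith)
      then have "?B u n x = (\<Sum>i<nat (N - n). \<kappa> u i (b u (n + int i) x))"
        "?B u n (t r x) = (\<Sum>i<nat (N - n). \<kappa> u i (b u (n + int i) (t r x)))"
        by (intro B_sum; simp add: b_scale)+
      then show ?thesis
        by (simp only: b_scale \<kappa>_scale scale_sum_right)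
    qed
    ultimately show "Vector_Spaces.linear t t (?B u n)"
      by (auto simp: Vector_Spaces.linear_iff vector_space_axioms)
  qed
  show ?thesis
  proof unfold_locales
    fix u m v n x
    let ?f = "\<lambda>m n. b v n (b u m x)" and ?g = "\<lambda>m n. b u m (b v n x)"
    obtain K1 where K1: "vanish_above ?f m n K1" using b_bounded2[of v u x] by (auto simp: bounded2_def)
    obtain K2' where K2': "vanish_above (\<lambda>n m. b u m (b v n x)) n m K2'"
      using b_bounded2[of u v x] by (auto simp: bounded2_def)
    then have K2: "vanish_above ?g m n K2'" by (auto simp: vanish_above_def add.commute)
    obtain N3 where N3: "\<And>k. k \<ge> N3 \<Longrightarrow> b u k x = 0" using b_trunc by blast
    obtain N4 where N4: "\<And>k. k \<ge> N4 \<Longrightarrow> b v k x = 0" using b_trunc by blast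
    obtain N5 where N5: "\<And>k. k \<ge> N5 \<Longrightarrow> b Psi k x = 0" using b_trunc by blast
    \<comment> \<open>A single cut-off for both orders of the product, both single fields and the
      psi term, so that all sums below run over the same square.\<close>
    define K where "K = K1 + K2' + nat (N3 - m) + nat (N4 - n) + nat (N5 - (m + n))"
    have f0: "vanish_above ?f m n K" and g0: "vanish_above ?g m n K"
      by (rule vanish_above_mono[OF K1], simp add: K_def) (rule vanish_above_mono[OF K2], simp add: K_def)
    have u0: "b u k x = 0" if "k \<ge> m + int K" for k by (rule N3) (use that in \<open>unfold K_def, linarith\<close>)
    have v0: "b v k x = 0" if "k \<ge> n + int K" for k by (rule N4) (use that in \<open>unfold K_def, linarith\<close>)
    have p0: "b Psi k x = 0" if "k \<ge> m + n + int K" for k by (rule N5) (use that in \<open>unfold K_def, linarith\<close>)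
    \<comment> \<open>Multiplication of a two-variable family by the factors of u(z) and v(w), cut
      off at \<open>K\<close>.\<close>
    define T where "T f m n = (\<Sum>i<K. \<Sum>j<K. \<kappa> u i (\<kappa> v j (f (m + int i) (n + int j))))" for f m n
    have 1: "?B v (n + int j') (?B u (m + int i') x) = T ?f (m + int i') (n + int j')" for i' j'
    proof -
      have "?B u (m + int i') x = (\<Sum>i<K. \<kappa> u i (b u (m + int i' + int i) x))"
        by (rule B_sum) (use u0 in auto)
      moreover have "?B v (n + int j') (\<Sum>i<K. \<kappa> u i (b u (m + int i' + int i) x))
        = (\<Sum>j<K. \<kappa> v j (b v (n + int j' + int j) (\<Sum>i<K. \<kappa> u i (b u (m + int i' + int i) x))))"
      proof (rule B_sum)
        fix k assume k: "k \<ge> n + int j' + int K"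
        have "b v k (b u (m + int i' + int i) x) = 0" for i
        proof -
          have "k = n + int (nat (k - n))" using k by simp
          moreover have "K \<le> (i' + i) + nat (k - n)" using k by linarith
          ultimately show ?thesis using f0 unfolding vanish_above_def by (metis add.assoc of_nat_add)
        qed
        then show "b v k (\<Sum>i<K. \<kappa> u i (b u (m + int i' + int i) x)) = 0"
          by (simp add: b_sum flip: \<kappa>b)
      qed
      ultimately show ?thesis
        by (simp add: T_def b_sum \<kappa>_sum flip: \<kappa>b) (subst sum.swap, simp add: \<kappa>\<kappa>[of v])
    qed
    have 2: "?B u m (?B v n x) = T ?g m n"
    proof -
      have "?B v n x = (\<Sum>j<K. \<kappa> v j (b v (n + int j) x))"
        by (rule B_sum) (use v0 in auto)
      moreover have "?B u m (\<Sum>j<K. \<kappa> v j (b v (n + int j) x))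
        = (\<Sum>i<K. \<kappa> u i (b u (m + int i) (\<Sum>j<K. \<kappa> v j (b v (n + int j) x))))"
      proof (rule B_sum)
        fix k assume k: "k \<ge> m + int K"
        have "b u k (b v (n + int j) x) = 0" for j
        proof -
          have "k = m + int (nat (k - m))" using k by simp
          moreover have "K \<le> nat (k - m) + j" using k by linarith
          ultimately show ?thesis using g0 unfolding vanish_above_def by metis
        qed
        then show "b u k (\<Sum>j<K. \<kappa> v j (b v (n + int j) x)) = 0"
          by (simp add: b_sum flip: \<kappa>b)
      qed
      ultimately show ?thesis
        by (simp add: T_def b_sum \<kappa>_sum flip: \<kappa>b)
    qed
    have Tf0: "vanish_above (T ?f) m n K"
      unfolding vanish_above_def T_def
    proof (intro allI impI sum.neutral ballI)
      fix i' j' i j assume "K \<le> i' + j'"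
      then have "?f (m + int (i' + i)) (n + int (j' + j)) = 0"
        using f0 unfolding vanish_above_def by (meson add_mono le_add1 order_trans)
      then show "\<kappa> u i (\<kappa> v j (?f (m + int i' + int i) (n + int j' + int j))) = 0"
        by (simp add: add.assoc)
    qed
    have Tpow: "(shift2 t (- 1) ^^ r) (T f) m n
        = (\<Sum>i<K. \<Sum>j<K. \<kappa> u i (\<kappa> v j ((shift2 t (- 1) ^^ r) f (m + int i) (n + int j))))" for r f
      unfolding T_def shift2_pow_sum scale_sum_right \<kappa>_sum \<kappa>_scale
      by (subst sum.swap, rule sum.cong[OF refl], subst sum.swap) (simp add: add_ac)
    have "T (fps_act t (gfac h u v) (- 1) ?f) m n
        = (\<Sum>i<K. \<Sum>j<K. \<kappa> u i (\<kappa> v j (\<Sum>r<K. t (fps_nth (gfac h u v) r) ((shift2 t (- 1) ^^ r) ?f (m + int i) (n + int j)))))"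
      unfolding T_def by (simp only: fps_act_sum[OF vanish_above_shift[OF f0] order_refl])
    also have "\<dots> = (\<Sum>r<K. t (fps_nth (gfac h u v) r) ((shift2 t (- 1) ^^ r) (T ?f) m n))"
      unfolding Tpow scale_sum_right \<kappa>_sum \<kappa>_scale
      by (subst (2) sum.swap, rule sum.cong[OF refl], subst sum.swap) simp
    also have "\<dots> = fps_act t (gfac h u v) (- 1) (T ?f) m n"
      by (rule fps_act_sum[symmetric, OF Tf0 order_refl])
    also have "\<dots> = fps_act t (gfac h u v) (- 1) (\<lambda>m n. ?B v n (?B u m x)) m n"
      unfolding fps_act_def by (intro Sum_any.cong arg_cong2[where f = t] refl shift2_pow_cong 1[symmetric])
    finally have 3: "T (fps_act t (gfac h u v) (- 1) ?f) m n = \<dots>" .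
    \<comment> \<open>The delta function identifies z with w, so \<open>p(z) q(w)\<close> becomes
      \<open>p(z) q(z)\<close>, the factor of psi. For the pairs other than e, f the coefficient
      \<open>geps\<close> is zero.\<close>
    have 4: "t (geps u v) (T (\<lambda>m n. b Psi (m + n) x) m n) = t (geps u v) (?B Psi (m + n) x)"
    proof -
      have "?B Psi (m + n) x = (\<Sum>r<K. \<kappa> Psi r (b Psi (m + n + int r) x))"
        by (rule B_sum) (use p0 in auto)
      also have "\<dots> = (\<Sum>(i, j)\<in>{(i, j). i + j < K}. \<kappa> E i (\<kappa> F j (b Psi (m + n + int (i + j)) x)))"
        unfolding \<kappa>Psi by (subst sum.triangle_reindex) simp
      also have "\<dots> = (\<Sum>(i, j)\<in>{..<K} \<times> {..<K}. \<kappa> E i (\<kappa> F j (b Psi (m + n + int (i + j)) x)))"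
      proof (rule sum.mono_neutral_left)
        have "b Psi (m + n + int (i + j)) x = 0" if "K \<le> i + j" for i j
          by (rule p0) (use that in linarith)
        then show "\<forall>ij\<in>{..<K} \<times> {..<K} - {(i, j). i + j < K}.
            (case ij of (i, j) \<Rightarrow> \<kappa> E i (\<kappa> F j (b Psi (m + n + int (i + j)) x))) = 0"
          by (auto simp del: of_nat_add) (metis \<kappa>_0 not_less)
      qed auto
      finally have *: "?B Psi (m + n) x = (\<Sum>i<K. \<Sum>j<K. \<kappa> E i (\<kappa> F j (b Psi (m + n + int (i + j)) x)))"
        by (simp add: sum.cartesian_product)
      moreover have "(\<Sum>i<K. \<Sum>j<K. \<kappa> E i (\<kappa> F j (b Psi (m + n + int (i + j)) x)))
        = (\<Sum>i<K. \<Sum>j<K. \<kappa> F i (\<kappa> E j (b Psi (m + n + int (i + j)) x)))"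
        by (subst sum.swap) (simp add: \<kappa>\<kappa>[of E] add.commute)
      ultimately show ?thesis
        unfolding T_def by (cases u; cases v) (simp_all add: geps_def algebra_simps)
    qed
    have "T ?g m n = T (fps_act t (gfac h u v) (- 1) ?f) m n + t (geps u v) (T (\<lambda>m n. b Psi (m + n) x) m n)"
      unfolding T_def rel[of u _ v]
      by (simp only: \<kappa>_add \<kappa>_scale sum.distrib scale_sum_right)
    then show "?B u m (?B v n x) = fps_act t (gfac h u v) (- 1) (\<lambda>m n. ?B v n (?B u m x)) m n
      + t (geps u v) (?B Psi (m + n) x)"
      by (simp only: 2 3 4)
  qed
qed

text \<open>The commutator of \<open>z^l e(z)\<close> and \<open>w^l f(w)\<close> carries
  \<open>z^l w^l\<close>, which on the delta function equals \<open>z^(2 l)\<close>; this forces the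
  exponent for psi.\<close>

definition glev :: "nat \<Rightarrow> gen \<Rightarrow> nat" where
  "glev l u = (if u = Psi then 2 * l else l)"

lemma (in Ah_module) Ah_module_shift: "Ah_module t (\<lambda>u n. b u (n + int (glev l u))) h"
proof -
  interpret B: op_family t "\<lambda>u n. b u (n + int (glev l u))"
  proof (intro op_family.intro cspace.intro op_family_axioms.intro vector_space_axioms b_linear)
    fix u x
    obtain N where "\<And>k. k \<ge> N \<Longrightarrow> b u k x = 0" using b_trunc by blast
    then show "\<exists>N. \<forall>n\<ge>N. b u (n + int (glev l u)) x = 0" by (intro exI[of _ N]) auto
  qed
  show ?thesis
  proof unfold_locales
    fix u m v n x
    have "t (geps u v) (b Psi (m + int (glev l u) + (n + int (glev l v))) x)
        = t (geps u v) (b Psi (m + n + int (glev l Psi)) x)"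
      by (cases u; cases v) (auto simp: geps_def glev_def algebra_simps)
    then show "b u (m + int (glev l u)) (b v (n + int (glev l v)) x)
       = fps_act t (gfac h u v) (- 1) (\<lambda>m n. b v (n + int (glev l v)) (b u (m + int (glev l u)) x)) m n
       + t (geps u v) (b Psi (m + n + int (glev l Psi)) x)"
      by (subst rel, subst fps_act_commute_index) simp
  qed
qed

lemma coeff_pCons0_pow: "coeff ((pCons 0 ^^ k) p) n = (if n < k then 0 else coeff p (n - k))"
  by (induction k arbitrary: n) (auto simp: coeff_pCons split: nat.splits)

text \<open>The polynomial variable will stand for \<open>x^-1\<close>. Polynomials have finitely
  many coefficients, so the coefficientwise action is truncated uniformly.\<close>

lemma (in Ah_module) Ah_module_poly:
  "Ah_module (\<lambda>r. map_poly (t r)) (\<lambda>u n. map_poly (b u n)) h"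
proof -
  have ct: "coeff (map_poly (t r) p) k = t r (coeff p k)" for r p k
    by (rule coeff_map_poly) simp
  have cb: "coeff (map_poly (b u n) p) k = b u n (coeff p k)" for u n p k
    by (rule coeff_map_poly) simp
  interpret P: cspace "\<lambda>r. map_poly (t r)"
    by unfold_locales (auto simp: poly_eq_iff ct scale_right_distrib scale_left_distrib)
  interpret P: op_family "\<lambda>r. map_poly (t r)" "\<lambda>u n. map_poly (b u n)"
  proof (intro op_family.intro op_family_axioms.intro P.cspace_axioms)
    fix u n
    show "Vector_Spaces.linear (\<lambda>r. map_poly (t r)) (\<lambda>r. map_poly (t r)) (map_poly (b u n))"
      by (simp add: Vector_Spaces.linear_iff P.vector_space_axioms poly_eq_iff ct cb b_add b_scale)
  next
    fix u p
    have "\<exists>J. \<forall>k\<in>{..degree p}. \<forall>n\<ge>J. b u n (coeff p k) = 0"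
      by (rule ex_uniform_bound) (auto intro: b_trunc)
    then obtain J where J: "\<And>k n. k \<le> degree p \<Longrightarrow> n \<ge> J \<Longrightarrow> b u n (coeff p k) = 0" by auto
    have "map_poly (b u n) p = 0" if "n \<ge> J" for n
    proof (rule poly_eqI)
      fix k
      show "coeff (map_poly (b u n) p) k = coeff 0 k"
        using J[OF _ that, of k] by (cases "k \<le> degree p") (auto simp: cb coeff_eq_0)
    qed
    then show "\<exists>N. \<forall>n\<ge>N. map_poly (b u n) p = 0" by blast
  qed
  show ?thesis
  proof unfold_locales
    fix u m v n p
    obtain N where N: "vanish_above (\<lambda>m n. map_poly (b v n) (map_poly (b u m) p)) m n N"
      using P.b_bounded2[of v u p] by (auto simp: bounded2_def)
    have lin: "Vector_Spaces.linear (\<lambda>r. map_poly (t r)) t (\<lambda>p. coeff p k)" for k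
      by (simp add: Vector_Spaces.linear_iff P.vector_space_axioms vector_space_axioms ct)
    show "map_poly (b u m) (map_poly (b v n) p)
      = fps_act (\<lambda>r. map_poly (t r)) (gfac h u v) (- 1) (\<lambda>m n. map_poly (b v n) (map_poly (b u m) p)) m n
        + map_poly (t (geps u v)) (map_poly (b Psi (m + n)) p)"
    proof (rule poly_eqI)
      fix k
      show "coeff (map_poly (b u m) (map_poly (b v n) p)) k
      = coeff (fps_act (\<lambda>r. map_poly (t r)) (gfac h u v) (- 1) (\<lambda>m n. map_poly (b v n) (map_poly (b u m) p)) m n
        + map_poly (t (geps u v)) (map_poly (b Psi (m + n)) p)) k"
        unfolding coeff_add linear_fps_act[OF lin N] cb ct by (rule rel)
    qed
  qed
qed

section \<open>Existence and uniqueness of intertwiners from V to Laurent series\<close>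

context cspace
begin

text \<open>Multiplying by \<open>x1 = x0 + x2\<close>: the two recursions express the case
  \<open>p + 1\<close> identically through the case \<open>p\<close>.\<close>

lemma twist_iter_up:
  assumes G: "\<And>N j. j \<ge> L \<Longrightarrow> G N j = 0" and K: "\<And>j N. j \<ge> M \<Longrightarrow> K j N = 0"
    and eq: "\<And>l q. twist t G l p q = iter t K l p q" and "p \<le> p'"
  shows "twist t G l p' q = iter t K l p' q"
  using \<open>p \<le> p'\<close>
proof (induction p' arbitrary: l q rule: int_ge_induct)
  case base
  show ?case by (rule eq)
next
  case (step p')
  have "twist t G l (p' + 1) q = twist t G (l + 1) p' q + twist t G l p' (q + 1)"
    using twist_rec[of L G l p' q, OF G] by simp
  also have "\<dots> = iter t K (l + 1) p' q + iter t K l p' (q + 1)" by (simp add: step)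
  also have "\<dots> = iter t K l (p' + 1) q"
    using iter_rec[of M K l p' q, OF K] by simp
  finally show ?case .
qed

text \<open>Multiplication by \<open>(x2 + x0)^p\<close> is injective on series truncated in
  \<open>x0\<close>: descending from \<open>M\<close>, each row is the leading term, with
  coefficient 1, of an equation whose other terms lie in rows already known to vanish.\<close>

lemma iter_inj:
  assumes K: "\<And>j N. j \<ge> M \<Longrightarrow> K j N = 0" and eq: "\<And>l q. iter t K l p q = 0"
  shows "K l q = 0"
proof -
  have "\<forall>q. K (M - int i) q = 0" for i
  proof (induction i rule: less_induct)
    case (less i)
    show ?case
    proof
      fix q
      have "0 = (\<Sum>r<Suc i. t (of_int p gchoose r) (K (M - int i + int r) (p + (q - p) - int r)))"
        using iter_sum[of M K "M - int i" "Suc i" p "q - p", OF K] eq by simp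
      also have "\<dots> = K (M - int i) q
          + (\<Sum>r<i. t (of_int p gchoose (Suc r)) (K (M - int i + int (Suc r)) (p + (q - p) - int (Suc r))))"
        by (subst sum.lessThan_Suc_shift) simp
      also have "(\<Sum>r<i. t (of_int p gchoose (Suc r)) (K (M - int i + int (Suc r)) (p + (q - p) - int (Suc r)))) = 0"
      proof (intro sum.neutral ballI)
        fix r assume "r \<in> {..<i}"
        then have "M - int i + int (Suc r) = M - int (i - Suc r)" "i - Suc r < i" by auto
        then have "K (M - int i + int (Suc r)) q' = 0" for q' using less by metis
        then show "t (of_int p gchoose (Suc r)) (K (M - int i + int (Suc r)) (p + (q - p) - int (Suc r))) = 0"
          by (simp only: scale_zero_right)
      qed
      finally show "K (M - int i) q = 0" by simp
    qed
  qed
  from this[of "nat (M - l)"] show ?thesis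
    using K by (cases "l \<ge> M") auto
qed

lemma iter_diff:
  assumes "\<And>j N. j \<ge> M \<Longrightarrow> K j N = 0" "\<And>j N. j \<ge> M' \<Longrightarrow> K' j N = 0"
  shows "iter t (\<lambda>j n. K j n - K' j n) l p q = iter t K l p q - iter t K' l p q"
proof -
  let ?I = "nat (max M M' - l)"
  have le: "max M M' \<le> l + int ?I" by linarith
  have 1: "K j N = 0" "K' j N = 0" "K j N - K' j N = 0" if "j \<ge> max M M'" for j N
    using that assms by auto
  show ?thesis
    by (subst iter_sum[OF 1(1) le], assumption, subst iter_sum[OF 1(2) le], assumption,
        subst iter_sum[OF 1(3) le], assumption) (simp add: scale_right_diff_distrib sum_subtractf)
qed

end

text \<open>\<open>intertwiner\<close>: the map \<open>y\<close> from \<open>V\<close> to \<open>W((x))\<close> sends the vacuum to \<open>w\<close> and satisfies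
  \<open>(z + x)^(glev l g) (y (g(z) u) - g(z + x) y u) = 0\<close>.\<close>

definition intertwiner where
  "intertwiner s a vac t b l w y \<longleftrightarrow>
    (\<forall>n. Vector_Spaces.linear s t (\<lambda>v. y v n)) \<and>
    (\<forall>n. y vac n = (if n = -1 then w else 0)) \<and>
    (\<forall>v. \<exists>N. \<forall>n\<ge>N. y v n = 0) \<and>
    (\<forall>g u m q. twist t (\<lambda>N j. b g N (y u j)) m (int (glev l g)) q
      = iter t (\<lambda>j n. y (a g j u) n) m (int (glev l g)) q)"

locale VAh_pair = W: Ah_module t b h
  for h :: "complex fps" and s :: "complex \<Rightarrow> 'v::ab_group_add \<Rightarrow> 'v" and a :: "gen \<Rightarrow> int \<Rightarrow> 'v \<Rightarrow> 'v"
    and vac :: 'v and t :: "complex \<Rightarrow> 'w::ab_group_add \<Rightarrow> 'w" and b :: "gen \<Rightarrow> int \<Rightarrow> 'w \<Rightarrow> 'w" +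
  assumes h: "h * (h oo (- fps_X)) = 1"
    and V: "is_VAh h s a vac"

sublocale VAh_pair \<subseteq> V: Ah_module s a h
  by (rule VAh_Ah_module[OF h V])

context VAh_pair
begin

lemma intertwiner_linear: "intertwiner s a vac t b l w y \<Longrightarrow> Vector_Spaces.linear s t (\<lambda>v. y v n)"
  by (simp add: intertwiner_def)

text \<open>The intertwining equation fixes \<open>y (g(z) u)\<close> from \<open>y u\<close> up to
  a power of \<open>z + x\<close>, which \<open>iter_inj\<close> cancels; generation of V by
  \<open>vac\<close> does the rest.\<close>

lemma intertwiner_unique:
  assumes y: "intertwiner s a vac t b l w y" and y': "intertwiner s a vac t b l w y'"
  shows "y = y'"
proof -
  have "\<forall>n. y v n = y' v n" for v
    using V
  proof (induction v rule: VAh_induct)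
    case vac
    show ?case using y y' by (simp add: intertwiner_def)
  next
    case (add u v)
    then show ?case using intertwiner_linear[OF y] intertwiner_linear[OF y']
      by (simp add: Vector_Spaces.linear_iff)
  next
    case (scale r v)
    then show ?case using intertwiner_linear[OF y] intertwiner_linear[OF y']
      by (simp add: Vector_Spaces.linear_iff)
  next
    case (op g m v)
    obtain M where M: "\<And>j. j \<ge> M \<Longrightarrow> a g j v = 0" using V.b_trunc by blast
    have z: "y 0 n = 0" "y' 0 n = 0" for n
      using intertwiner_linear[OF y, of n] intertwiner_linear[OF y', of n]
      unfolding Vector_Spaces.linear_iff by (metis V.scale_zero_left W.scale_zero_left)+
    have "y (a g j v) n - y' (a g j v) n = 0" for j n
    proof (rule W.iter_inj[where K = "\<lambda>j n. y (a g j v) n - y' (a g j v) n" and M = M and p = "int (glev l g)"])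
      show "y (a g j v) N - y' (a g j v) N = 0" if "j \<ge> M" for j N
        using M[OF that] z by simp
      fix m q
      have "iter t (\<lambda>j n. y (a g j v) n) m (int (glev l g)) q = iter t (\<lambda>j n. y' (a g j v) n) m (int (glev l g)) q"
      proof -
        have "iter t (\<lambda>j n. y (a g j v) n) m (int (glev l g)) q
          = twist t (\<lambda>N j. b g N (y v j)) m (int (glev l g)) q"
          using y by (simp add: intertwiner_def)
        also have "(\<lambda>N j. b g N (y v j)) = (\<lambda>N j. b g N (y' v j))" using op by simp
        also have "twist t \<dots> m (int (glev l g)) q = iter t (\<lambda>j n. y' (a g j v) n) m (int (glev l g)) q"
          using y' by (simp add: intertwiner_def)
        finally show ?thesis .
      qed
      then show "iter t (\<lambda>j n. y (a g j v) n - y' (a g j v) n) m (int (glev l g)) q = 0"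
        by (subst W.iter_diff[of M _ M]) (auto simp: M z)
    qed
    then show ?case by simp
  qed
  then show ?thesis by (intro ext) auto
qed

lemma intertwiner_up:
  assumes y: "intertwiner s a vac t b l w y" and "l \<le> l'"
  shows "intertwiner s a vac t b l' w y"
  unfolding intertwiner_def
proof (intro conjI allI)
  fix g u m q
  obtain L where L: "\<And>n. n \<ge> L \<Longrightarrow> y u n = 0" using y unfolding intertwiner_def by blast
  obtain M where M: "\<And>j. j \<ge> M \<Longrightarrow> a g j u = 0" using V.b_trunc by blast
  have z: "y 0 n = 0" for n
    using intertwiner_linear[OF y, of n]
    unfolding Vector_Spaces.linear_iff by (metis V.scale_zero_left W.scale_zero_left)
  show "twist t (\<lambda>N j. b g N (y u j)) m (int (glev l' g)) q = iter t (\<lambda>j n. y (a g j u) n) m (int (glev l' g)) q"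
  proof (rule W.twist_iter_up[where p = "int (glev l g)" and L = L and M = M])
    show "int (glev l g) \<le> int (glev l' g)" using \<open>l \<le> l'\<close> by (simp add: glev_def)
    show "b g N (y u j) = 0" if "j \<ge> L" for N j by (simp add: L that)
    show "y (a g j u) N = 0" if "j \<ge> M" for j N by (simp add: M that z)
    show "twist t (\<lambda>N j. b g N (y u j)) m (int (glev l g)) q = iter t (\<lambda>j n. y (a g j u) n) m (int (glev l g)) q"
      for m q using y unfolding intertwiner_def by blast
  qed
qed (use y in \<open>simp_all add: intertwiner_def\<close>)

text \<open>With \<open>P = glev l g\<close>, the map is a composite: \<open>\<tau>\<close> goes
  from V to \<open>V[x^-1]\<close> with \<open>\<tau>(g(z) u) = (z + x)^(-P) g(z) \<tau>(u)\<close>,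
  and \<open>\<theta>\<close> comes from the shifted module, so
  \<open>\<theta>(g(z) u) = (z + x)^P g(z + x) \<theta>(u)\<close>. The two powers compensate, and
  multiplying by \<open>(z + x)^P\<close> makes the different expansions agree.\<close>

lemma intertwiner_exists:
  assumes w: "\<And>g n. n \<ge> int (glev l g) \<Longrightarrow> b g n w = 0"
  shows "\<exists>y. intertwiner s a vac t b l w y"
proof -
  interpret S: Ah_module t "\<lambda>u n. b u (n + int (glev l u))" h
    by (rule W.Ah_module_shift)
  interpret P: Ah_module "\<lambda>r. map_poly (s r)" "\<lambda>u n. map_poly (a u n)" h
    by (rule V.Ah_module_poly)
  define Yp where "Yp k = (\<lambda>p :: 'v poly. (pCons 0 ^^ k) p)" for k
  \<comment> \<open>The coefficients of \<open>(z + x)^(-P)\<close> in nonnegative powers of z; the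
    factor \<open>x^(-P - i)\<close> is multiplication by the polynomial variable to the power
    \<open>P + i\<close>.\<close>
  define \<kappa> where "\<kappa> g i p = map_poly (s (of_int (- int (glev l g)) gchoose i)) (Yp (glev l g + i) p)" for g i p
  have cs: "coeff (map_poly (s r) p) k = s r (coeff p k)" for r p k
    by (rule coeff_map_poly) simp
  have ca: "coeff (map_poly (a u n) p) k = a u n (coeff p k)" for u n p k
    by (rule coeff_map_poly) simp
  have cY: "coeff (Yp k p) n = (if n < k then 0 else coeff p (n - k))" for k p n
    by (simp add: Yp_def coeff_pCons0_pow)
  have c\<kappa>: "coeff (\<kappa> g i p) n = s (of_int (- int (glev l g)) gchoose i)
      (if n < glev l g + i then 0 else coeff p (n - (glev l g + i)))" for g i p n
    by (simp add: \<kappa>_def cs cY)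
  let ?B = "\<lambda>u n x. Sum_any (\<lambda>i. \<kappa> u i (map_poly (a u (n + int i)) x))"
  interpret B: Ah_module "\<lambda>r. map_poly (s r)" ?B h
  proof (rule P.Ah_module_mult)
    show "Vector_Spaces.linear (\<lambda>r. map_poly (s r)) (\<lambda>r. map_poly (s r)) (\<kappa> u i)" for u i
      by (auto simp: Vector_Spaces.linear_iff P.vector_space_axioms poly_eq_iff c\<kappa> cs
          V.scale_right_distrib mult.commute)
    show "\<kappa> u i (map_poly (a v n) x) = map_poly (a v n) (\<kappa> u i x)" for u i v n x
      by (auto simp: poly_eq_iff c\<kappa> ca V.b_scale)
    show "\<kappa> u i (\<kappa> v j x) = \<kappa> v j (\<kappa> u i x)" for u i v j x
      by (auto simp: poly_eq_iff c\<kappa> mult.commute intro: arg_cong[where f = "coeff x"])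
    show "\<kappa> Psi r x = (\<Sum>i\<le>r. \<kappa> E i (\<kappa> F (r - i) x))" for r x
    proof (rule poly_eqI)
      fix n
      have "coeff (\<Sum>i\<le>r. \<kappa> E i (\<kappa> F (r - i) x)) n
         = (\<Sum>i\<le>r. s ((of_int (- int l) gchoose i) * (of_int (- int l) gchoose (r - i)))
             (if n < 2 * l + r then 0 else coeff x (n - (2 * l + r))))"
        unfolding coeff_sum
        by (intro sum.cong) (auto simp: c\<kappa> glev_def intro!: arg_cong[where f = "coeff x"] arg_cong2[where f = s])
      also have "\<dots> = s (of_int (- int (2 * l)) gchoose r) (if n < 2 * l + r then 0 else coeff x (n - (2 * l + r)))"
        using gbinomial_Vandermonde[of "of_int (- int l) :: complex" "of_int (- int l)" r]
        by (simp add: atLeast0AtMost flip: V.scale_sum_left)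
      finally show "coeff (\<kappa> Psi r x) n = coeff (\<Sum>i\<le>r. \<kappa> E i (\<kappa> F (r - i) x)) n"
        by (simp add: c\<kappa> glev_def)
    qed
  qed
  have vacB: "?B u n [:vac:] = 0" if "n \<ge> 0" for u n
  proof -
    have "map_poly (a u (n + int i)) [:vac:] = 0" for i
      using VAh_vac[OF V] that by (auto simp: poly_eq_iff ca coeff_pCons split: nat.splits)
    moreover have "\<kappa> u i 0 = 0" for u i by (simp add: poly_eq_iff c\<kappa>)
    ultimately show ?thesis by simp
  qed
  obtain \<tau>' where \<tau>': "\<And>x y. \<tau>' (x + y) = (\<lambda>c. \<tau>' x c + \<tau>' y c)" "\<And>r x. \<tau>' (s r x) = (\<lambda>c. map_poly (s r) (\<tau>' x c))"
    "\<tau>' vac = const_series [:vac:]" "\<And>u n x. \<tau>' (a u n x) = transl (\<lambda>r. map_poly (s r)) ?B u n (\<tau>' x)"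
    by (rule VAh_universal[OF V B.Ah_module_axioms vacB]) auto
  \<comment> \<open>At y = 0 the translation disappears, leaving a map that intertwines the modes of
    V with the modified ones.\<close>
  define \<tau> where "\<tau> x = \<tau>' x 0" for x
  have \<tau>_add: "\<tau> (x + y) = \<tau> x + \<tau> y" and \<tau>_scale: "\<tau> (s r x) = map_poly (s r) (\<tau> x)" for x y r
    by (simp_all add: \<tau>_def \<tau>')
  have \<tau>_vac: "\<tau> vac = [:vac:]" by (simp add: \<tau>_def \<tau>' const_series_def)
  have \<tau>_op: "\<tau> (a u n x) = ?B u n (\<tau> x)" for u n x
  proof -
    have "map_poly (s 1) p = p" for p by (simp add: poly_eq_iff cs)
    then show ?thesis by (simp add: \<tau>_def \<tau>' transl_def)
  qed
  obtain \<theta> where \<theta>: "\<And>x y. \<theta> (x + y) = (\<lambda>c. \<theta> x c + \<theta> y c)" "\<And>r x. \<theta> (s r x) = (\<lambda>c. t r (\<theta> x c))"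
    "\<theta> vac = const_series w" "\<And>u n x. \<theta> (a u n x) = transl t (\<lambda>u n. b u (n + int (glev l u))) u n (\<theta> x)"
    by (rule VAh_universal[OF V S.Ah_module_axioms, of w]) (use w in auto)
  define th where "th x (i::int) = (if i < 0 then 0 else \<theta> x (nat i))" for x i
  have th_add: "th (x + y) i = th x i + th y i" and th_scale: "th (s r x) i = t r (th x i)" for x y r i
    by (simp_all add: th_def \<theta>)
  have th_0 [simp]: "th 0 i = 0" for i using th_scale[of 0 0 i] by simp
  have th_sum: "th (sum f A) i = (\<Sum>k\<in>A. th (f k) i)" for f :: "'c \<Rightarrow> 'v" and A i
    by (induction A rule: infinite_finite_induct) (auto simp: th_add)
  have th_op: "th (a u n x) i = (\<Sum>j<J. t (bdiff n j) (b u (n + int (glev l u) - int j) (th x (i - int j))))"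
    if "i < int J" for u n x i J
  proof (cases "i < 0")
    case False
    have "(\<Sum>j<J. t (bdiff n j) (b u (n + int (glev l u) - int j) (th x (i - int j))))
       = (\<Sum>j\<le>nat i. t (bdiff n j) (b u (n + int (glev l u) - int j) (th x (i - int j))))"
      by (rule sum.mono_neutral_right) (use that False in \<open>auto simp: th_def le_nat_iff\<close>)
    also have "\<dots> = (\<Sum>j\<le>nat i. t (bdiff n j) (b u (n - int j + int (glev l u)) (\<theta> x (nat i - j))))"
      using False by (intro sum.cong) (auto simp: th_def nat_diff_distrib algebra_simps)
    finally show ?thesis using False by (simp add: th_def \<theta>(4) transl_def)
  qed (simp add: th_def)
  \<comment> \<open>The coefficient of \<open>x^(-n-1)\<close>: a term \<open>x^(-k)\<close> of
    \<open>\<tau> v\<close> meets the term \<open>x^i\<close> of \<open>\<theta>\<close> with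
    \<open>i = k - n - 1\<close>, and \<open>th\<close> is zero at negative exponents.\<close>
  define y where "y v n = (\<Sum>k\<le>degree (\<tau> v). th (coeff (\<tau> v) k) (int k - n - 1))" for v n
  have y_sum: "y v n = (\<Sum>k<D. th (coeff (\<tau> v) k) (int k - n - 1))" if "degree (\<tau> v) < D" for v n D
    unfolding y_def by (rule sum.mono_neutral_left) (use that in \<open>auto simp: coeff_eq_0\<close>)
  have "intertwiner s a vac t b l w y"
    unfolding intertwiner_def
  proof (intro conjI allI)
    fix n
    have "y (u + v) n = y u n + y v n" for u v
    proof -
      define D where "D = Suc (max (degree (\<tau> u)) (degree (\<tau> v)))"
      have "degree (\<tau> (u + v)) < D" "degree (\<tau> u) < D" "degree (\<tau> v) < D"
        using degree_add_le_max[of "\<tau> u" "\<tau> v"] by (auto simp: D_def \<tau>_add)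
      then show ?thesis by (simp add: y_sum[of _ D] \<tau>_add th_add sum.distrib)
    qed
    moreover have "y (s r u) n = t r (y u n)" for r u
    proof -
      have "degree (\<tau> (s r u)) \<le> degree (\<tau> u)"
        by (rule degree_le) (auto simp: \<tau>_scale cs coeff_eq_0)
      then have "degree (\<tau> (s r u)) < Suc (degree (\<tau> u))" by simp
      then show ?thesis
        by (simp add: y_sum[of _ "Suc (degree (\<tau> u))"] \<tau>_scale cs th_scale W.scale_sum_right W.scale_right_distrib)
    qed
    ultimately show "Vector_Spaces.linear s t (\<lambda>v. y v n)"
      by (simp add: Vector_Spaces.linear_iff V.vector_space_axioms W.vector_space_axioms)
    show "y vac n = (if n = - 1 then w else 0)"
      by (auto simp: y_def \<tau>_vac th_def \<theta>(3) const_series_def)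
  next
    fix v
    have "y v n = 0" if "n \<ge> int (degree (\<tau> v))" for n
      unfolding y_def by (rule sum.neutral) (use that in \<open>auto simp: th_def\<close>)
    then show "\<exists>N. \<forall>n\<ge>N. y v n = 0" by blast
  next
    fix g u m q
    define P where "P = glev l g"
    obtain M where M: "\<And>j. j \<ge> M \<Longrightarrow> a g j u = 0" using V.b_trunc by blast
    obtain M' where M': "\<And>j k. j \<ge> M' \<Longrightarrow> map_poly (a g j) (\<tau> u) = 0" using P.b_trunc by blast
    have \<tau>_0: "\<tau> 0 = 0" using \<tau>_scale[of 0 0] by (simp add: poly_eq_iff cs)
    have yz: "y 0 n = 0" for n by (simp add: y_def \<tau>_0)
    text \<open>\<open>(z + y)^P \<tau>(g(z) u) = g(z) \<tau>(u)\<close>, in the variable \<open>1/y\<close>\<close>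
    have key: "(\<Sum>i\<le>P. s (of_nat (P choose i)) (coeff (\<tau> (a g (m + int i) u)) (k + P - i)))
        = a g m (coeff (\<tau> u) k)" for k m
    proof -
      define J where "J = nat (M' - m)"
      let ?c = "\<lambda>i. (of_int (- int P) gchoose i) :: complex"
      let ?d = "\<lambda>r. if r \<le> k then a g (m + int r) (coeff (\<tau> u) (k - r)) else 0"
      have \<tau>a: "coeff (\<tau> (a g (m + int i) u)) (k + P - i)
          = (\<Sum>j<J. s (?c j) (?d (i + j)))" if "i \<le> P" for i
      proof -
        have "?B g (m + int i) (\<tau> u) = (\<Sum>j<J. \<kappa> g j (map_poly (a g (m + int i + int j)) (\<tau> u)))"
        proof (rule Sum_any_lessThan)
          fix j assume "j \<ge> J"
          then have "map_poly (a g (m + int i + int j)) (\<tau> u) = 0" by (intro M') (simp add: J_def)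
          then show "\<kappa> g j (map_poly (a g (m + int i + int j)) (\<tau> u)) = 0" by (simp add: poly_eq_iff c\<kappa>)
        qed
        then have "coeff (\<tau> (a g (m + int i) u)) (k + P - i)
          = (\<Sum>j<J. coeff (\<kappa> g j (map_poly (a g (m + int i + int j)) (\<tau> u))) (k + P - i))"
          by (simp add: \<tau>_op coeff_sum)
        also have "\<dots> = (\<Sum>j<J. s (?c j) (?d (i + j)))"
          using that by (intro sum.cong) (auto simp: c\<kappa> ca P_def add.assoc intro!: arg_cong2[where f = s])
        finally show ?thesis .
      qed
      have d0: "?d r = 0" if "r \<ge> J" for r
      proof -
        have "coeff (map_poly (a g (m + int r)) (\<tau> u)) (k - r) = 0"
          using M'[of "m + int r"] that by (simp add: J_def)
        then show ?thesis by (simp add: ca)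
      qed
      have "(\<Sum>i\<le>P. s (of_nat (P choose i)) (coeff (\<tau> (a g (m + int i) u)) (k + P - i)))
        = (\<Sum>i\<le>P. \<Sum>j<J. s (of_nat (P choose i) * ?c j) (?d (i + j)))"
        by (intro sum.cong refl) (simp add: \<tau>a V.scale_sum_right)
      also have "\<dots> = (\<Sum>(i, j)\<in>{..P} \<times> {..<J}. s (of_nat (P choose i) * ?c j) (?d (i + j)))"
        by (rule sum.cartesian_product)
      also have "\<dots> = (\<Sum>(i, j)\<in>{(i, j). i + j < J}. s (of_nat (P choose i) * ?c j) (?d (i + j)))"
      proof (rule sum.mono_neutral_cong)
        show "finite {(i, j). i + j < J}" by (rule finite_subset[of _ "{..<J} \<times> {..<J}"]) auto
      qed (use d0 in \<open>auto simp: not_less binomial_eq_0 split del: if_split\<close>)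
      also have "\<dots> = (\<Sum>r<J. \<Sum>i\<le>r. s (of_nat (P choose i) * ?c (r - i)) (?d r))"
        by (subst sum.triangle_reindex) (auto intro!: sum.cong)
      also have "\<dots> = (\<Sum>r<J. s (of_int 0 gchoose r) (?d r))"
      proof (intro sum.cong refl)
        fix r
        have "(\<Sum>i\<le>r. of_nat (P choose i) * ?c (r - i)) = (of_int 0 gchoose r)"
          using gbinomial_Vandermonde[of "of_nat P :: complex" "of_int (- int P)" r]
          by (simp add: atLeast0AtMost binomial_gbinomial)
        then show "(\<Sum>i\<le>r. s (of_nat (P choose i) * ?c (r - i)) (?d r)) = s (of_int 0 gchoose r) (?d r)"
          by (simp flip: V.scale_sum_left)
      qed
      also have "\<dots> = ?d 0"
      proof (cases J)
        case 0
        then show ?thesis using d0[of 0] by simp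
      next
        case (Suc J')
        show ?thesis unfolding Suc by (subst sum.lessThan_Suc_shift) simp
      qed
      finally show ?thesis by simp
    qed
    define D where "D = Suc (Max (insert (degree (\<tau> u)) ((\<lambda>i. degree (\<tau> (a g (m + int i) u))) ` {..P})))"
    have D: "degree (\<tau> u) < D" "\<And>i. i \<le> P \<Longrightarrow> degree (\<tau> (a g (m + int i) u)) < D"
      by (auto simp: D_def less_Suc_eq_le simp del: Max_insert intro!: Max_ge)
    have "iter t (\<lambda>j n. y (a g j u) n) m (int P) q
       = (\<Sum>i<Suc P + nat (M - m). t (of_int (int P) gchoose i) (y (a g (m + int i) u) (int P + q - int i)))"
      by (rule W.iter_sum[of M]) (auto simp: M yz)
    also have "\<dots> = (\<Sum>i\<le>P. t (of_nat (P choose i)) (y (a g (m + int i) u) (int P + q - int i)))"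
      by (rule sum.mono_neutral_cong_right) (auto simp: binomial_eq_0 simp flip: binomial_gbinomial)
    also have "\<dots> = (\<Sum>i\<le>P. \<Sum>k<D. t (of_nat (P choose i))
        (th (coeff (\<tau> (a g (m + int i) u)) k) (int k + int i - int P - q - 1)))"
      by (intro sum.cong refl) (auto simp: y_sum[OF D(2)] W.scale_sum_right algebra_simps)
    also have "\<dots> = (\<Sum>i\<le>P. \<Sum>k<D + P. t (of_nat (P choose i))
        (th (coeff (\<tau> (a g (m + int i) u)) (k + P - i)) (int k - q - 1)))"
    proof (rule sum.cong[OF refl])
      fix i assume i: "i \<in> {..P}"
      let ?f = "\<lambda>k. t (of_nat (P choose i)) (th (coeff (\<tau> (a g (m + int i) u)) k) (int k + int i - int P - q - 1))"
      \<comment> \<open>Each \<open>\<kappa>\<close> carries at least \<open>x^(-P)\<close>, so the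
        summation over k can be moved up by \<open>P - i\<close> to line up with
        \<open>key\<close>.\<close>
      have low: "coeff (\<tau> (a g n u)) k = 0" if "k < P" for n k
      proof -
        define K where "K = nat (M' - n)"
        have "?B g n (\<tau> u) = (\<Sum>j<K. \<kappa> g j (map_poly (a g (n + int j)) (\<tau> u)))"
        proof (rule Sum_any_lessThan)
          fix j assume "j \<ge> K"
          then have "map_poly (a g (n + int j)) (\<tau> u) = 0" by (intro M') (simp add: K_def)
          then show "\<kappa> g j (map_poly (a g (n + int j)) (\<tau> u)) = 0" by (simp add: poly_eq_iff c\<kappa>)
        qed
        then show ?thesis using that by (simp add: \<tau>_op coeff_sum c\<kappa> P_def)
      qed
      have "sum ?f {..<D} = sum ?f {P - i..<D + P + (P - i)}"
        by (rule sum.mono_neutral_cong)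
          (use i D(2)[of i] low in \<open>auto simp: coeff_eq_0 not_less\<close>)
      also have "\<dots> = (\<Sum>k<D + P. ?f (k + (P - i)))"
        using sum.shift_bounds_nat_ivl[of ?f 0 "P - i" "D + P"] by (simp add: atLeast0LessThan)
      also have "\<dots> = (\<Sum>k<D + P. t (of_nat (P choose i))
          (th (coeff (\<tau> (a g (m + int i) u)) (k + P - i)) (int k - q - 1)))"
        using i by (intro sum.cong) (auto simp: of_nat_diff)
      finally show "sum ?f {..<D} = \<dots>" .
    qed
    also have "\<dots> = (\<Sum>k<D + P. th (a g m (coeff (\<tau> u) k)) (int k - q - 1))"
      by (subst sum.swap) (simp add: key[symmetric] th_sum th_scale)
    also have "\<dots> = (\<Sum>k<D + P. \<Sum>j<D + P + nat (- q). t (bdiff m j)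
        (b g (m + int P - int j) (th (coeff (\<tau> u) k) (int k - q - 1 - int j))))"
      unfolding P_def by (intro sum.cong refl th_op) auto
    also have "\<dots> = (\<Sum>j<D + P + nat (- q). t (bdiff m j) (b g (int P + m - int j) (y u (q + int j))))"
      by (subst sum.swap) (auto simp: y_sum[of u "D + P"] D(1) trans_less_add1 W.b_sum W.scale_sum_right algebra_simps intro!: sum.cong)
    also have "\<dots> = twist t (\<lambda>N j. b g N (y u j)) m (int P) q"
    proof (rule W.twist_sum[symmetric, of "int D"])
      show "b g N (y u j) = 0" if "j \<ge> int D" for N j
      proof -
        have "y u j = 0" unfolding y_def by (rule sum.neutral) (use that D(1) in \<open>auto simp: th_def\<close>)
        then show ?thesis by simp
      qed
    qed simp
    finally show "twist t (\<lambda>N j. b g N (y u j)) m (int (glev l g)) q = iter t (\<lambda>j n. y (a g j u) n) m (int (glev l g)) q"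
      by (simp add: P_def)
  qed
  then show ?thesis by blast
qed

end

section \<open>Powers of sums of variables, and the vertex operator map on a module\<close>

lemma zbin_add: "zbin s (\<lambda>n p. f n p + g n p) n p = zbin s f n p + zbin s g n p"
  by (induction s arbitrary: n p) (auto simp: algebra_simps)

lemma zbin_shift: "zbin s (\<lambda>n p. f (n + c) (p + d)) n p = zbin s f (n + c) (p + d)"
  by (induction s arbitrary: n p) (auto simp: algebra_simps)

lemma zbin_commute:
  "zbin s (\<lambda>n p. zbin k (\<lambda>n l. T n l p) n l) n p = zbin k (\<lambda>n l. zbin s (\<lambda>n p. T n l p) n p) n l"
proof (induction s arbitrary: n p l)
  case (Suc s)
  have "zbin k (\<lambda>n l. zbin (Suc s) (\<lambda>n p. T n l p) n p) n l
    = zbin k (\<lambda>n l. zbin s (\<lambda>n p. T n l p) n p) (n + 1) l + zbin k (\<lambda>n l. zbin s (\<lambda>n p. T n l p) n (p + 1)) n l"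
    using zbin_shift[of k "\<lambda>n l. zbin s (\<lambda>n p. T n l p) n p" 1 0] by (simp add: zbin_add)
  then show ?case by (simp add: Suc)
qed simp

lemma zbin_map:
  assumes "\<And>x y. \<phi> (x + y) = \<phi> x + \<phi> y"
  shows "\<phi> (zbin s f n p) = zbin s (\<lambda>n p. \<phi> (f n p)) n p"
  by (induction s arbitrary: n p) (auto simp: assms)

lemma zbin_eq_0:
  assumes "\<And>n' p'. n' \<ge> n \<Longrightarrow> p' \<ge> p \<Longrightarrow> f n' p' = 0"
  shows "zbin s f n p = 0"
  using assms by (induction s arbitrary: n p) auto

text \<open>Two pairs of variables with the same sum on \<open>T\<close> give the same powers of
  that sum.\<close>

lemma zbin_exchange:
  assumes "\<And>n m p q. T (n + 1) m p q + T n m (p + 1) q = T n (m + 1) p q + T n m p (q + 1)"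
  shows "zbin s (\<lambda>n p. T n m p q) n p = zbin s (\<lambda>m q. T n m p q) m q"
proof (induction s arbitrary: n m p q)
  case (Suc s)
  have "zbin (Suc s) (\<lambda>n p. T n m p q) n p = zbin s (\<lambda>n p. T (n + 1) m p q + T n m (p + 1) q) n p"
    using zbin_shift[of s "\<lambda>n p. T n m p q" 1 0 n p] zbin_shift[of s "\<lambda>n p. T n m p q" 0 1 n p]
    by (simp add: zbin_add)
  also have "\<dots> = zbin (Suc s) (\<lambda>m q. T n m p q) m q"
    by (simp add: assms zbin_add Suc)
  finally show ?case .
qed simp

context cspace
begin

lemma zbin_lincomb:
  "zbin s (\<lambda>n p. \<Sum>i\<in>A. t (c i) (f i n p)) n p = (\<Sum>i\<in>A. t (c i) (zbin s (f i) n p))"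
  by (induction s arbitrary: n p) (auto simp: sum.distrib scale_right_distrib)

lemma zbin_iter:
  assumes "\<And>j N. j \<ge> L \<Longrightarrow> K j N = 0"
  shows "zbin s K l q = iter t K l (int s) q"
proof -
  have "zbin s (\<lambda>l q. iter t K l 0 q) l q = iter t K l (0 + int s) q"
    by (rule zbin_rec) (simp add: iter_rec[of L K, OF assms])
  then show ?thesis by (simp add: iter_0[of L K, OF assms])
qed

lemma zbin_twist:
  assumes "\<And>N j. j \<ge> L \<Longrightarrow> G N j = 0"
  shows "zbin s (\<lambda>n l. twist t G n m l) n l = twist t G n (m + int s) l"
  by (rule zbin_rec) (simp add: twist_rec[of L G, OF assms])

lemma twist_eqI:
  assumes "\<And>N j. j \<ge> l \<Longrightarrow> G N j = G' N j"
  shows "twist t G n m l = twist t G' n m l"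
  by (simp add: twist_def assms)

end

text \<open>The level l is quantified inside the choice: intertwiners persist at higher levels,
  where they are unique, so the chosen one depends on w alone.\<close>

definition vop where
  "vop s a vac t b v n w = (SOME y. \<exists>l. intertwiner s a vac t b l w y) v n"

context VAh_pair
begin

abbreviation "Y \<equiv> vop s a vac t b"

lemma glev_ge: "l \<le> glev l g"
  by (simp add: glev_def)

lemma ex_level: "\<exists>l. \<forall>g n. n \<ge> int (glev l g) \<longrightarrow> b g n w = 0"
proof -
  have "\<forall>g. \<exists>N. \<forall>n\<ge>N. b g n w = 0" using W.b_trunc by blast
  then obtain N where N: "\<And>g n. n \<ge> N g \<Longrightarrow> b g n w = 0" by metis
  define l where "l = nat (max (N E) (max (N F) (N Psi)))"
  have "N g \<le> max (N E) (max (N F) (N Psi))" for g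
    by (cases g) auto
  moreover have "x \<le> int (nat x)" for x by simp
  ultimately have "N g \<le> int l" for g
    unfolding l_def by (rule order_trans)
  moreover have "int l \<le> int (glev l g)" for g
    using glev_ge[of l g] by simp
  ultimately have "N g \<le> int (glev l g)" for g
    by (rule order_trans)
  then have "b g n w = 0" if "n \<ge> int (glev l g)" for g n
    using N that order_trans by blast
  then show ?thesis by blast
qed

lemma Y_intertwiner:
  assumes "\<And>g n. n \<ge> int (glev l g) \<Longrightarrow> b g n w = 0"
  shows "intertwiner s a vac t b l w (\<lambda>v n. Y v n w)"
proof -
  obtain y where y: "intertwiner s a vac t b l w y"
    using intertwiner_exists[of l w] assms by auto
  define y' where "y' = (SOME y. \<exists>l. intertwiner s a vac t b l w y)"
  have "\<exists>l. intertwiner s a vac t b l w y'"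
    unfolding y'_def by (rule someI[of "\<lambda>y. \<exists>l. intertwiner s a vac t b l w y" y]) (use y in blast)
  then obtain l' where l': "intertwiner s a vac t b l' w y'" ..
  have "y = y'"
    by (rule intertwiner_unique[OF intertwiner_up[OF y] intertwiner_up[OF l'], of "max l l'"]) auto
  moreover have "(\<lambda>v n. Y v n w) = y'" by (simp add: vop_def y'_def)
  ultimately show ?thesis using y by simp
qed

lemma Y_linear1: "Vector_Spaces.linear s t (\<lambda>v. Y v n w)"
  using ex_level[of w] Y_intertwiner intertwiner_linear by blast

lemma Y_add1: "Y (u + v) n w = Y u n w + Y v n w" and Y_scale1: "Y (s r u) n w = t r (Y u n w)"
  using Y_linear1[of n w] by (simp_all add: Vector_Spaces.linear_iff)

lemma Y_01 [simp]: "Y 0 n w = 0"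
  using Y_scale1[of 0 0 n w] by simp

lemma Y_sum1: "Y (sum f A) n w = (\<Sum>k\<in>A. Y (f k) n w)"
  by (induction A rule: infinite_finite_induct) (auto simp: Y_add1)

lemma Y_vac: "Y vac n w = (if n = -1 then w else 0)"
  using ex_level[of w] Y_intertwiner unfolding intertwiner_def by blast

lemma Y_trunc: "\<exists>N. \<forall>n\<ge>N. Y v n w = 0"
  using ex_level[of w] Y_intertwiner unfolding intertwiner_def by blast

lemma Y_assoc_gen0:
  assumes "\<And>g n. n \<ge> int (glev l g) \<Longrightarrow> b g n w = 0"
  shows "twist t (\<lambda>N j. b g N (Y u j w)) m (int (glev l g)) q = iter t (\<lambda>j n. Y (a g j u) n w) m (int (glev l g)) q"
  using Y_intertwiner[OF assms] unfolding intertwiner_def by blast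

text \<open>The intertwiner is constructed for each w separately, so linearity in w is not built in.
  A linear combination of intertwiners at a common level is an intertwiner for the combined vector,
  and uniqueness identifies it.\<close>

lemma Y_linear2: "Vector_Spaces.linear t t (Y v n)"
proof -
  have "intertwiner s a vac t b l (t r w + w') (\<lambda>v n. t r (Y v n w) + Y v n w')"
    if l: "\<And>g n. n \<ge> int (glev l g) \<Longrightarrow> b g n w = 0" "\<And>g n. n \<ge> int (glev l g) \<Longrightarrow> b g n w' = 0" for l r w w'
    unfolding intertwiner_def
  proof (intro conjI allI)
    fix n
    show "Vector_Spaces.linear s t (\<lambda>v. t r (Y v n w) + Y v n w')"
      by (simp add: Vector_Spaces.linear_iff V.vector_space_axioms W.vector_space_axioms Y_add1 Y_scale1
          W.scale_right_distrib mult.commute)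
    show "t r (Y vac n w) + Y vac n w' = (if n = - 1 then t r w + w' else 0)"
      by (simp add: Y_vac)
  next
    fix v
    obtain N N' where "\<And>n. n \<ge> N \<Longrightarrow> Y v n w = 0" "\<And>n. n \<ge> N' \<Longrightarrow> Y v n w' = 0" using Y_trunc by metis
    then have "\<forall>n\<ge>max N N'. t r (Y v n w) + Y v n w' = 0" by auto
    then show "\<exists>N. \<forall>n\<ge>N. t r (Y v n w) + Y v n w' = 0" ..
  next
    fix g u m q
    let ?P = "int (glev l g)"
    obtain N N' where N: "\<And>n. n \<ge> N \<Longrightarrow> Y u n w = 0" "\<And>n. n \<ge> N' \<Longrightarrow> Y u n w' = 0" using Y_trunc by metis
    obtain M where M: "\<And>j. j \<ge> M \<Longrightarrow> a g j u = 0" using V.b_trunc by blast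
    define J where "J = nat (max N N' - q)"
    have J: "max N N' \<le> q + int J" unfolding J_def by linarith
    define I where "I = nat (M - m)"
    have I: "M \<le> m + int I" unfolding I_def by linarith
    have tw: "twist t (\<lambda>N j. b g N (f j)) m ?P q = (\<Sum>i<J. t (bdiff m i) (b g (?P + m - int i) (f (q + int i))))"
      if "\<And>j. j \<ge> max N N' \<Longrightarrow> f j = 0" for f
      by (rule W.twist_sum[OF _ J]) (simp add: that)
    have it: "iter t (\<lambda>j n. f (a g j u) n) m ?P q = (\<Sum>i<I. t (of_int ?P gchoose i) (f (a g (m + int i) u) (?P + q - int i)))"
      if "\<And>n. f 0 n = 0" for f
      by (rule W.iter_sum[OF _ I]) (simp add: M that)
    have "twist t (\<lambda>N j. b g N (t r (Y u j w) + Y u j w')) m ?P q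
       = t r (twist t (\<lambda>N j. b g N (Y u j w)) m ?P q) + twist t (\<lambda>N j. b g N (Y u j w')) m ?P q"
      by (subst (1 2 3) tw) (auto simp: N W.b_add W.b_scale W.scale_right_distrib sum.distrib W.scale_sum_right mult.commute)
    also have "\<dots> = t r (iter t (\<lambda>j n. Y (a g j u) n w) m ?P q) + iter t (\<lambda>j n. Y (a g j u) n w') m ?P q"
      by (simp only: Y_assoc_gen0[OF l(1)] Y_assoc_gen0[OF l(2)])
    also have "\<dots> = iter t (\<lambda>j n. t r (Y (a g j u) n w) + Y (a g j u) n w') m ?P q"
      by (simp add: it[of "\<lambda>v n. t r (Y v n w) + Y v n w'"] it[of "\<lambda>v n. Y v n w"] it[of "\<lambda>v n. Y v n w'"]
          W.scale_right_distrib sum.distrib W.scale_sum_right mult.commute)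
    finally show "twist t (\<lambda>N j. b g N (t r (Y u j w) + Y u j w')) m ?P q
       = iter t (\<lambda>j n. t r (Y (a g j u) n w) + Y (a g j u) n w') m ?P q" .
  qed
  note lin = this
  have comb: "Y v n (t r w + w') = t r (Y v n w) + Y v n w'" for r w w'
  proof -
    obtain l1 where l1: "\<And>g n. n \<ge> int (glev l1 g) \<Longrightarrow> b g n w = 0" using ex_level by blast
    obtain l2 where l2: "\<And>g n. n \<ge> int (glev l2 g) \<Longrightarrow> b g n w' = 0" using ex_level by blast
    have mono: "glev l1 g \<le> glev (max l1 l2) g" "glev l2 g \<le> glev (max l1 l2) g" for g
      by (auto simp: glev_def)
    have z: "b g n w = 0" "b g n w' = 0" if "n \<ge> int (glev (max l1 l2) g)" for g n
      using l1[of g n] l2[of g n] mono[of g] that by linarith+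
    have "intertwiner s a vac t b (max l1 l2) (t r w + w') (\<lambda>v n. Y v n (t r w + w'))"
      by (rule Y_intertwiner) (simp add: W.b_add W.b_scale z)
    from intertwiner_unique[OF this lin[OF z]] show ?thesis by (auto dest!: fun_cong)
  qed
  have "Y v n 0 = 0" using comb[of "-1" 0 0] by simp
  then show ?thesis
    using comb[of 1] comb[of _ _ 0]
    by (simp add: Vector_Spaces.linear_iff W.vector_space_axioms)
qed

lemma Y_add2: "Y u n (x + y) = Y u n x + Y u n y" and Y_scale2: "Y u n (t r x) = t r (Y u n x)"
  using Y_linear2[of u n] by (simp_all add: Vector_Spaces.linear_iff)

lemma Y_02 [simp]: "Y u n 0 = 0"
  using Y_scale2[of u n 0 0] by simp

lemma Y_field_map: "field_map s t Y"
  unfolding field_map_def using Y_linear1 Y_linear2 Y_trunc by blast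

lemma Y_assoc_gen:
  assumes l: "\<And>g n. n \<ge> int (glev l g) \<Longrightarrow> b g n w = 0" and r: "r \<ge> glev l g"
  shows "twist t (\<lambda>N j. b g N (Y u j w)) m (int r) q = zbin r (\<lambda>j n. Y (a g j u) n w) m q"
proof -
  obtain L where L: "\<And>n. n \<ge> L \<Longrightarrow> Y u n w = 0" using Y_trunc by blast
  obtain M where M: "\<And>j. j \<ge> M \<Longrightarrow> a g j u = 0" using V.b_trunc by blast
  have "twist t (\<lambda>N j. b g N (Y u j w)) m (int r) q = iter t (\<lambda>j n. Y (a g j u) n w) m (int r) q"
    by (rule W.twist_iter_up[where p = "int (glev l g)" and L = L and M = M])
      (use Y_assoc_gen0[OF l] r in \<open>auto simp: L M\<close>)
  then show ?thesis by (simp add: W.zbin_iter[where L = M] M)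
qed

text \<open>Associativity with \<open>u = vac\<close>, read at \<open>m = -1\<close>: nonnegative
  modes kill \<open>vac\<close>, leaving one term in the iterate, and \<open>Y(vac, x) = 1\<close>
  selects one term of the product.\<close>

lemma Y_gen: "Y (a g (-1) vac) n w = b g n w"
proof -
  obtain l where l: "\<And>g n. n \<ge> int (glev l g) \<Longrightarrow> b g n w = 0" using ex_level by blast
  define P where "P = int (glev l g)"
  define q where "q = n - P"
  have v0: "a g j vac = 0" if "j \<ge> 0" for j using VAh_vac[OF V that] .
  have "iter t (\<lambda>j n. Y (a g j vac) n w) (-1) P q = Y (a g (-1) vac) n w"
    by (subst W.iter_sum[where L = 0 and M = 1]) (auto simp: v0 q_def)
  moreover have "twist t (\<lambda>N j. b g N (Y vac j w)) (-1) P q = b g n w"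
  proof -
    have "twist t (\<lambda>N j. b g N (Y vac j w)) (-1) P q
      = (\<Sum>i<nat (- q). t (bdiff (-1) i) (b g (P + - 1 - int i) (Y vac (q + int i) w)))"
      by (rule W.twist_sum[where L = 0]) (auto simp: Y_vac)
    also have "\<dots> = b g n w"
    proof (cases "q \<ge> 0")
      \<comment> \<open>Here \<open>n\<close> is at least the level of w, so the right-hand side
        vanishes together with the empty sum.\<close>
      case True
      then show ?thesis using l[of g n] by (simp add: q_def P_def)
    next
      case False
      define i0 where "i0 = nat (- q - 1)"
      have i0: "nat (- q) = Suc i0" "q + int i0 = - 1" using False by (auto simp: i0_def)
      have "bdiff (-1) i0 = 1"
        using gbinomial_minus[of "1::complex" i0] by (simp add: bdiff_def flip: binomial_gbinomial power_mult_distrib)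
      moreover have "(\<Sum>i<i0. t (bdiff (-1) i) (b g (P + - 1 - int i) (Y vac (q + int i) w))) = 0"
        by (rule sum.neutral) (use i0 in \<open>auto simp: Y_vac\<close>)
      moreover have "P + - 1 - int i0 = n" using i0 by (simp add: q_def)
      ultimately show ?thesis
        unfolding i0(1) by (simp add: Y_vac i0(2))
    qed
    finally show ?thesis .
  qed
  moreover have "twist t (\<lambda>N j. b g N (Y vac j w)) (-1) P q = iter t (\<lambda>j n. Y (a g j vac) n w) (-1) P q"
    unfolding P_def by (rule Y_assoc_gen0) (rule l)
  ultimately show ?thesis by simp
qed

end

section \<open>Weak associativity\<close>

context VAh_pair
begin

lemma V_pair: "VAh_pair h s a vac s a"
  by unfold_locales (rule h, rule V)

abbreviation "YV \<equiv> vop s a vac s a"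

lemmas YV_add1 = VAh_pair.Y_add1[OF V_pair] and YV_scale1 = VAh_pair.Y_scale1[OF V_pair]
  and YV_01 [simp] = VAh_pair.Y_01[OF V_pair] 
  and YV_02 [simp] = VAh_pair.Y_02[OF V_pair]
  and YV_vac = VAh_pair.Y_vac[OF V_pair] and YV_trunc = VAh_pair.Y_trunc[OF V_pair]
  and YV_assoc_gen = VAh_pair.Y_assoc_gen[OF V_pair] and V_ex_level = VAh_pair.ex_level[OF V_pair]
  and YV_gen = VAh_pair.Y_gen[OF V_pair]

text \<open>The first and third Jacobi terms as functionals \<open>x0^l x1^p x2^q\<close>. Weak
  associativity becomes their equality for all large \<open>p\<close>.\<close>

definition "prodc u v w l p q = twist t (\<lambda>N j. Y u N (Y v j w)) l p q"
definition "iterc u v w l p q = iter t (\<lambda>j n. Y (YV u j v) n w) l p q"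

lemma prodc_sum:
  assumes "\<And>j. j \<ge> L \<Longrightarrow> Y v j w = 0" "L \<le> q + int K"
  shows "prodc u v w l p q = (\<Sum>i<K. t (bdiff l i) (Y u (p + l - int i) (Y v (q + int i) w)))"
  unfolding prodc_def by (rule W.twist_sum[of L]) (use assms in auto)

lemma iterc_sum:
  assumes "\<And>j. j \<ge> L \<Longrightarrow> YV u j v = 0" "L \<le> l + int K"
  shows "iterc u v w l p q = (\<Sum>i<K. t (of_int p gchoose i) (Y (YV u (l + int i) v) (p + q - int i) w))"
  unfolding iterc_def by (rule W.iter_sum[of L]) (use assms in auto)

lemma prodc_eq_0: "(\<And>j. j \<ge> L \<Longrightarrow> Y v j w = 0) \<Longrightarrow> q \<ge> L \<Longrightarrow> prodc u v w l p q = 0"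
  unfolding prodc_def by (rule W.twist_eq_0[of L]) auto

lemma iterc_eq_0: "(\<And>j. j \<ge> L \<Longrightarrow> YV u j v = 0) \<Longrightarrow> l \<ge> L \<Longrightarrow> iterc u v w l p q = 0"
  unfolding iterc_def by (rule W.iter_eq_0[of L]) auto

lemma prodc_rec: "prodc u v w (l + 1) p q = prodc u v w l (p + 1) q - prodc u v w l p (q + 1)"
proof -
  obtain L where "\<And>j. j \<ge> L \<Longrightarrow> Y v j w = 0" using Y_trunc by blast
  then show ?thesis unfolding prodc_def by (intro W.twist_rec[of L]) auto
qed

lemma iterc_rec: "iterc u v w (l + 1) p q = iterc u v w l (p + 1) q - iterc u v w l p (q + 1)"
proof -
  obtain L where "\<And>j. j \<ge> L \<Longrightarrow> YV u j v = 0" using YV_trunc by blast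
  then show ?thesis unfolding iterc_def by (intro W.iter_rec[of L]) auto
qed

lemma prodc_add: "prodc (u + u') v w l p q = prodc u v w l p q + prodc u' v w l p q"
  and prodc_scale: "prodc (s r u) v w l p q = t r (prodc u v w l p q)"
proof -
  obtain L where L: "\<And>j. j \<ge> L \<Longrightarrow> Y v j w = 0" using Y_trunc by blast
  have "L \<le> q + int (nat (L - q))" by linarith
  note e = prodc_sum[OF L this]
  show "prodc (u + u') v w l p q = prodc u v w l p q + prodc u' v w l p q"
    by (simp add: e Y_add1 W.scale_right_distrib sum.distrib)
  show "prodc (s r u) v w l p q = t r (prodc u v w l p q)"
    by (simp add: e Y_scale1 W.scale_sum_right mult.commute)
qed

lemma iterc_add: "iterc (u + u') v w l p q = iterc u v w l p q + iterc u' v w l p q"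
proof -
  obtain L where L: "\<And>j. j \<ge> L \<Longrightarrow> YV u j v = 0" using YV_trunc by blast
  obtain L' where L': "\<And>j. j \<ge> L' \<Longrightarrow> YV u' j v = 0" using YV_trunc by blast
  define K where "K = nat (max L L' - l)"
  have K: "max L L' \<le> l + int K" unfolding K_def by linarith
  have z: "YV u j v = 0" "YV u' j v = 0" "YV (u + u') j v = 0" if "j \<ge> max L L'" for j
    using L L' that by (auto simp: YV_add1)
  have e: "iterc x v w l p q = (\<Sum>i<K. t (of_int p gchoose i) (Y (YV x (l + int i) v) (p + q - int i) w))"
    if "x \<in> {u, u', u + u'}" for x
    by (rule iterc_sum[OF _ K]) (use z that in auto)
  show ?thesis
    by (simp add: e YV_add1 Y_add1 W.scale_right_distrib sum.distrib)
qed

lemma iterc_scale: "iterc (s r u) v w l p q = t r (iterc u v w l p q)"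
proof -
  obtain L where L: "\<And>j. j \<ge> L \<Longrightarrow> YV u j v = 0" using YV_trunc by blast
  have K: "L \<le> l + int (nat (L - l))" by linarith
  have z: "YV (s r u) j v = 0" if "j \<ge> L" for j using L that by (simp add: YV_scale1)
  show ?thesis
    by (simp add: iterc_sum[OF z K] iterc_sum[OF L K] YV_scale1 Y_scale1 W.scale_sum_right mult.commute)
qed

lemma YV_trunc_op: "\<exists>J. \<forall>k\<ge>m. \<forall>j\<ge>J. YV (a g k u) j v = 0"
proof -
  obtain M where M: "\<And>k. k \<ge> M \<Longrightarrow> a g k u = 0" using V.b_trunc by blast
  have "\<exists>J. \<forall>k\<in>{m..M}. \<forall>j\<ge>J. YV (a g k u) j v = 0"
    by (rule ex_uniform_bound) (auto intro: YV_trunc)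
  then obtain J where "\<forall>k\<in>{m..M}. \<forall>j\<ge>J. YV (a g k u) j v = 0" ..
  then have "\<forall>k\<ge>m. \<forall>j\<ge>J. YV (a g k u) j v = 0"
    using M by (metis atLeastAtMost_iff YV_01 linear)
  then show ?thesis ..
qed

text \<open>The field g(z + x1) acting from outside; \<open>n\<close> and \<open>m\<close> are the
  exponents of z and of z + x1.\<close>

definition "act_shift g \<Theta> n m l p q = twist t (\<lambda>N j. b g N (\<Theta> l j q)) n m p"

text \<open>Associativity of g and u on the vectors \<open>v_j w\<close>. The required power of z +
  x1 depends on j; only finitely many j matter once the exponent of \<open>x2\<close> is bounded
  below by \<open>q0\<close>, and this is the only uniformity available.\<close>

lemma zbin_prodc:
  "\<exists>S. \<forall>r\<ge>S. \<forall>n l p q. q \<ge> q0 \<longrightarrow>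
    zbin r (\<lambda>n p. prodc (a g n u) v w l p q) n p = act_shift g (prodc u v w) n (int r) l p q"
proof -
  obtain L where L: "\<And>j. j \<ge> L \<Longrightarrow> Y v j w = 0" using Y_trunc by blast
  have "\<exists>B::int. \<forall>j\<in>{q0..L}. \<forall>n\<ge>B. \<forall>g k. k \<ge> int (glev (nat n) g) \<longrightarrow> b g k (Y v j w) = 0"
  proof (rule ex_uniform_bound)
    fix j
    obtain l where l: "\<And>g n. n \<ge> int (glev l g) \<Longrightarrow> b g n (Y v j w) = 0" using ex_level by blast
    have "\<forall>n\<ge>int l. \<forall>g k. k \<ge> int (glev (nat n) g) \<longrightarrow> b g k (Y v j w) = 0"
    proof (intro allI impI)
      fix n g k assume "int l \<le> n" "int (glev (nat n) g) \<le> k"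
      then have "int (glev l g) \<le> k" unfolding glev_def by (auto split: if_splits)
      then show "b g k (Y v j w) = 0" by (rule l)
    qed
    then show "\<exists>B. \<forall>n\<ge>B. \<forall>g k. k \<ge> int (glev (nat n) g) \<longrightarrow> b g k (Y v j w) = 0" ..
  qed simp
  then obtain B where B: "\<And>j g k. j \<in> {q0..L} \<Longrightarrow> k \<ge> int (glev (nat B) g) \<Longrightarrow> b g k (Y v j w) = 0"
    by blast
  have lev: "b g k (Y v j w) = 0" if "j \<ge> q0" "k \<ge> int (glev (nat B) g)" for j g k
    using B[of j g k] L[of j] that by (cases "j \<le> L") auto
  have "zbin r (\<lambda>n p. prodc (a g n u) v w l p q) n p = act_shift g (prodc u v w) n (int r) l p q"
    if r: "r \<ge> glev (nat B) g" and q: "q \<ge> q0" for r n l p q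
  proof -
    define J where "J = nat (L - q)"
    have J: "L \<le> q + int J" unfolding J_def by linarith
    have ps: "prodc x v w l p q = (\<Sum>i<J. t (bdiff l i) (Y x (p + l - int i) (Y v (q + int i) w)))" for x p
      by (rule prodc_sum[OF L J])
    have "\<exists>I. \<forall>j\<in>{..<J}. \<forall>n\<ge>I. Y u n (Y v (q + int j) w) = 0"
      by (rule ex_uniform_bound) (auto intro: Y_trunc)
    then obtain I0 where I0: "\<And>j n. j < J \<Longrightarrow> n \<ge> I0 \<Longrightarrow> Y u n (Y v (q + int j) w) = 0" by auto
    define I where "I = nat (I0 - p - l + int J)"
    have zp: "prodc u v w l p' q = 0" if "p' \<ge> p + int I" for p'
      unfolding ps
    proof (intro sum.neutral ballI)
      fix j assume "j \<in> {..<J}"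
      moreover have "I0 - p - l + int J \<le> int I" unfolding I_def by linarith
      ultimately have "j < J" "p' + l - int j \<ge> I0" using that by auto
      then show "t (bdiff l j) (Y u (p' + l - int j) (Y v (q + int j) w)) = 0" by (simp add: I0)
    qed
    have "zbin r (\<lambda>n p. prodc (a g n u) v w l p q) n p
      = zbin r (\<lambda>n p. \<Sum>j<J. t (bdiff l j) (Y (a g n u) (p + l - int j) (Y v (q + int j) w))) n p"
      by (simp add: ps)
    also have "\<dots> = (\<Sum>j<J. t (bdiff l j) (zbin r (\<lambda>n p. Y (a g n u) (p + l - int j) (Y v (q + int j) w)) n p))"
      by (rule W.zbin_lincomb)
    also have "\<dots> = (\<Sum>j<J. t (bdiff l j) (\<Sum>i<I. t (bdiff n i)
        (b g (int r + n - int i) (Y u (p + int i + l - int j) (Y v (q + int j) w)))))"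
    proof (intro sum.cong refl arg_cong2[where f = t])
      fix j assume j: "j \<in> {..<J}"
      have "zbin r (\<lambda>n p. Y (a g n u) (p + l - int j) (Y v (q + int j) w)) n p
        = zbin r (\<lambda>n p. Y (a g n u) p (Y v (q + int j) w)) n (p + l - int j)"
        using zbin_shift[of r "\<lambda>n p. Y (a g n u) p (Y v (q + int j) w)" 0 "l - int j" n p]
        by (simp add: algebra_simps)
      also have "\<dots> = twist t (\<lambda>N k. b g N (Y u k (Y v (q + int j) w))) n (int r) (p + l - int j)"
        by (rule Y_assoc_gen[symmetric, OF lev r]) (use q in auto)
      also have "\<dots> = (\<Sum>i<I. t (bdiff n i)
        (b g (int r + n - int i) (Y u (p + l - int j + int i) (Y v (q + int j) w))))"
      proof (rule W.twist_sum[of I0])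
        have "I0 - p - l + int J \<le> int I" unfolding I_def by linarith
        then show "I0 \<le> p + l - int j + int I" using j by auto
      qed (use j in \<open>auto simp: I0\<close>)
      finally show "zbin r (\<lambda>n p. Y (a g n u) (p + l - int j) (Y v (q + int j) w)) n p
        = (\<Sum>i<I. t (bdiff n i) (b g (int r + n - int i) (Y u (p + int i + l - int j) (Y v (q + int j) w))))"
        by (simp add: algebra_simps)
    qed
    also have "\<dots> = (\<Sum>i<I. t (bdiff n i) (b g (int r + n - int i) (prodc u v w l (p + int i) q)))"
      unfolding ps W.b_sum W.b_scale W.scale_sum_right
      by (subst sum.swap) (simp add: mult.commute)
    also have "\<dots> = act_shift g (prodc u v w) n (int r) l p q"
      unfolding act_shift_def by (rule W.twist_sum[symmetric, of "p + int I"]) (auto simp: zp)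
    finally show ?thesis .
  qed
  then show ?thesis by blast
qed

lemma iterc_bounded2: "bounded2 (\<lambda>l q. iterc u v w l p q)"
proof -
  obtain L where L: "\<And>j. j \<ge> L \<Longrightarrow> YV u j v = 0" using YV_trunc by blast
  show ?thesis
  proof (rule bounded2I)
    show "iterc u v w l p q = 0" if "l \<ge> L" for l q by (rule iterc_eq_0[OF L that])
    fix m
    have "\<exists>J. \<forall>j\<in>{m..L}. \<forall>n\<ge>J. Y (YV u j v) n w = 0"
      by (rule ex_uniform_bound) (auto intro: Y_trunc)
    then obtain J where J: "\<And>j n. j \<in> {m..L} \<Longrightarrow> n \<ge> J \<Longrightarrow> Y (YV u j v) n w = 0" by blast
    have "iterc u v w k p n = 0" if k: "k \<ge> m" and n: "n \<ge> J - p + \<bar>L - m\<bar>" for k n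
    proof -
      define K where "K = nat (L - k)"
      have "iterc u v w k p n = (\<Sum>i<K. t (of_int p gchoose i) (Y (YV u (k + int i) v) (p + n - int i) w))"
        by (rule iterc_sum[OF L], assumption, unfold K_def, linarith)
      also have "\<dots> = 0"
        using k n by (intro sum.neutral ballI) (auto simp: J K_def)
      finally show ?thesis .
    qed
    then show "\<exists>J. \<forall>k\<ge>m. \<forall>n\<ge>J. iterc u v w k p n = 0" by blast
  qed
qed

end

section \<open>Associativity of a generator inside an iterate\<close>

lemma zbin_cong:
  assumes "\<And>n' p'. n' \<ge> n \<Longrightarrow> p' \<ge> p \<Longrightarrow> f n' p' = g n' p'"
  shows "zbin s f n p = zbin s g n p"
  using assms by (induction s arbitrary: n p) auto

text \<open>Subtracting two variables one after the other is subtracting their sum; used to merge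
  \<open>x0\<close> and \<open>x2\<close> into \<open>x1\<close>.\<close>

lemma bdiff_trinomial:
  assumes "i \<le> r"
  shows "bdiff n i * bdiff (n - int i) (r - i) = bdiff n r * of_nat (r choose i)"
proof -
  have tri: "(of_int n gchoose r) * (of_nat r gchoose i) = (of_int n gchoose i) * ((of_int n - of_nat i :: complex) gchoose (r - i))"
    by (rule gbinomial_trinomial_revision[OF assms])
  have sgn: "(- 1) ^ i * (- 1) ^ (r - i) = ((- 1) ^ r :: complex)"
    using assms by (simp flip: power_add)
  have "bdiff n i * bdiff (n - int i) (r - i)
    = ((of_int n gchoose i) * ((of_int n - of_nat i :: complex) gchoose (r - i))) * ((- 1) ^ i * (- 1) ^ (r - i))"
    by (simp add: bdiff_def)
  also have "\<dots> = bdiff n r * of_nat (r choose i)"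
    unfolding sgn tri[symmetric] by (simp add: bdiff_def binomial_gbinomial)
  finally show ?thesis .
qed

context VAh_pair
begin

definition "iterg g u v w N l p q = iter t (\<lambda>j n. Y (a g N (YV u j v)) n w) l p q"

lemma iterg_sum:
  assumes "\<And>j. j \<ge> M \<Longrightarrow> YV u j v = 0" "M \<le> l + int J"
  shows "iterg g u v w N l p q
    = (\<Sum>j<J. t (of_int p gchoose j) (Y (a g N (YV u (l + int j) v)) (p + q - int j) w))"
  unfolding iterg_def by (rule W.iter_sum[of M]) (use assms in auto)

lemma iterg_eq_0: "(\<And>j. j \<ge> M \<Longrightarrow> YV u j v = 0) \<Longrightarrow> l \<ge> M \<Longrightarrow> iterg g u v w N l p q = 0"
  unfolding iterg_def by (rule W.iter_eq_0[of M]) auto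

lemma iterg_rec: "iterg g u v w N (l + 1) p q = iterg g u v w N l (p + 1) q - iterg g u v w N l p (q + 1)"
proof -
  obtain M where "\<And>j. j \<ge> M \<Longrightarrow> YV u j v = 0" using YV_trunc by blast
  then show ?thesis unfolding iterg_def by (intro W.iter_rec[of M]) auto
qed

text \<open>The position of g is measured from u by z (exponent \<open>n\<close>) and from v by z +
  x0 (exponent \<open>m\<close>); \<open>l\<close>, \<open>p\<close>, \<open>q\<close> belong to
  \<open>x0\<close>, \<open>x1\<close>, \<open>x2\<close>.\<close>

definition "assocg g u v w n m l p q = twist t (\<lambda>N l. iterg g u v w N l p q) n m l"

lemma assocg_sum:
  assumes "\<And>j. j \<ge> M \<Longrightarrow> YV u j v = 0" "M \<le> l + int I"
  shows "assocg g u v w n m l p q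
    = (\<Sum>i<I. t (bdiff n i) (iterg g u v w (m + n - int i) (l + int i) p q))"
  unfolding assocg_def
proof (rule W.twist_sum[of M])
  show "iterg g u v w N j p q = 0" if "j \<ge> M" for N j by (rule iterg_eq_0[OF assms(1) that])
qed (rule assms)

text \<open>Associativity of g and u on the vector v of V: after multiplication by
  \<open>(z + x0)^k\<close> the field g moves from u to the whole of
  \<open>Y(u, x0) v\<close>.\<close>

lemma zbin_iterc_assocg:
  assumes lev: "\<And>g n. n \<ge> int (glev lv g) \<Longrightarrow> a g n v = 0" and k: "k \<ge> glev lv g"
  shows "zbin k (\<lambda>n l. iterc (a g n u) v w l p q) n l = assocg g u v w n (int k) l p q"
proof -
  obtain M where M: "\<And>j. j \<ge> M \<Longrightarrow> YV u j v = 0" using YV_trunc by blast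
  obtain J0 where J0: "\<And>n' j. n' \<ge> n \<Longrightarrow> j \<ge> J0 \<Longrightarrow> YV (a g n' u) j v = 0"
    using YV_trunc_op by blast
  define J where "J = nat (max J0 M - l)"
  have J: "J0 \<le> l + int J" "M \<le> l + int J" unfolding J_def by linarith+
  have J': "J0 \<le> l' + int J" if "l' \<ge> l" for l' using J that by linarith
  have e: "iterc (a g n' u) v w l' p q
      = (\<Sum>j<J. t (of_int p gchoose j) (Y (YV (a g n' u) (l' + int j) v) (p + q - int j) w))"
    if "n' \<ge> n" "l' \<ge> l" for n' l'
    by (rule iterc_sum[OF J0[OF that(1)] J'[OF that(2)]])
  have "zbin k (\<lambda>n l. iterc (a g n u) v w l p q) n l
    = zbin k (\<lambda>n l. \<Sum>j<J. t (of_int p gchoose j) (Y (YV (a g n u) (l + int j) v) (p + q - int j) w)) n l"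
    by (rule zbin_cong) (rule e)
  also have "\<dots> = (\<Sum>j<J. t (of_int p gchoose j)
      (zbin k (\<lambda>n l. Y (YV (a g n u) (l + int j) v) (p + q - int j) w) n l))"
    by (rule W.zbin_lincomb)
  also have "\<dots> = (\<Sum>j<J. t (of_int p gchoose j) (\<Sum>i<J. t (bdiff n i)
      (Y (a g (int k + n - int i) (YV u (l + int i + int j) v)) (p + q - int j) w)))"
  proof (intro sum.cong refl arg_cong2[where f = t])
    fix j
    have "zbin k (\<lambda>n l. Y (YV (a g n u) (l + int j) v) (p + q - int j) w) n l
      = Y (zbin k (\<lambda>n l. YV (a g n u) l v) n (l + int j)) (p + q - int j) w"
      using zbin_shift[of k "\<lambda>n l. YV (a g n u) l v" 0 "int j" n l]
      by (subst zbin_map[symmetric, where \<phi> = "\<lambda>x. Y x (p + q - int j) w"]) (simp_all add: Y_add1)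
    also have "zbin k (\<lambda>n l. YV (a g n u) l v) n (l + int j)
      = twist s (\<lambda>N j. a g N (YV u j v)) n (int k) (l + int j)"
      by (rule YV_assoc_gen[symmetric, OF lev k])
    also have "\<dots> = (\<Sum>i<J. s (bdiff n i) (a g (int k + n - int i) (YV u (l + int j + int i) v)))"
      by (rule V.twist_sum[of M]) (use J M in auto)
    finally show "zbin k (\<lambda>n l. Y (YV (a g n u) (l + int j) v) (p + q - int j) w) n l
      = (\<Sum>i<J. t (bdiff n i) (Y (a g (int k + n - int i) (YV u (l + int i + int j) v)) (p + q - int j) w))"
      by (simp add: Y_sum1 Y_scale1 add_ac)
  qed
  also have "\<dots> = (\<Sum>i<J. t (bdiff n i) (iterg g u v w (int k + n - int i) (l + int i) p q))"
  proof -
    have "iterg g u v w N (l + int i) p q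
      = (\<Sum>j<J. t (of_int p gchoose j) (Y (a g N (YV u (l + int i + int j) v)) (p + q - int j) w))" for i N
      by (rule iterg_sum[OF M]) (use J in auto)
    then show ?thesis
      unfolding W.scale_sum_right by (subst sum.swap) (simp add: W.scale_sum_right mult.commute)
  qed
  also have "\<dots> = assocg g u v w n (int k) l p q"
    by (rule assocg_sum[symmetric, OF M J(2)])
  finally show ?thesis .
qed

text \<open>The distance from g to w is both \<open>z + x1\<close> and
  \<open>(z + x0) + x2\<close>.\<close>

lemma zbin_assocg:
  "zbin r (\<lambda>n p. assocg g u v w n m l p q) n p = zbin r (\<lambda>m q. assocg g u v w n m l p q) m q"
proof (rule zbin_exchange)
  fix n m p q
  obtain M where M: "\<And>j. j \<ge> M \<Longrightarrow> YV u j v = 0" using YV_trunc by blast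
  have 1: "assocg g u v w (n + 1) m l p q = assocg g u v w n (m + 1) l p q - assocg g u v w n m (l + 1) p q"
    unfolding assocg_def by (rule W.twist_rec[of M]) (rule iterg_eq_0[OF M])
  define I where "I = nat (M - l)"
  have I: "M \<le> l + int I" "M \<le> (l + 1) + int I" unfolding I_def by linarith+
  note e = assocg_sum[OF M I(1)]
  have "assocg g u v w n m (l + 1) p q
      = (\<Sum>i<I. t (bdiff n i) (iterg g u v w (m + n - int i) (l + int i + 1) p q))"
    by (subst assocg_sum[OF M I(2)]) (simp_all add: add_ac)
  also have "\<dots> = assocg g u v w n m l (p + 1) q - assocg g u v w n m l p (q + 1)"
    by (simp add: e iterg_rec W.scale_right_diff_distrib sum_subtractf)
  finally show "assocg g u v w (n + 1) m l p q + assocg g u v w n m l (p + 1) q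
      = assocg g u v w n (m + 1) l p q + assocg g u v w n m l p (q + 1)"
    using 1 by simp
qed

definition "act_iterc g u v w r N l p q = twist t (\<lambda>N j. b g N (iterc u v w l p j)) N r q"

lemma zbin_iterg:
  assumes lev: "\<And>g n. n \<ge> int (glev lw g) \<Longrightarrow> b g n w = 0" and r: "r \<ge> glev lw g"
  shows "zbin r (\<lambda>N q. iterg g u v w N l p q) N q = act_iterc g u v w (int r) N l p q"
proof -
  obtain M where M: "\<And>j. j \<ge> M \<Longrightarrow> YV u j v = 0" using YV_trunc by blast
  define J where "J = nat (M - l)"
  have J: "M \<le> l + int J" unfolding J_def by linarith
  have "\<exists>I. \<forall>j\<in>{..<J}. \<forall>n\<ge>I. Y (YV u (l + int j) v) n w = 0"
    by (rule ex_uniform_bound) (auto intro: Y_trunc)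
  then obtain I0 where I0: "\<And>j n. j < J \<Longrightarrow> n \<ge> I0 \<Longrightarrow> Y (YV u (l + int j) v) n w = 0" by auto
  define I where "I = nat (I0 - p - q + int J)"
  have I: "I0 - p - q + int J \<le> int I" unfolding I_def by linarith
  have ic: "iterc u v w l p q = (\<Sum>j<J. t (of_int p gchoose j) (Y (YV u (l + int j) v) (p + q - int j) w))" for q
    by (rule iterc_sum[OF M J])
  have z: "iterc u v w l p q' = 0" if "q' \<ge> q + int I" for q'
    unfolding ic by (rule sum.neutral) (use that I in \<open>auto simp: I0\<close>)
  have "zbin r (\<lambda>N q. iterg g u v w N l p q) N q
    = (\<Sum>j<J. t (of_int p gchoose j) (zbin r (\<lambda>N q. Y (a g N (YV u (l + int j) v)) (p + q - int j) w) N q))"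
    unfolding W.zbin_lincomb[symmetric] by (intro zbin_cong iterg_sum[OF M J])
  also have "\<dots> = (\<Sum>j<J. t (of_int p gchoose j) (\<Sum>i<I. t (bdiff N i)
      (b g (int r + N - int i) (Y (YV u (l + int j) v) (p + (q + int i) - int j) w))))"
  proof (intro sum.cong refl arg_cong2[where f = t])
    fix j assume j: "j \<in> {..<J}"
    have "zbin r (\<lambda>N q. Y (a g N (YV u (l + int j) v)) (p + q - int j) w) N q
      = zbin r (\<lambda>N q. Y (a g N (YV u (l + int j) v)) q w) N (p + q - int j)"
      using zbin_shift[of r "\<lambda>N q. Y (a g N (YV u (l + int j) v)) q w" 0 "p - int j" N q]
      by (simp add: algebra_simps)
    also have "\<dots> = twist t (\<lambda>N k. b g N (Y (YV u (l + int j) v) k w)) N (int r) (p + q - int j)"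
      by (rule Y_assoc_gen[symmetric, OF lev r])
    also have "\<dots> = (\<Sum>i<I. t (bdiff N i)
        (b g (int r + N - int i) (Y (YV u (l + int j) v) (p + q - int j + int i) w)))"
      by (rule W.twist_sum[of I0]) (use j I in \<open>auto simp: I0\<close>)
    finally show "zbin r (\<lambda>N q. Y (a g N (YV u (l + int j) v)) (p + q - int j) w) N q
      = (\<Sum>i<I. t (bdiff N i) (b g (int r + N - int i) (Y (YV u (l + int j) v) (p + (q + int i) - int j) w)))"
      by (simp add: algebra_simps)
  qed
  also have "\<dots> = (\<Sum>i<I. t (bdiff N i) (b g (int r + N - int i) (iterc u v w l p (q + int i))))"
    unfolding ic W.b_sum W.b_scale W.scale_sum_right
    by (subst sum.swap) (simp add: mult.commute)
  also have "\<dots> = act_iterc g u v w (int r) N l p q"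
    unfolding act_iterc_def by (rule W.twist_sum[symmetric, of "q + int I"]) (auto simp: z)
  finally show ?thesis .
qed

lemma act_iterc_eq_0: "(\<And>j. j \<ge> M \<Longrightarrow> YV u j v = 0) \<Longrightarrow> l \<ge> M \<Longrightarrow> act_iterc g u v w r N l p q = 0"
  using W.twist_sum[of q "\<lambda>N j. b g N (iterc u v w l p j)" q 0 N r] iterc_eq_0[of M u v l w p]
  by (simp add: act_iterc_def)

text \<open>Expanding g at z + x0 + x2 in two steps equals expanding it at z + x1; the double sum
  collapses along diagonals by \<open>bdiff_trinomial\<close>.\<close>

lemma twist_act_iterc:
  "twist t (\<lambda>N l. act_iterc g u v w r N l p q) n 0 l = act_shift g (iterc u v w) n r l p q"
proof -
  let ?c = "\<lambda>l q. iterc u v w l p q"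
  obtain M where M: "\<And>j. j \<ge> M \<Longrightarrow> YV u j v = 0" using YV_trunc by blast
  obtain K0 where "vanish_above ?c l q K0" using iterc_bounded2[of u v w p] by (auto simp: bounded2_def)
  define K where "K = K0 + nat (M - l)"
  have "vanish_above ?c l q K" by (rule vanish_above_mono) (fact, simp add: K_def)
  then have K: "?c (l + int i) (q + int j) = 0" if "K \<le> i + j" for i j
    using that by (simp add: vanish_above_def)
  have KM: "M \<le> l + int K" unfolding K_def by linarith
  have zb: "iterc u v w l (p + int \<rho>) q = (\<Sum>i\<le>\<rho>. t (of_nat (\<rho> choose i)) (?c (l + int i) (q + int (\<rho> - i))))" for \<rho>
  proof -
    have "zbin \<rho> (\<lambda>l q. iterc u v w l p q) l q = iterc u v w l (p + int \<rho>) q"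
      by (rule zbin_rec) (simp add: iterc_rec)
    then show ?thesis by (simp only: W.zbin_sum)
  qed
  have "twist t (\<lambda>N l. act_iterc g u v w r N l p q) n 0 l
    = (\<Sum>i<K. t (bdiff n i) (act_iterc g u v w r (0 + n - int i) (l + int i) p q))"
    by (rule W.twist_sum[of M]) (use act_iterc_eq_0[OF M] KM in auto)
  also have "\<dots> = (\<Sum>i<K. t (bdiff n i) (\<Sum>j<K. t (bdiff (n - int i) j)
      (b g (r + (n - int i) - int j) (?c (l + int i) (q + int j)))))"
  proof (intro sum.cong refl arg_cong2[where f = t])
    fix i
    have "?c (l + int i) j = 0" if "j \<ge> q + int K" for j
      using K[of i "nat (j - q)"] that by simp
    then have "act_iterc g u v w r (n - int i) (l + int i) p q = (\<Sum>j<K. t (bdiff (n - int i) j)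
      (b g (r + (n - int i) - int j) (?c (l + int i) (q + int j))))"
      unfolding act_iterc_def by (intro W.twist_sum[of "q + int K"]) auto
    then show "act_iterc g u v w r (0 + n - int i) (l + int i) p q = (\<Sum>j<K. t (bdiff (n - int i) j)
      (b g (r + (n - int i) - int j) (?c (l + int i) (q + int j))))" by simp
  qed
  also have "\<dots> = (\<Sum>(i, j)\<in>{..<K} \<times> {..<K}. t (bdiff n i * bdiff (n - int i) j)
      (b g (r + n - int (i + j)) (?c (l + int i) (q + int j))))"
    by (simp add: W.scale_sum_right sum.cartesian_product algebra_simps)
  also have "\<dots> = (\<Sum>(i, j)\<in>{(i, j). i + j < K}. t (bdiff n i * bdiff (n - int i) j)
      (b g (r + n - int (i + j)) (?c (l + int i) (q + int j))))"
  proof (rule sum.mono_neutral_right)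
    show "\<forall>ij\<in>{..<K} \<times> {..<K} - {(i, j). i + j < K}. (case ij of (i, j) \<Rightarrow>
        t (bdiff n i * bdiff (n - int i) j) (b g (r + n - int (i + j)) (?c (l + int i) (q + int j)))) = 0"
      using K by (auto simp: not_less) (metis W.b_0 not_less)
  qed auto
  also have "\<dots> = (\<Sum>\<rho><K. \<Sum>i\<le>\<rho>. t (bdiff n i * bdiff (n - int i) (\<rho> - i))
      (b g (r + n - int \<rho>) (?c (l + int i) (q + int (\<rho> - i)))))"
    by (subst sum.triangle_reindex) (auto intro!: sum.cong)
  also have "\<dots> = (\<Sum>\<rho><K. t (bdiff n \<rho>) (b g (r + n - int \<rho>) (iterc u v w l (p + int \<rho>) q)))"
    unfolding zb W.b_sum W.b_scale W.scale_sum_right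
    by (intro sum.cong refl) (simp add: bdiff_trinomial)
  also have "\<dots> = act_shift g (iterc u v w) n r l p q"
    unfolding act_shift_def
  proof (rule W.twist_sum[symmetric, of "p + int K"])
    fix N j assume j: "j \<ge> p + int K"
    define \<rho> where "\<rho> = nat (j - p)"
    have \<rho>: "j = p + int \<rho>" "\<rho> \<ge> K" using j by (auto simp: \<rho>_def)
    have "iterc u v w l j q = 0"
      unfolding \<rho>(1) zb
    proof (intro sum.neutral ballI)
      fix i assume "i \<in> {..\<rho>}"
      then have "K \<le> i + (\<rho> - i)" using \<rho>(2) by simp
      from K[OF this] show "t (of_nat (\<rho> choose i)) (?c (l + int i) (q + int (\<rho> - i))) = 0" by simp
    qed
    then show "b g N (iterc u v w l j q) = 0" by simp
  qed simp
  finally show ?thesis .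
qed

text \<open>Two uses of associativity with g, first on v with factor \<open>(z + x0)^k\<close>, then
  on w with factor \<open>(z + x1)^r\<close>, move g out of the iterate. Both exponents are
  independent of the coefficient considered, unlike in \<open>zbin_prodc\<close>.\<close>

lemma zbin_iterc:
  assumes levv: "\<And>g n. n \<ge> int (glev lv g) \<Longrightarrow> a g n v = 0" and k: "k \<ge> glev lv g"
    and levw: "\<And>g n. n \<ge> int (glev lw g) \<Longrightarrow> b g n w = 0" and r: "r \<ge> glev lw g"
  shows "zbin k (\<lambda>n l. zbin r (\<lambda>n p. iterc (a g n u) v w l p q) n p) n l
    = zbin k (\<lambda>n l. act_shift g (iterc u v w) n (int r) l p q) n l"
proof -
  obtain M where M: "\<And>j. j \<ge> M \<Longrightarrow> YV u j v = 0" using YV_trunc by blast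
  define I where "I = nat (M - l)"
  have I: "M \<le> l + int I" unfolding I_def by linarith
  have "zbin k (\<lambda>n l. zbin r (\<lambda>n p. iterc (a g n u) v w l p q) n p) n l
    = zbin r (\<lambda>n p. assocg g u v w n (int k) l p q) n p"
    by (subst zbin_commute[symmetric]) (simp only: zbin_iterc_assocg[OF levv k])
  also have "\<dots> = zbin r (\<lambda>m q. assocg g u v w n m l p q) (int k) q"
    by (rule zbin_assocg)
  also have "\<dots> = (\<Sum>i<I. t (bdiff n i) (zbin r (\<lambda>m q. iterg g u v w (m + n - int i) (l + int i) p q) (int k) q))"
    unfolding W.zbin_lincomb[symmetric] by (intro zbin_cong assocg_sum[OF M I])
  also have "\<dots> = (\<Sum>i<I. t (bdiff n i) (act_iterc g u v w (int r) (int k + n - int i) (l + int i) p q))"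
  proof (intro sum.cong refl arg_cong2[where f = t])
    fix i
    have "zbin r (\<lambda>m q. iterg g u v w (m + n - int i) (l + int i) p q) (int k) q
      = zbin r (\<lambda>m q. iterg g u v w m (l + int i) p q) (int k + n - int i) q"
      using zbin_shift[of r "\<lambda>m q. iterg g u v w m (l + int i) p q" "n - int i" 0 "int k" q]
      by (simp add: algebra_simps)
    also have "\<dots> = act_iterc g u v w (int r) (int k + n - int i) (l + int i) p q"
      by (rule zbin_iterg[OF levw r])
    finally show "zbin r (\<lambda>m q. iterg g u v w (m + n - int i) (l + int i) p q) (int k) q = \<dots>" .
  qed
  also have "\<dots> = twist t (\<lambda>N l. act_iterc g u v w (int r) N l p q) n (int k) l"
    by (rule W.twist_sum[symmetric, of M]) (use act_iterc_eq_0[OF M] I in auto)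
  also have "\<dots> = zbin k (\<lambda>n l. twist t (\<lambda>N l. act_iterc g u v w (int r) N l p q) n 0 l) n l"
    by (subst W.zbin_twist[of M]) (use act_iterc_eq_0[OF M] in auto)
  also have "\<dots> = zbin k (\<lambda>n l. act_shift g (iterc u v w) n (int r) l p q) n l"
    by (simp only: twist_act_iterc)
  finally show ?thesis .
qed


text \<open>At \<open>p = 0\<close> both sides are \<open>v_q w\<close> for \<open>l = -1\<close>
  and zero otherwise; \<open>twist_iter_up\<close> extends this to \<open>p \<ge> 0\<close>.\<close>

lemma prodc_vac_iterc: "p \<ge> 0 \<Longrightarrow> prodc vac v w l p q = iterc vac v w l p q"
proof -
  assume p: "p \<ge> 0"
  obtain L where L: "\<And>j. j \<ge> L \<Longrightarrow> Y v j w = 0" using Y_trunc by blast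
  have tG: "Y vac N (Y v j w) = 0" if "j \<ge> L" for N j using L[OF that] by simp
  have tK: "Y (YV vac j v) N w = 0" if "j \<ge> 0" for j N using that by (simp add: YV_vac)
  have 0: "twist t (\<lambda>N j. Y vac N (Y v j w)) l 0 q = iter t (\<lambda>j n. Y (YV vac j v) n w) l 0 q" for l q
  proof -
    have "iter t (\<lambda>j n. Y (YV vac j v) n w) l 0 q = (if l = -1 then Y v q w else 0)"
      by (subst W.iter_0[of 0]) (simp_all add: tK YV_vac)
    moreover have "twist t (\<lambda>N j. Y vac N (Y v j w)) l 0 q = (if l = -1 then Y v q w else 0)"
    proof -
      define K where "K = Suc (nat (L - q) + nat (l + 1))"
      have "twist t (\<lambda>N j. Y vac N (Y v j w)) l 0 q
        = (\<Sum>i<K. t (bdiff l i) (Y vac (0 + l - int i) (Y v (q + int i) w)))"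
      proof (rule W.twist_sum[of L])
        show "L \<le> q + int K" unfolding K_def by linarith
      qed (rule tG)
      also have "\<dots> = (\<Sum>i<K. if int i = l + 1 then t (bdiff l i) (Y v (q + int i) w) else 0)"
        by (intro sum.cong) (auto simp: Y_vac)
      also have "\<dots> = (if l = -1 then Y v q w else 0)"
      proof (cases "l \<ge> -1")
        case False
        then show ?thesis by (intro trans[OF sum.neutral]) auto
      next
        case True
        define i0 where "i0 = nat (l + 1)"
        have i0: "int i0 = l + 1" "i0 < K" using True by (auto simp: i0_def K_def)
        have "(\<Sum>i<K. if int i = l + 1 then t (bdiff l i) (Y v (q + int i) w) else 0)
          = (\<Sum>i<K. if i = i0 then t (bdiff l i) (Y v (q + int i) w) else 0)"
          by (intro sum.cong) (use i0 in auto)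
        also have "\<dots> = t (bdiff l i0) (Y v (q + int i0) w)" using i0(2) by simp
        also have "\<dots> = (if l = -1 then Y v q w else 0)"
        proof (cases "l = -1")
          case False
          define k where "k = nat l"
          have "l \<ge> 0" using False True by linarith
          then have "l = int k" "i0 = Suc k" by (simp_all add: k_def i0_def nat_add_distrib)
          then show ?thesis by (simp add: bdiff_def binomial_eq_0 flip: binomial_gbinomial)
        qed (use i0 in simp)
        finally show ?thesis .
      qed
      finally show ?thesis .
    qed
    ultimately show ?thesis by simp
  qed
  show ?thesis unfolding prodc_def iterc_def
    by (rule W.twist_iter_up[OF tG tK 0 p])
qed

lemma act_shift_cong:
  assumes "\<And>j. j \<ge> p \<Longrightarrow> \<Theta> l j q = \<Theta>' l j q"
  shows "act_shift g \<Theta> n m l p q = act_shift g \<Theta>' n m l p q"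
  unfolding act_shift_def by (rule W.twist_eqI) (simp add: assms)

text \<open>The difference \<open>\<Delta>\<close> of product and iterate for g(z) u is first shown
  to vanish after multiplication by fixed powers of z + x0 and z + x1 (this is \<open>Z\<close>).
  These powers are then stripped off by descending in \<open>n\<close>, at the cost of a larger
  bound on \<open>p\<close>.\<close>

lemma prodc_iterc_op:
  assumes IH: "\<And>p l q. p \<ge> L \<Longrightarrow> prodc u v w l p q = iterc u v w l p q"
  shows "\<exists>P. \<forall>p\<ge>P. \<forall>l q. prodc (a g n u) v w l p q = iterc (a g n u) v w l p q"
proof -
  obtain lv where lv: "\<And>g n. n \<ge> int (glev lv g) \<Longrightarrow> a g n v = 0" using V_ex_level by blast
  obtain lw where lw: "\<And>g n. n \<ge> int (glev lw g) \<Longrightarrow> b g n w = 0" using ex_level by blast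
  define k where "k = glev lv g"
  define r0 where "r0 = glev lw g"
  obtain Q where Q: "\<And>j. j \<ge> Q \<Longrightarrow> Y v j w = 0" using Y_trunc by blast
  obtain n0 where n0: "\<And>n. n \<ge> n0 \<Longrightarrow> a g n u = 0" using V.b_trunc by blast
  define A where "A n l p q = prodc (a g n u) v w l p q" for n l p q
  define C where "C n l p q = iterc (a g n u) v w l p q" for n l p q
  define \<Delta> where "\<Delta> n l p q = A n l p q - C n l p q" for n l p q
  define Z where "Z n l p q = zbin r0 (\<lambda>n p. zbin k (\<lambda>n l. \<Delta> n l p q) n l) n p" for n l p q
  have \<Delta>_rec: "\<Delta> n (l + 1) p q = \<Delta> n l (p + 1) q - \<Delta> n l p (q + 1)" for n l p q
    by (simp add: \<Delta>_def A_def C_def prodc_rec iterc_rec)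
  have Z_rec: "Z n (l + 1) p q = Z n l (p + 1) q - Z n l p (q + 1)" for n l p q
  proof -
    have sh: "zbin k (\<lambda>n l. \<Delta> n (l + 1) p q) n l = zbin k (\<lambda>n l. \<Delta> n l p q) n (l + 1)" for n p
      using zbin_shift[of k "\<lambda>n l. \<Delta> n l p q" 0 1 n l] by simp
    have "Z n (l + 1) p q = zbin r0 (\<lambda>n p. zbin k (\<lambda>n l. \<Delta> n l (p + 1) q - \<Delta> n l p (q + 1)) n l) n p"
      unfolding Z_def sh[symmetric] by (simp add: \<Delta>_rec)
    also have "\<dots> = zbin r0 (\<lambda>n p. zbin k (\<lambda>n l. \<Delta> n l (p + 1) q) n l) n p - Z n l p (q + 1)"
      by (simp add: zbin_diff Z_def)
    also have "zbin r0 (\<lambda>n p. zbin k (\<lambda>n l. \<Delta> n l (p + 1) q) n l) n p = Z n l (p + 1) q"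
      using zbin_shift[of r0 "\<lambda>n p. zbin k (\<lambda>n l. \<Delta> n l p q) n l" 0 1 n p] by (simp add: Z_def)
    finally show ?thesis .
  qed
  have Zsplit: "zbin r (\<lambda>n p. zbin k (\<lambda>n l. \<Delta> n l p q) n l) n p
      = zbin k (\<lambda>n l. zbin r (\<lambda>n p. A n l p q) n p) n l
        - zbin k (\<lambda>n l. act_shift g (iterc u v w) n (int r) l p q) n l"
    if "r \<ge> r0" for r n l p q
  proof -
    have "zbin r (\<lambda>n p. zbin k (\<lambda>n l. \<Delta> n l p q) n l) n p
      = zbin k (\<lambda>n l. zbin r (\<lambda>n p. A n l p q) n p) n l - zbin k (\<lambda>n l. zbin r (\<lambda>n p. C n l p q) n p) n l"
      unfolding \<Delta>_def zbin_diff zbin_commute[of r k "\<lambda>n l p. A n l p q"] zbin_commute[of r k "\<lambda>n l p. C n l p q"] ..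
    then show ?thesis
      unfolding C_def k_def using zbin_iterc[OF lv order_refl lw that[unfolded r0_def]] by simp
  qed
  have Hcong: "act_shift g (iterc u v w) n m l p q = act_shift g (prodc u v w) n m l p q" if "p \<ge> L" for n m l p q
    by (rule act_shift_cong) (use that in \<open>auto simp: IH\<close>)
  \<comment> \<open>For fixed \<open>q\<close> a further power \<open>R\<close> of z + x1 makes
    \<open>zbin_prodc\<close> applicable, and the hypothesis on u identifies the two results.
    \<open>R\<close> depends on \<open>q\<close>, so it has to be removed again.\<close>
  have Z_kill: "\<exists>R. \<forall>n l p. p \<ge> L \<longrightarrow> zbin R (\<lambda>n p. Z n l p q) n p = 0" for q
  proof -
    obtain S where S: "\<And>r n l p. r \<ge> S \<Longrightarrow>
        zbin r (\<lambda>n p. prodc (a g n u) v w l p q) n p = act_shift g (prodc u v w) n (int r) l p q"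
      using zbin_prodc[of q g u v w] by blast
    have "zbin S (\<lambda>n p. Z n l p q) n p = 0" if p: "p \<ge> L" for n l p
    proof -
      have "zbin S (\<lambda>n p. Z n l p q) n p = zbin (S + r0) (\<lambda>n p. zbin k (\<lambda>n l. \<Delta> n l p q) n l) n p"
        by (simp only: Z_def zbin_zbin)
      also have "\<dots> = 0"
        by (subst Zsplit) (simp_all add: A_def S Hcong p)
      finally show ?thesis .
    qed
    then show ?thesis by blast
  qed
  have Z_Q: "Z n l p q = 0" if "p \<ge> L" "q \<ge> Q" for n l p q
  proof -
    have "A n l p q = 0" for n l p by (simp add: A_def prodc_eq_0[OF Q that(2)])
    moreover have "act_shift g (prodc u v w) n m l p q = 0" for n m l p
      by (simp add: act_shift_def prodc_eq_0[OF Q that(2)] twist_def)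
    ultimately show ?thesis
      unfolding Z_def by (subst Zsplit) (simp_all add: Hcong that zbin_eq_0)
  qed
  have \<Delta>_n0: "\<Delta> n l p q = 0" if "n \<ge> n0" for n l p q
    using n0[OF that] by (simp add: \<Delta>_def A_def C_def prodc_def iterc_def twist_def iter_def)
  have Z_n0: "Z n l p q = 0" if "n \<ge> n0" for n l p q
    unfolding Z_def by (intro zbin_eq_0) (use that \<Delta>_n0 in auto)
  \<comment> \<open>Descending induction on \<open>n\<close>, and for each \<open>n\<close> on
    \<open>q\<close>, starting where truncation makes \<open>Z\<close> zero.\<close>
  have Z0: "\<forall>n l p q. n \<ge> n0 - int i \<longrightarrow> p \<ge> L \<longrightarrow> Z n l p q = 0" for i
  proof (induction i)
    case 0
    then show ?case using Z_n0 by simp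
  next
    case (Suc i)
    let ?n = "n0 - int (Suc i)"
    have up: "Z n' l p q = 0" if "n' > ?n" "p \<ge> L" for n' l p q
      using Suc that by simp
    have Zq: "\<forall>l p q. q \<ge> Q - int j \<longrightarrow> p \<ge> L \<longrightarrow> Z ?n l p q = 0" for j
    proof (induction j)
      case 0
      then show ?case using Z_Q by simp
    next
      case (Suc j)
      show ?case
      proof (intro allI impI)
        fix l p q assume q: "q \<ge> Q - int (Suc j)" and p: "p \<ge> L"
        obtain R where R: "\<And>n l p. p \<ge> L \<Longrightarrow> zbin R (\<lambda>n p. Z n l p q) n p = 0" using Z_kill by blast
        \<comment> \<open>In the topmost remaining row the power of z + x1 acts as
          \<open>x1^R\<close>, so \<open>Z\<close> vanishes at \<open>p + R\<close>.\<close>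
        have top: "Z ?n l (p + int R) q = 0" if "p \<ge> L" for l p
          using R[OF that, of l ?n] zbin_lead[of ?n L "\<lambda>n p. Z n l p q" p R] up that by simp
        \<comment> \<open>The term with \<open>q + 1\<close> is already zero, so \<open>x0\<close>
          and \<open>x1\<close> act alike on this row; trading \<open>R\<close> powers of
          \<open>x0\<close> for powers of \<open>x1\<close> reaches the range of
          \<open>top\<close>.\<close>
        have step: "Z ?n (l + 1) p q = Z ?n l (p + 1) q" if "p \<ge> L" for l p
          using Z_rec[of ?n l p q] Suc q that by simp
        have "Z ?n l p q = Z ?n (l - int i) (p + int i) q" for i
        proof (induction i)
          case (Suc i)
          then show ?case using step[of "p + int i" "l - int (Suc i)"] p by (simp add: algebra_simps)
        qed simp
        from this[of R] top[OF p, of "l - int R"] show "Z ?n l p q = 0" by simp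
      qed
    qed
    have *: "Z ?n l p q = 0" if "p \<ge> L" for l p q
      using Zq[of "nat (Q - q)"] that by simp
    show ?case
    proof (intro allI impI)
      fix n l p q assume "n \<ge> n0 - int (Suc i)" "p \<ge> L"
      then show "Z n l p q = 0" using * up by (cases "n = ?n") auto
    qed
  qed
  have Z_0: "Z n l p q = 0" if "p \<ge> L" for n l p q
    using Z0[of "nat (n0 - n)"] that by simp
  \<comment> \<open>Stripping the factor of z + x0 costs only a shift of \<open>l\<close>, on which
    the statement does not depend; stripping the one of z + x1 raises the bound on \<open>p\<close>
    by \<open>r0\<close> for each step down in \<open>n\<close>.\<close>
  have "\<exists>P\<ge>L. \<forall>n l p q. n \<ge> n0 - int i \<longrightarrow> p \<ge> P \<longrightarrow> \<Delta> n l p q = 0" for i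
  proof (induction i)
    case 0
    then show ?case using \<Delta>_n0 by auto
  next
    case (Suc i)
    then obtain P where P: "P \<ge> L" "\<And>n l p q. n \<ge> n0 - int i \<Longrightarrow> p \<ge> P \<Longrightarrow> \<Delta> n l p q = 0" by blast
    let ?n = "n0 - int (Suc i)"
    have "\<Delta> n l p q = 0" if n: "n \<ge> ?n" and p: "p \<ge> P + int r0" for n l p q
    proof (cases "n = ?n")
      case False
      then show ?thesis using P(2)[of n p] n p by simp
    next
      case True
      have inner: "zbin k (\<lambda>n l. \<Delta> n l p' q) ?n (l - int k) = \<Delta> ?n l p' q" if "p' \<ge> P" for p'
        using zbin_lead[of ?n "l - int k" "\<lambda>n l. \<Delta> n l p' q" "l - int k" k] P(2) that by simp
      have outer: "zbin k (\<lambda>n l. \<Delta> n l p' q) n' (l - int k) = 0" if "n' > ?n" "p' \<ge> P" for n' p'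
        by (rule zbin_eq_0) (use P(2) that in simp)
      have "Z ?n (l - int k) (p - int r0) q = zbin k (\<lambda>n l. \<Delta> n l (p - int r0 + int r0) q) ?n (l - int k)"
        unfolding Z_def
        by (rule zbin_lead[of ?n P "\<lambda>n p. zbin k (\<lambda>n l. \<Delta> n l p q) n (l - int k)"]) (use outer p in auto)
      also have "\<dots> = \<Delta> ?n l p q" using inner[of p] p by simp
      finally show ?thesis using Z_0[of "p - int r0"] P(1) p True by simp
    qed
    then show ?case using P(1) by (intro exI[of _ "P + int r0"]) auto
  qed
  from this[of "nat (n0 - n)"] obtain P
    where P: "\<forall>n' l p q. n' \<ge> n0 - int (nat (n0 - n)) \<longrightarrow> p \<ge> P \<longrightarrow> \<Delta> n' l p q = 0" by blast
  have "n \<ge> n0 - int (nat (n0 - n))" by linarith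
  with P have "\<forall>p\<ge>P. \<forall>l q. \<Delta> n l p q = 0" by blast
  then show ?thesis by (auto simp: \<Delta>_def A_def C_def)
qed

theorem prodc_iterc: "\<exists>P. \<forall>p\<ge>P. \<forall>l q. prodc u v w l p q = iterc u v w l p q"
  using V
proof (induction u rule: VAh_induct)
  case vac
  show ?case using prodc_vac_iterc by blast
next
  case (add u u')
  then obtain P P' where "\<And>p l q. p \<ge> P \<Longrightarrow> prodc u v w l p q = iterc u v w l p q"
    "\<And>p l q. p \<ge> P' \<Longrightarrow> prodc u' v w l p q = iterc u' v w l p q" by blast
  then have "\<forall>p\<ge>max P P'. \<forall>l q. prodc (u + u') v w l p q = iterc (u + u') v w l p q"
    by (simp add: prodc_add iterc_add)
  then show ?case ..
next
  case (scale r u)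
  then show ?case by (simp add: prodc_scale iterc_scale) blast
next
  case (op g n u)
  then obtain L where "\<And>p l q. p \<ge> L \<Longrightarrow> prodc u v w l p q = iterc u v w l p q" by blast
  then show ?case by (rule prodc_iterc_op)
qed

end

section \<open>Skew symmetry and the Jacobi identity\<close>

text \<open>Multiplication of \<open>\<tau>(x) = \<Sum> \<tau>\<^sub>n x^(-n-1)\<close> by a power series.\<close>

definition xmul :: "(complex \<Rightarrow> 'w \<Rightarrow> 'w) \<Rightarrow> complex fps \<Rightarrow> (int \<Rightarrow> 'w::ab_group_add) \<Rightarrow> int \<Rightarrow> 'w"
  where "xmul t f \<tau> n = Sum_any (\<lambda>k. t (fps_nth f k) (\<tau> (n + int k)))"

text \<open>The divided derivatives, so that \<open>f(y + x) = \<Sum> x^i fps_hasse i f (y)\<close>.\<close>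

definition fps_hasse :: "nat \<Rightarrow> complex fps \<Rightarrow> complex fps"
  where "fps_hasse i f = Abs_fps (\<lambda>r. of_nat (i + r choose i) * fps_nth f (i + r))"

text \<open>Upper negation of \<open>bdiff\<close> turns this into the ordinary Vandermonde sum, and
  a second upper negation gives the stated form.\<close>

lemma gbinomial_alternating_Vandermonde:
  "(\<Sum>i\<le>j. (of_int p gchoose i) * bdiff (n - int i) (j - i)) = (- 1) ^ j * (of_int (n - p) gchoose j)"
proof -
  have "bdiff (n - int i) (j - i) = (of_int (int j - n - 1) gchoose (j - i))" if "i \<le> j" for i
    using bdiff_neg[of "j - i" "int j - n - 1"] that by (simp add: of_nat_diff algebra_simps)
  then have "(\<Sum>i\<le>j. (of_int p gchoose i) * bdiff (n - int i) (j - i))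
      = (\<Sum>i\<le>j. (of_int p gchoose i) * (of_int (int j - n - 1) gchoose (j - i)))"
    by (intro sum.cong) auto
  also have "\<dots> = (of_int p + of_int (int j - n - 1) gchoose j)"
    using gbinomial_Vandermonde[of "of_int p :: complex" "of_int (int j - n - 1)" j]
    by (simp add: atLeast0AtMost)
  also have "\<dots> = (- 1) ^ j * (of_int (n - p) gchoose j)"
    using gbinomial_negated_upper[of "of_int p + of_int (int j - n - 1) :: complex" j]
    by (simp add: algebra_simps)
  finally show ?thesis .
qed

context cspace
begin

lemma xmul_sum:
  assumes "\<And>k. k \<ge> N \<Longrightarrow> \<tau> k = 0" "N \<le> n + int K"
  shows "xmul t f \<tau> n = (\<Sum>k<K. t (fps_nth f k) (\<tau> (n + int k)))"
  unfolding xmul_def by (rule Sum_any_lessThan) (use assms in auto)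

lemma xmul_eq_0: "(\<And>k. k \<ge> N \<Longrightarrow> \<tau> k = 0) \<Longrightarrow> n \<ge> N \<Longrightarrow> xmul t f \<tau> n = 0"
  using xmul_sum[of N \<tau> n 0 f] by simp

lemma xmul_one: "xmul t 1 \<tau> n = \<tau> n"
proof -
  have "xmul t 1 \<tau> n = (\<Sum>k<Suc 0. t (fps_nth 1 k) (\<tau> (n + int k)))"
    unfolding xmul_def by (rule Sum_any_lessThan) auto
  then show ?thesis by simp
qed

lemma xmul_const: "xmul t (fps_const r) \<tau> n = t r (\<tau> n)"
proof -
  have "xmul t (fps_const r) \<tau> n = (\<Sum>k<Suc 0. t (fps_nth (fps_const r) k) (\<tau> (n + int k)))"
    unfolding xmul_def by (rule Sum_any_lessThan) auto
  then show ?thesis by simp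
qed

lemma xmul_add:
  assumes "\<And>k. k \<ge> N \<Longrightarrow> \<tau> k = 0" "\<And>k. k \<ge> N' \<Longrightarrow> \<tau>' k = 0"
  shows "xmul t f (\<lambda>n. \<tau> n + \<tau>' n) n = xmul t f \<tau> n + xmul t f \<tau>' n"
proof -
  define K where "K = nat (max N N' - n)"
  have K: "max N N' \<le> n + int K" unfolding K_def by linarith
  have z: "\<tau> k = 0" "\<tau>' k = 0" if "k \<ge> max N N'" for k using assms that by auto
  have "xmul t f x n = (\<Sum>k<K. t (fps_nth f k) (x (n + int k)))" if "x \<in> {\<tau>, \<tau>', \<lambda>n. \<tau> n + \<tau>' n}" for x
    by (rule xmul_sum[OF _ K]) (use z that in auto)
  then show ?thesis by (simp add: scale_right_distrib sum.distrib)
qed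

lemma xmul_mult:
  assumes \<tau>: "\<And>k. k \<ge> N \<Longrightarrow> \<tau> k = 0"
  shows "xmul t f (xmul t g \<tau>) n = xmul t (f * g) \<tau> n"
proof -
  define K where "K = nat (N - n)"
  have K: "N \<le> n + int K" unfolding K_def by linarith
  have "xmul t f (xmul t g \<tau>) n = (\<Sum>i<K. t (fps_nth f i) (xmul t g \<tau> (n + int i)))"
    by (rule xmul_sum[OF _ K]) (rule xmul_eq_0[OF \<tau>])
  also have "\<dots> = (\<Sum>i<K. t (fps_nth f i) (\<Sum>j<K. t (fps_nth g j) (\<tau> (n + int i + int j))))"
    by (intro sum.cong refl arg_cong2[where f = t] xmul_sum[OF \<tau>]) (use K in auto)
  also have "\<dots> = (\<Sum>(i, j)\<in>{..<K} \<times> {..<K}. t (fps_nth f i * fps_nth g j) (\<tau> (n + int (i + j))))"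
    by (simp add: scale_sum_right sum.cartesian_product add_ac)
  also have "\<dots> = (\<Sum>(i, j)\<in>{(i, j). i + j < K}. t (fps_nth f i * fps_nth g j) (\<tau> (n + int (i + j))))"
  proof (rule sum.mono_neutral_right)
    have "\<tau> (n + int (i + j)) = 0" if "K \<le> i + j" for i j by (rule \<tau>) (use that K in linarith)
    then show "\<forall>ij\<in>{..<K} \<times> {..<K} - {(i, j). i + j < K}. (case ij of (i, j) \<Rightarrow>
        t (fps_nth f i * fps_nth g j) (\<tau> (n + int (i + j)))) = 0"
      by (auto simp del: of_nat_add) (metis not_less)
  qed auto
  also have "\<dots> = (\<Sum>r<K. \<Sum>i\<le>r. t (fps_nth f i * fps_nth g (r - i)) (\<tau> (n + int r)))"
    by (subst sum.triangle_reindex) (auto intro!: sum.cong)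
  also have "\<dots> = (\<Sum>r<K. t (fps_nth (f * g) r) (\<tau> (n + int r)))"
    by (simp add: fps_mult_nth atLeast0AtMost scale_sum_left)
  also have "\<dots> = xmul t (f * g) \<tau> n"
    by (rule xmul_sum[symmetric, OF \<tau> K])
  finally show ?thesis .
qed

lemma xmul_shift2_pow:
  assumes "bounded2 f"
  shows "(shift2 t e ^^ r) (\<lambda>m. xmul t g (f m)) m n = xmul t g (\<lambda>n. (shift2 t e ^^ r) f m n) n"
proof -
  obtain K where K: "vanish_above f m n K" using assms by (auto simp: bounded2_def)
  have 1: "xmul t g (f (m + int i)) (n + int j) = (\<Sum>k<K. t (fps_nth g k) (f (m + int i) (n + int j + int k)))" for i j
    unfolding xmul_def
  proof (rule Sum_any_lessThan)
    fix k assume "K \<le> k"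
    then have "f (m + int i) (n + int (j + k)) = 0" using K unfolding vanish_above_def by (simp only: trans_le_add2)
    then show "t (fps_nth g k) (f (m + int i) (n + int j + int k)) = 0" by (simp add: add.assoc)
  qed
  have "(shift2 t e ^^ r) (\<lambda>m. xmul t g (f m)) m n
    = (shift2 t e ^^ r) (\<lambda>m n. \<Sum>k<K. t (fps_nth g k) (f m (n + int k))) m n"
    by (rule shift2_pow_cong) (rule 1)
  also have "\<dots> = (\<Sum>k<K. t (fps_nth g k) ((shift2 t e ^^ r) f m (n + int k)))"
    using shift2_pow_commute_index[where e = e and r = r and f = f and m = m and a = 0]
    by (simp only: shift2_pow_sum_fun) simp
  also have "\<dots> = xmul t g (\<lambda>n. (shift2 t e ^^ r) f m n) n"
    unfolding xmul_def
  proof (rule Sum_any_lessThan[symmetric])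
    fix k assume k: "K \<le> k"
    have "vanish_above f (m + int 0) (n + int k) (K - (0 + k))" by (rule vanish_above_add[OF K])
    then have "(shift2 t e ^^ r) f (m + int 0) (n + int k) = 0" by (rule shift2_pow_eq_0) (use k in simp)
    then show "t (fps_nth g k) ((shift2 t e ^^ r) f m (n + int k)) = 0" by simp
  qed
  finally show ?thesis .
qed

text \<open>Taylor expansion of g(y + e x) in x, finite because \<open>f\<close> vanishes for large
  first index. Each row of the result is thus a finite combination of rows of \<open>f\<close> with
  power series coefficients in y.\<close>

lemma fps_act_taylor:
  assumes f: "bounded2 f" and M: "\<And>i n. i \<ge> M \<Longrightarrow> f (m + int i) n = 0"
  shows "fps_act t g e f m n = (\<Sum>i<M. t (e ^ i) (xmul t (fps_hasse i g) (f (m + int i)) n))"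
proof -
  obtain K where K: "vanish_above f m n K" using f by (auto simp: bounded2_def)
  have K0: "f (m + int i) (n + int j) = 0" if "K \<le> i + j" for i j
    using K that by (simp add: vanish_above_def)
  let ?F = "\<lambda>i j. t (fps_nth g (i + j) * of_nat (i + j choose i) * e ^ i) (f (m + int i) (n + int j))"
  have "fps_act t g e f m n = (\<Sum>r<K. \<Sum>i\<le>r. ?F i (r - i))"
    by (auto simp: fps_act_sum[OF K order_refl] shift2_pow_sum scale_sum_right mult_ac intro!: sum.cong)
  also have "\<dots> = (\<Sum>(i, j)\<in>{(i, j). i + j < K}. ?F i j)"
    by (subst sum.triangle_reindex) simp
  also have "\<dots> = (\<Sum>(i, j)\<in>{..<K + M} \<times> {..<K}. ?F i j)"
    by (rule sum.mono_neutral_left) (auto, metis K0 not_less)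
  also have "\<dots> = (\<Sum>i<K + M. \<Sum>j<K. ?F i j)" by (simp add: sum.cartesian_product)
  also have "\<dots> = (\<Sum>i<M. \<Sum>j<K. ?F i j)"
    by (rule sum.mono_neutral_right) (auto simp: M not_less)
  also have "\<dots> = (\<Sum>i<M. t (e ^ i) (xmul t (fps_hasse i g) (f (m + int i)) n))"
  proof (intro sum.cong refl)
    fix i
    have "xmul t (fps_hasse i g) (f (m + int i)) n = (\<Sum>j<K. t (fps_nth (fps_hasse i g) j) (f (m + int i) (n + int j)))"
      unfolding xmul_def by (rule Sum_any_lessThan) (use K0 in auto)
    then show "(\<Sum>j<K. ?F i j) = t (e ^ i) (xmul t (fps_hasse i g) (f (m + int i)) n)"
      by (simp add: fps_hasse_def scale_sum_right mult_ac)
  qed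
  finally show ?thesis .
qed

lemma zbin_shift2: "zbin k f m n = (shift2 t 1 ^^ k) f m n"
proof (induction k arbitrary: m n)
  case (Suc k)
  then show ?case by (simp add: shift2_def add.commute)
qed simp

lemma shift2_pow_top:
  assumes "\<And>m' n. m' > m \<Longrightarrow> f m' n = 0"
  shows "(shift2 t e ^^ k) f m n = f m (n + int k)"
proof -
  have "(shift2 t e ^^ k) f m n = (\<Sum>i\<in>{0}. t (of_nat (k choose i) * e ^ i) (f (m + int i) (n + int (k - i))))"
    unfolding shift2_pow_sum by (rule sum.mono_neutral_right) (auto simp: assms)
  then show ?thesis by simp
qed

text \<open>Cancels \<open>(y + e x)^k\<close>: for families truncated in the first index the
  topmost row sees only \<open>y^k\<close>.\<close>

lemma shift2_pow_inj:
  assumes eq: "\<And>m n. (shift2 t e ^^ k) f m n = (shift2 t e ^^ k) g m n"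
    and f: "\<And>m n. m \<ge> M \<Longrightarrow> f m n = 0" and g: "\<And>m n. m \<ge> M' \<Longrightarrow> g m n = 0"
  shows "f m n = g m n"
proof -
  let ?d = "\<lambda>m n. f m n - g m n"
  let ?M = "max M M'"
  have "\<forall>m n. m \<ge> ?M - int i \<longrightarrow> ?d m n = 0" for i
  proof (induction i)
    case (Suc i)
    show ?case
    proof (intro allI impI)
      fix m n assume m: "m \<ge> ?M - int (Suc i)"
      have "?d m (n - int k + int k) = (shift2 t e ^^ k) ?d m (n - int k)"
        by (rule shift2_pow_top[symmetric]) (use Suc m in auto)
      also have "\<dots> = 0" by (simp only: shift2_pow_diff eq) simp
      finally show "?d m n = 0" by simp
    qed
  qed (use f g in auto)
  moreover have "m \<ge> ?M - int (nat (?M - m))" by linarith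
  ultimately have "?d m n = 0" by blast
  then show ?thesis by simp
qed

text \<open>The recursion multiplies by \<open>x1 - x2\<close>, while \<open>shift2\<close> with
  \<open>e = -1\<close> multiplies by \<open>x2 - x1\<close>; hence the sign.\<close>

lemma shift2_pow_rec:
  assumes "\<And>l p q. T (l + 1) p q = T l (p + 1) q - T l p (q + 1)"
  shows "(shift2 t (- 1) ^^ k) (T l) p q = t ((- 1) ^ k) (T (l + int k) p q)"
proof (induction k arbitrary: p q)
  case (Suc k)
  have 1: "T (l + int (Suc k)) p q = T (l + int k) (p + 1) q - T (l + int k) p (q + 1)"
    using assms[of "l + int k" p q] by (simp add: add_ac)
  have 2: "(shift2 t (- 1) ^^ k) (T l) = (\<lambda>p q. t ((- 1) ^ k) (T (l + int k) p q))"
    by (intro ext Suc)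
  show ?case
    by (simp only: funpow.simps o_apply 1 2) (simp add: shift2_def scale_right_diff_distrib)
qed simp

end

section \<open>The adjoint case W = V: creation, the operator D, and the second Jacobi term\<close>

locale VAh =
  fixes h :: "complex fps" and s :: "complex \<Rightarrow> 'v::ab_group_add \<Rightarrow> 'v" and a :: "gen \<Rightarrow> int \<Rightarrow> 'v \<Rightarrow> 'v"
    and vac :: 'v
  assumes h: "h * (h oo (- fps_X)) = 1" and V: "is_VAh h s a vac"

sublocale VAh \<subseteq> VAh_pair h s a vac s a
proof -
  interpret V: Ah_module s a h by (rule VAh_Ah_module[OF h V])
  show "VAh_pair h s a vac s a" by unfold_locales (rule h, rule V)
qed

context VAh
begin

text \<open>The vacuum has level 0, so associativity with generators on it holds without any factor,
  and the property passes along generation.\<close>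

lemma Y_creation: "Y u (-1) vac = u" and Y_creation_0: "n \<ge> 0 \<Longrightarrow> Y u n vac = 0"
proof -
  have lev: "a g n vac = 0" if "n \<ge> int (glev 0 g)" for g n
    by (rule VAh_vac[OF V]) (use that in \<open>simp add: glev_def\<close>)
  have eq: "Y (a g m u) q vac = twist s (\<lambda>N j. a g N (Y u j vac)) m 0 q" for g m u q
  proof -
    have "twist s (\<lambda>N j. a g N (Y u j vac)) m (int 0) q = zbin 0 (\<lambda>j n. Y (a g j u) n vac) m q"
      by (rule Y_assoc_gen[OF lev]) (simp_all add: glev_def)
    then show ?thesis by simp
  qed
  have "(\<forall>n\<ge>0. Y u n vac = 0) \<and> Y u (-1) vac = u"
    using V
  proof (induction u rule: VAh_induct)
    case vac
    show ?case by (simp add: Y_vac)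
  next
    case (op g m u)
    have z: "a g N (Y u j vac) = 0" if "j \<ge> 0" for N j using op that by simp
    have "Y (a g m u) n vac = 0" if "n \<ge> 0" for n
      unfolding eq by (rule W.twist_eq_0[of 0]) (use z that in auto)
    moreover have "Y (a g m u) (-1) vac = a g m u"
      unfolding eq by (subst W.twist_sum[of 0 _ _ 1]) (use z op in auto)
    ultimately show ?case by blast
  qed (simp_all add: Y_add1 Y_scale1)
  then show "Y u (-1) vac = u" "n \<ge> 0 \<Longrightarrow> Y u n vac = 0" by auto
qed

text \<open>\<open>dpow j u\<close> is \<open>D^j u / j!\<close>.\<close>

definition "dpow j u = Y u (- 1 - int j) vac"

lemma dpow_op: "dpow c (a g n u) = (\<Sum>i\<le>c. s (bdiff n i) (a g (n - int i) (dpow (c - i) u)))"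
proof -
  have lev: "a g n vac = 0" if "n \<ge> int (glev 0 g)" for g n
    by (rule VAh_vac[OF V]) (use that in \<open>simp add: glev_def\<close>)
  have "twist s (\<lambda>N j. a g N (Y u j vac)) n (int 0) (- 1 - int c) = zbin 0 (\<lambda>j n. Y (a g j u) n vac) n (- 1 - int c)"
    by (rule Y_assoc_gen[OF lev]) (simp_all add: glev_def)
  then have "dpow c (a g n u) = twist s (\<lambda>N j. a g N (Y u j vac)) n 0 (- 1 - int c)"
    by (simp add: dpow_def)
  also have "\<dots> = (\<Sum>i<Suc c. s (bdiff n i) (a g (0 + n - int i) (Y u (- 1 - int c + int i) vac)))"
    by (rule W.twist_sum[of 0]) (auto simp: Y_creation_0)
  also have "\<dots> = (\<Sum>i\<le>c. s (bdiff n i) (a g (n - int i) (dpow (c - i) u)))"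
    by (auto simp: lessThan_Suc_atMost dpow_def of_nat_diff algebra_simps intro!: sum.cong)
  finally show ?thesis .
qed

lemma dpow_linear: "dpow j (x + y) = dpow j x + dpow j y" "dpow j (s r x) = s r (dpow j x)" "dpow j 0 = 0"
  by (simp_all add: dpow_def Y_add1 Y_scale1)

lemma dpow_sum: "dpow j (sum f A) = (\<Sum>k\<in>A. dpow j (f k))"
  by (simp add: dpow_def Y_sum1)

lemma bdiff_neg_neg: "bdiff (- 1 - int j) i = of_nat (i + j choose j)"
proof -
  have "bdiff (- 1 - int j) i = (of_int (int (i + j)) gchoose i)"
  proof -
    have "- 1 - int j = int i - int (i + j) - 1" by simp
    then show ?thesis by (simp only: bdiff_neg)
  qed
  also have "\<dots> = of_nat (i + j choose i)" by (simp only: of_int_of_nat_eq binomial_gbinomial)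
  also have "(i + j choose i) = (i + j choose j)"
    using binomial_symmetric[of i "i + j"] by simp
  finally show ?thesis .
qed

end

context VAh_pair
begin

lemma Y_V_creation: "YV u (-1) vac = u" and Y_V_creation_0: "n \<ge> 0 \<Longrightarrow> YV u n vac = 0"
proof -
  interpret VV: VAh h s a vac by unfold_locales (rule h, rule V)
  show "YV u (-1) vac = u" "n \<ge> 0 \<Longrightarrow> YV u n vac = 0"
    using VV.Y_creation VV.Y_creation_0 by auto
qed

text \<open>The D-derivative property: \<open>Y(D^j u / j!, x)\<close> is the divided derivative of
  \<open>Y(u, x)\<close>. Weak associativity with \<open>v = vac\<close> gives a triangular system
  for these operators, solved by induction on j.\<close>

lemma Y_dpow: "Y (YV u (- 1 - int j) vac) n w = t (bdiff n j) (Y u (n - int j) w)"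
proof (induction j arbitrary: n rule: less_induct)
  case (less j)
  obtain P where P: "\<And>p l q. p \<ge> P \<Longrightarrow> prodc u vac w l p q = iterc u vac w l p q"
    using prodc_iterc by blast
  \<comment> \<open>Large enough for associativity, and larger than \<open>n\<close>, so that the
    exponent \<open>n - p\<close> is negative and the sum over \<open>i\<close> reaches the one
    nonzero mode of \<open>vac\<close>, at \<open>i0\<close>.\<close>
  define p where "p = max P (n + 1)"
  define i0 where "i0 = nat (p - n - 1)"
  have i0: "n - p = - 1 - int i0" unfolding i0_def p_def by linarith
  let ?x = "Y u (n - int j) w"
  have vz: "Y vac k w = 0" if "k \<ge> 0" for k using that by (simp add: Y_vac)
  have "prodc u vac w (- 1 - int j) p (n - p)
    = (\<Sum>i<Suc i0. t (bdiff (- 1 - int j) i) (Y u (p + (- 1 - int j) - int i) (Y vac (n - p + int i) w)))"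
    by (rule prodc_sum[of 0]) (use vz i0 in auto)
  also have "\<dots> = (\<Sum>i<i0. 0) + t (bdiff (- 1 - int j) i0) ?x"
  proof -
    have e: "p + (- 1 - int j) - int i0 = n - int j" "n - p + int i0 = -1" using i0 by auto
    have e': "(\<Sum>i<i0. t (bdiff (- 1 - int j) i) (Y u (p + (- 1 - int j) - int i) (Y vac (n - p + int i) w))) = 0"
      by (rule sum.neutral) (auto simp: Y_vac i0)
    show ?thesis unfolding sum.lessThan_Suc e e' by (simp add: Y_vac)
  qed
  finally have A: "prodc u vac w (- 1 - int j) p (n - p) = t (bdiff (- 1 - int j) i0) ?x" by simp
  have "iterc u vac w (- 1 - int j) p (n - p)
    = (\<Sum>i<Suc j. t (of_int p gchoose i) (Y (YV u (- 1 - int j + int i) vac) (p + (n - p) - int i) w))"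
    by (rule iterc_sum[of 0]) (auto simp: Y_V_creation_0)
  also have "\<dots> = Y (YV u (- 1 - int j) vac) n w
      + (\<Sum>i<j. t (of_int p gchoose (Suc i)) (Y (YV u (- 1 - int (j - Suc i)) vac) (n - int (Suc i)) w))"
    by (subst sum.lessThan_Suc_shift) (auto simp: of_nat_diff algebra_simps intro!: sum.cong)
  also have "(\<Sum>i<j. t (of_int p gchoose (Suc i)) (Y (YV u (- 1 - int (j - Suc i)) vac) (n - int (Suc i)) w))
    = t (\<Sum>i<j. (of_int p gchoose (Suc i)) * bdiff (n - int (Suc i)) (j - Suc i)) ?x"
    unfolding W.scale_sum_left
  proof (intro sum.cong refl)
    fix i assume i: "i \<in> {..<j}"
    have "Y (YV u (- 1 - int (j - Suc i)) vac) (n - int (Suc i)) w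
      = t (bdiff (n - int (Suc i)) (j - Suc i)) (Y u (n - int (Suc i) - int (j - Suc i)) w)"
      by (rule less) (use i in auto)
    also have "n - int (Suc i) - int (j - Suc i) = n - int j" using i by (simp add: of_nat_diff)
    finally show "t (of_int p gchoose (Suc i)) (Y (YV u (- 1 - int (j - Suc i)) vac) (n - int (Suc i)) w)
      = t ((of_int p gchoose (Suc i)) * bdiff (n - int (Suc i)) (j - Suc i)) ?x"
      by (simp only: W.scale_scale)
  qed
  also have "(\<Sum>i<j. (of_int p gchoose (Suc i)) * bdiff (n - int (Suc i)) (j - Suc i))
    = (- 1) ^ j * (of_int (n - p) gchoose j) - bdiff n j"
  proof -
    let ?f = "\<lambda>i. (of_int p gchoose i) * bdiff (n - int i) (j - i)"
    have "(\<Sum>i\<le>j. ?f i) = ?f 0 + (\<Sum>i<j. ?f (Suc i))"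
      unfolding lessThan_Suc_atMost[symmetric] by (rule sum.lessThan_Suc_shift)
    then show ?thesis
      unfolding gbinomial_alternating_Vandermonde by (simp add: algebra_simps)
  qed
  also have "(- 1) ^ j * (of_int (n - p) gchoose j) = bdiff (- 1 - int j) i0"
  proof -
    interpret VV: VAh h s a vac by unfold_locales (rule h, rule V)
    have "(- 1) ^ j * (of_int (n - p) gchoose j) = bdiff (- 1 - int i0) j"
      by (simp add: bdiff_def i0)
    then show ?thesis
      using binomial_symmetric[of i0 "i0 + j"] by (simp add: VV.bdiff_neg_neg add.commute)
  qed
  finally have "iterc u vac w (- 1 - int j) p (n - p) = Y (YV u (- 1 - int j) vac) n w
     + t (bdiff (- 1 - int j) i0 - bdiff n j) ?x" .
  with A P[of p] show ?case
    by (simp add: p_def W.scale_left_diff_distrib)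
qed

end

context VAh
begin

lemma Y_dpow': "Y (dpow j u) n w = s (bdiff n j) (Y u (n - int j) w)"
  unfolding dpow_def by (rule Y_dpow)

lemma dpow_dpow: "dpow j (dpow i u) = s (of_nat (i + j choose j)) (dpow (i + j) u)"
proof -
  have "dpow j (dpow i u) = s (bdiff (- 1 - int j) i) (Y u (- 1 - int j - int i) vac)"
    using Y_dpow'[of i u "- 1 - int j" vac] by (simp add: dpow_def)
  moreover have "- 1 - int j - int i = - 1 - int (i + j)" by simp
  ultimately show ?thesis by (simp only: bdiff_neg_neg dpow_def)
qed

text \<open>The coefficients of \<open>exp(x D) \<tau>(-x)\<close>.\<close>

definition "eop \<tau> n = Sum_any (\<lambda>j. s ((- 1) powi (n + int j + 1)) (dpow j (\<tau> (n + int j))))"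

abbreviation "opp u v \<equiv> eop (\<lambda>n. Y u n v)"

lemma eop_sum:
  assumes "\<And>k. k \<ge> N \<Longrightarrow> \<tau> k = 0" "N \<le> n + int K"
  shows "eop \<tau> n = (\<Sum>j<K. s ((- 1) powi (n + int j + 1)) (dpow j (\<tau> (n + int j))))"
  unfolding eop_def by (rule Sum_any_lessThan) (use assms in \<open>auto simp: dpow_linear\<close>)

lemma eop_eq_0: "(\<And>k. k \<ge> N \<Longrightarrow> \<tau> k = 0) \<Longrightarrow> n \<ge> N \<Longrightarrow> eop \<tau> n = 0"
  using eop_sum[of N \<tau> n 0] by simp

lemma eop_add:
  assumes "\<And>k. k \<ge> N \<Longrightarrow> \<tau> k = 0" "\<And>k. k \<ge> N' \<Longrightarrow> \<tau>' k = 0"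
  shows "eop (\<lambda>n. \<tau> n + \<tau>' n) n = eop \<tau> n + eop \<tau>' n"
proof -
  define K where "K = nat (max N N' - n)"
  have K: "max N N' \<le> n + int K" unfolding K_def by linarith
  have z: "\<tau> k = 0" "\<tau>' k = 0" if "k \<ge> max N N'" for k using assms that by auto
  have "eop x n = (\<Sum>j<K. s ((- 1) powi (n + int j + 1)) (dpow j (x (n + int j))))"
    if "x \<in> {\<tau>, \<tau>', \<lambda>n. \<tau> n + \<tau>' n}" for x
    by (rule eop_sum[OF _ K]) (use z that in auto)
  then show ?thesis by (simp add: dpow_linear W.scale_right_distrib sum.distrib)
qed

lemma eop_scale: "eop (\<lambda>n. s r (\<tau> n)) n = s r (eop \<tau> n)" if "\<And>k. k \<ge> N \<Longrightarrow> \<tau> k = 0"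
proof -
  have K: "N \<le> n + int (nat (N - n))" by linarith
  have "eop x n = (\<Sum>j<nat (N - n). s ((- 1) powi (n + int j + 1)) (dpow j (x (n + int j))))"
    if "x \<in> {\<tau>, \<lambda>n. s r (\<tau> n)}" for x
    by (rule eop_sum[OF _ K]) (use that \<open>\<And>k. k \<ge> N \<Longrightarrow> \<tau> k = 0\<close> in auto)
  then show ?thesis by (simp add: dpow_linear W.scale_sum_right mult.commute)
qed

text \<open>Multiplication by x inside \<open>\<tau>(-x)\<close> is multiplication by -x
  outside.\<close>

lemma eop_shift: "eop (\<lambda>n. \<tau> (n + 1)) n = - eop \<tau> (n + 1)"
proof -
  have sg: "(- 1 :: complex) powi (n + 1 + int j + 1) = - ((- 1) powi (n + int j + 1))" for j
    using power_int_add[of "-1 :: complex" "n + int j + 1" 1] by (simp add: add_ac)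
  have "eop (\<lambda>n. \<tau> (n + 1)) n = Sum_any (\<lambda>j. - (s ((- 1) powi (n + 1 + int j + 1)) (dpow j (\<tau> (n + 1 + int j)))))"
    unfolding eop_def sg by (simp add: add_ac)
  also have "\<dots> = - eop \<tau> (n + 1)"
    by (simp add: eop_def Sum_any.expand_set sum_negf)
  finally show ?thesis .
qed

text \<open>\<open>exp(x D) a(z) = a(z + x) exp(x D)\<close>, and its inverse form \<open>a(z) exp(x D) = exp(x D) a(z - x)\<close>.\<close>

lemma eop_op:
  assumes \<tau>: "\<And>k. k \<ge> N \<Longrightarrow> \<tau> k = 0"
  shows "eop (\<lambda>n. a g m (\<tau> n)) n = twist s (\<lambda>M j. a g M (eop \<tau> j)) m 0 n"
proof -
  define K where "K = nat (N - n)"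
  have K: "N \<le> n + int K" unfolding K_def by linarith
  let ?\<sigma> = "\<lambda>j. (- 1 :: complex) powi (n + int j + 1)"
  have "eop (\<lambda>n. a g m (\<tau> n)) n = (\<Sum>j<K. \<Sum>i\<le>j. s (?\<sigma> j * bdiff m i) (a g (m - int i) (dpow (j - i) (\<tau> (n + int j)))))"
    by (subst eop_sum[OF _ K]) (simp_all add: \<tau> dpow_op W.scale_sum_right)
  also have "\<dots> = (\<Sum>(i, j)\<in>{(i, j). i + j < K}. s (?\<sigma> (i + j) * bdiff m i) (a g (m - int i) (dpow j (\<tau> (n + int (i + j))))))"
    by (subst sum.triangle_reindex) (auto intro!: sum.cong)
  also have "\<dots> = (\<Sum>(i, j)\<in>{..<K} \<times> {..<K}. s (?\<sigma> (i + j) * bdiff m i) (a g (m - int i) (dpow j (\<tau> (n + int (i + j))))))"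
  proof (rule sum.mono_neutral_left)
    have "\<tau> (n + int (i + j)) = 0" if "K \<le> i + j" for i j by (rule \<tau>) (use that K in linarith)
    then show "\<forall>ij\<in>{..<K} \<times> {..<K} - {(i, j). i + j < K}. (case ij of (i, j) \<Rightarrow>
        s (?\<sigma> (i + j) * bdiff m i) (a g (m - int i) (dpow j (\<tau> (n + int (i + j)))))) = 0"
      by (auto simp del: of_nat_add simp: dpow_linear) (metis W.b_0 dpow_linear(3) not_less)
  qed auto
  also have "\<dots> = (\<Sum>i<K. s (bdiff m i) (a g (m - int i) (eop \<tau> (n + int i))))"
  proof -
    have "eop \<tau> (n + int i) = (\<Sum>j<K. s (?\<sigma> (i + j)) (dpow j (\<tau> (n + int (i + j)))))" for i
    proof -
      have "N \<le> n + int i + int K" using K by linarith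
      from eop_sum[OF \<tau> this] show ?thesis by (simp add: add_ac)
    qed
    then show ?thesis
      by (simp add: W.b_sum W.b_scale W.scale_sum_right sum.cartesian_product mult.commute)
  qed
  also have "\<dots> = twist s (\<lambda>M j. a g M (eop \<tau> j)) m 0 n"
    by (subst W.twist_sum[OF _ K]) (simp_all add: eop_eq_0[OF \<tau>])
  finally show ?thesis .
qed

lemma eop_shift_pow: "eop (\<lambda>q. \<tau> (q + int i)) n = s ((- 1) ^ i) (eop \<tau> (n + int i))"
proof (induction i arbitrary: n)
  case (Suc i)
  have "eop (\<lambda>q. \<tau> (q + int (Suc i))) n = eop (\<lambda>q. (\<lambda>q. \<tau> (q + int i)) (q + 1)) n"
    by (simp add: add_ac)
  also have "\<dots> = - s ((- 1) ^ i) (eop \<tau> (n + 1 + int i))"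
    by (subst eop_shift) (simp only: Suc)
  finally show ?case by (simp add: add_ac)
qed simp

lemma eop_lincomb:
  assumes f: "\<And>i k. k \<ge> N \<Longrightarrow> f i k = 0"
    and \<tau>: "\<And>q. q \<ge> n \<Longrightarrow> \<tau> q = (\<Sum>i<K. s (c i) (f i q))"
  shows "eop \<tau> n = (\<Sum>i<K. s (c i) (eop (f i) n))"
proof -
  define J where "J = nat (N - n)"
  have J: "N \<le> n + int J" unfolding J_def by linarith
  have "eop \<tau> n = (\<Sum>j<J. s ((- 1) powi (n + int j + 1)) (dpow j (\<tau> (n + int j))))"
    unfolding eop_def by (rule Sum_any_lessThan) (use J in \<open>auto simp: \<tau> f dpow_linear\<close>)
  also have "\<dots> = (\<Sum>i<K. s (c i) (\<Sum>j<J. s ((- 1) powi (n + int j + 1)) (dpow j (f i (n + int j)))))"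
    by (simp add: \<tau> dpow_sum dpow_linear W.scale_sum_right mult.commute)
      (subst sum.swap, simp add: mult.commute)
  also have "\<dots> = (\<Sum>i<K. s (c i) (eop (f i) n))"
    by (subst eop_sum[OF f J]) simp_all
  finally show ?thesis .
qed

text \<open>Expanding the right-hand side by \<open>eop_op\<close> composes the translations by x
  and by -x; \<open>inv\<close> says that their coefficients combine to the identity.\<close>

lemma op_eop:
  assumes \<tau>: "\<And>k. k \<ge> N \<Longrightarrow> \<tau> k = 0"
  shows "a g m (eop \<tau> n) = eop (\<lambda>q. twist s (\<lambda>M j. a g M (\<tau> j)) m 0 q) n"
proof -
  define K where "K = Suc (nat (N - n))"
  have K: "N \<le> n + int K" unfolding K_def by linarith
  let ?A = "\<lambda>r. a g (m - int r) (eop \<tau> (n + int r))"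
  have A0: "?A r = 0" if "K \<le> r" for r
    using eop_eq_0[of N \<tau> "n + int r", OF \<tau>] that K by simp
  have inv: "(\<Sum>i\<le>r. (- 1) ^ i * bdiff m i * bdiff (m - int i) (r - i)) = (if r = 0 then 1 else 0)" for r
  proof -
    have "(\<Sum>i\<le>r. (- 1) ^ i * bdiff m i * bdiff (m - int i) (r - i))
      = (\<Sum>i\<le>r. (of_int m gchoose i) * bdiff (m - int i) (r - i))"
      by (intro sum.cong refl) (simp add: bdiff_def mult_ac flip: power_mult_distrib)
    also have "\<dots> = (- 1) ^ r * (of_int (m - m) gchoose r)"
      by (rule gbinomial_alternating_Vandermonde)
    finally show ?thesis by (simp add: gbinomial_0_left)
  qed
  have "eop (\<lambda>q. twist s (\<lambda>M j. a g M (\<tau> j)) m 0 q) n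
    = (\<Sum>i<K. s (bdiff m i) (eop (\<lambda>q. a g (m - int i) (\<tau> (q + int i))) n))"
  proof (rule eop_lincomb[of N])
    show "a g (m - int i) (\<tau> (k + int i)) = 0" if "k \<ge> N" for i k using that by (simp add: \<tau>)
    show "twist s (\<lambda>M j. a g M (\<tau> j)) m 0 q = (\<Sum>i<K. s (bdiff m i) (a g (m - int i) (\<tau> (q + int i))))"
      if "q \<ge> n" for q
      by (subst W.twist_sum[of N _ _ K]) (use \<tau> K that in auto)
  qed
  also have "\<dots> = (\<Sum>i<K. s (bdiff m i * (- 1) ^ i) (twist s (\<lambda>M j. a g M (eop \<tau> j)) (m - int i) 0 (n + int i)))"
  proof (intro sum.cong refl)
    fix i
    have "eop (\<lambda>q. a g (m - int i) (\<tau> (q + int i))) n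
      = s ((- 1) ^ i) (twist s (\<lambda>M j. a g M (eop \<tau> j)) (m - int i) 0 (n + int i))"
      using eop_shift_pow[of "\<lambda>q. a g (m - int i) (\<tau> q)" i n] eop_op[OF \<tau>, where m = "m - int i"] by simp
    then show "s (bdiff m i) (eop (\<lambda>q. a g (m - int i) (\<tau> (q + int i))) n)
      = s (bdiff m i * (- 1) ^ i) (twist s (\<lambda>M j. a g M (eop \<tau> j)) (m - int i) 0 (n + int i))" by simp
  qed
  also have "\<dots> = (\<Sum>i<K. \<Sum>j<K. s ((- 1) ^ i * bdiff m i * bdiff (m - int i) j) (?A (i + j)))"
  proof (intro sum.cong refl)
    fix i
    have "twist s (\<lambda>M j. a g M (eop \<tau> j)) (m - int i) 0 (n + int i)
      = (\<Sum>j<K. s (bdiff (m - int i) j) (a g (0 + (m - int i) - int j) (eop \<tau> (n + int i + int j))))"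
      by (rule W.twist_sum[of N]) (use K eop_eq_0[of N \<tau>, OF \<tau>] in auto)
    then show "s (bdiff m i * (- 1) ^ i) (twist s (\<lambda>M j. a g M (eop \<tau> j)) (m - int i) 0 (n + int i))
      = (\<Sum>j<K. s ((- 1) ^ i * bdiff m i * bdiff (m - int i) j) (?A (i + j)))"
      by (simp add: W.scale_sum_right mult_ac algebra_simps)
  qed
  also have "\<dots> = (\<Sum>(i, j)\<in>{..<K} \<times> {..<K}. s ((- 1) ^ i * bdiff m i * bdiff (m - int i) j) (?A (i + j)))"
    by (rule sum.cartesian_product)
  also have "\<dots> = (\<Sum>(i, j)\<in>{(i, j). i + j < K}. s ((- 1) ^ i * bdiff m i * bdiff (m - int i) j) (?A (i + j)))"
  proof (rule sum.mono_neutral_right)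
    show "\<forall>ij\<in>{..<K} \<times> {..<K} - {(i, j). i + j < K}. (case ij of (i, j) \<Rightarrow>
        s ((- 1) ^ i * bdiff m i * bdiff (m - int i) j) (?A (i + j))) = 0"
      using A0 by (auto simp del: of_nat_add) (metis not_less)
  qed auto
  also have "\<dots> = (\<Sum>r<K. s (\<Sum>i\<le>r. (- 1) ^ i * bdiff m i * bdiff (m - int i) (r - i)) (?A r))"
    by (subst sum.triangle_reindex) (auto simp: W.scale_sum_left intro!: sum.cong)
  also have "\<dots> = a g m (eop \<tau> n)"
    unfolding inv K_def by (subst sum.lessThan_Suc_shift) simp
  finally show ?thesis ..
qed


text \<open>\<open>opposite f x y w l p q\<close> is the second term of the Jacobi identity for a datum \<open>x \<otimes> y \<otimes> f\<close>.\<close>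

definition "opposite f x y w l p q =
  s ((- 1) powi l) (Sum_any (\<lambda>k. s (fps_nth f k) (prodc x y w (l + int k) q p)))"

text \<open>Finiteness in k of the second Jacobi term: for the finitely many \<open>i < I\<close>
  the outer mode index grows with k.\<close>

lemma prodc_far:
  "\<exists>K0. \<forall>k\<ge>K0. \<forall>i. Y x (q + l + int k - int i) (Y y (p + int i) w) = 0 \<or> I \<le> i"
proof -
  have "\<exists>N. \<forall>i\<in>{..<I}. \<forall>n\<ge>N. Y x n (Y y (p + int i) w) = 0"
    by (rule ex_uniform_bound) (auto intro: Y_trunc)
  then obtain N where N: "\<And>i n. i < I \<Longrightarrow> n \<ge> N \<Longrightarrow> Y x n (Y y (p + int i) w) = 0" by auto
  have "Y x (q + l + int k - int i) (Y y (p + int i) w) = 0 \<or> I \<le> i" if "k \<ge> nat (N - q - l + int I)" for k i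
  proof (cases "i < I")
    case True
    with that have "q + l + int k - int i \<ge> N" by linarith
    with True show ?thesis by (simp add: N)
  qed simp
  then show ?thesis by blast
qed

lemma opposite_sum:
  "\<exists>K0. \<forall>K\<ge>K0. opposite f x y w l p q
    = s ((- 1) powi l) (\<Sum>k<K. s (fps_nth f k) (prodc x y w (l + int k) q p))"
proof -
  obtain L where L: "\<And>j. j \<ge> L \<Longrightarrow> Y y j w = 0" using Y_trunc by blast
  define I where "I = nat (L - p)"
  have I: "L \<le> p + int I" unfolding I_def by linarith
  obtain K0 where K0: "\<And>k i. k \<ge> K0 \<Longrightarrow> Y x (q + l + int k - int i) (Y y (p + int i) w) = 0 \<or> I \<le> i"
    using prodc_far by blast
  have "prodc x y w (l + int k) q p = 0" if k: "k \<ge> K0" for k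
  proof -
    have "prodc x y w (l + int k) q p
      = (\<Sum>i<I. s (bdiff (l + int k) i) (Y x (q + (l + int k) - int i) (Y y (p + int i) w)))"
      by (rule prodc_sum[OF L I])
    also have "\<dots> = 0"
    proof (intro sum.neutral ballI)
      fix i assume "i \<in> {..<I}"
      then show "s (bdiff (l + int k) i) (Y x (q + (l + int k) - int i) (Y y (p + int i) w)) = 0"
        using K0[OF k, of i] by (auto simp: add.assoc)
    qed
    finally show ?thesis .
  qed
  then have "\<forall>K\<ge>K0. opposite f x y w l p q
    = s ((- 1) powi l) (\<Sum>k<K. s (fps_nth f k) (prodc x y w (l + int k) q p))"
    unfolding opposite_def by (intro allI impI arg_cong2[where f = s] refl Sum_any_lessThan) auto
  then show ?thesis ..
qed

text \<open>The signs of f(-x0) and of the delta function combine to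
  \<open>(-1)^k (-1)^(l + k) = (-1)^l\<close>. Only nonnegative k occur, as f is a power
  series.\<close>

lemma jacobi_2_eq: "jacobi_2 s Y (fps_to_fls f) x y l p q w = opposite f x y w l p q"
proof -
  obtain L where L: "\<And>j. j \<ge> L \<Longrightarrow> Y y j w = 0" using Y_trunc by blast
  define I where "I = nat (L - p)"
  have I: "L \<le> p + int I" unfolding I_def by linarith
  obtain K0 where K0: "\<And>k i. k \<ge> K0 \<Longrightarrow> Y x (q + l + int k - int i) (Y y (p + int i) w) = 0 \<or> I \<le> i"
    using prodc_far by blast
  obtain K1 where K1: "\<And>K. K \<ge> K1 \<Longrightarrow> opposite f x y w l p q
    = s ((- 1) powi l) (\<Sum>k<K. s (fps_nth f k) (prodc x y w (l + int k) q p))"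
    using opposite_sum by blast
  define K where "K = max K0 K1"
  let ?g = "\<lambda>(k::int, i::nat). s (fls_nth (fps_to_fls f) k * (- 1) powi k * (- 1) powi (l + k) * bdiff (l + k) i)
        (Y x (q + (l + k) - int i) (Y y (p + int i) w))"
  have "jacobi_2 s Y (fps_to_fls f) x y l p q w = sum ?g (int ` {..<K} \<times> {..<I})"
    unfolding jacobi_2_def
  proof (rule Sum_any.expand_superset)
    show "{ki. ?g ki \<noteq> 0} \<subseteq> int ` {..<K} \<times> {..<I}"
    proof (clarsimp simp del: fps_to_fls_nth)
      fix k :: int and i :: nat
      assume 1: "fls_nth (fps_to_fls f) k \<noteq> 0" and 2: "Y x (q + (l + k) - int i) (Y y (p + int i) w) \<noteq> 0"
      have k: "k = int (nat k)" using 1 by (cases "k < 0") auto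
      have i: "i < I"
      proof (rule ccontr)
        assume "\<not> i < I"
        then have "Y y (p + int i) w = 0" using I by (intro L) linarith
        then show False using 2 by simp
      qed
      have "q + (l + k) = q + l + int (nat k)" using k by simp
      have "nat k < K0"
      proof (rule ccontr)
        assume "\<not> nat k < K0"
        then have "Y x (q + l + int (nat k) - int i) (Y y (p + int i) w) = 0 \<or> I \<le> i"
          by (intro K0) simp
        then show False using i 2 \<open>q + (l + k) = q + l + int (nat k)\<close> by (simp only:) linarith
      qed
      then show "k \<in> int ` {..<K} \<and> i < I" using k i by (auto simp: K_def intro!: image_eqI[of _ _ "nat k"])
    qed
  qed simp
  also have "\<dots> = (\<Sum>k<K. \<Sum>i<I. ?g (int k, i))"
    by (simp add: sum.cartesian_product[symmetric] sum.reindex)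
  also have "\<dots> = (\<Sum>k<K. s ((- 1) powi l) (s (fps_nth f k) (prodc x y w (l + int k) q p)))"
  proof (intro sum.cong refl)
    fix k
    have "prodc x y w (l + int k) q p
      = (\<Sum>i<I. s (bdiff (l + int k) i) (Y x (q + (l + int k) - int i) (Y y (p + int i) w)))"
      by (rule prodc_sum[OF L I])
    moreover have "fls_nth (fps_to_fls f) (int k) * (- 1) powi int k * (- 1) powi (l + int k) * c = (- 1) powi l * fps_nth f k * c" for c
    proof -
      have "(- 1 :: complex) powi int k * (- 1) powi (l + int k) = (- 1) powi l"
        by (simp add: power_int_add mult_ac flip: power_mult_distrib)
      from this[symmetric] show ?thesis by (simp add: mult_ac)
    qed
    ultimately show "(\<Sum>i<I. ?g (int k, i)) = s ((- 1) powi l) (s (fps_nth f k) (prodc x y w (l + int k) q p))"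
      by (simp only: prod.case W.scale_sum_right W.scale_scale mult.assoc)
  qed
  also have "\<dots> = opposite f x y w l p q"
    by (subst K1) (simp_all add: K_def W.scale_sum_right)
  finally show ?thesis .
qed

text \<open>The exchanged product obeys the recursion for \<open>x2 - x1\<close>; the factor
  \<open>(-1)^l\<close> restores the one for \<open>x1 - x2\<close>.\<close>

lemma opposite_rec: "opposite f x y w (l + 1) p q = opposite f x y w l (p + 1) q - opposite f x y w l p (q + 1)"
proof -
  obtain K1 where K1: "\<And>K. K \<ge> K1 \<Longrightarrow> opposite f x y w (l + 1) p q
      = s ((- 1) powi (l + 1)) (\<Sum>k<K. s (fps_nth f k) (prodc x y w (l + 1 + int k) q p))"
    using opposite_sum by blast
  obtain K2 where K2: "\<And>K. K \<ge> K2 \<Longrightarrow> opposite f x y w l (p + 1) q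
      = s ((- 1) powi l) (\<Sum>k<K. s (fps_nth f k) (prodc x y w (l + int k) q (p + 1)))"
    using opposite_sum by blast
  obtain K3 where K3: "\<And>K. K \<ge> K3 \<Longrightarrow> opposite f x y w l p (q + 1)
      = s ((- 1) powi l) (\<Sum>k<K. s (fps_nth f k) (prodc x y w (l + int k) (q + 1) p))"
    using opposite_sum by blast
  note e = K1[of "K1 + K2 + K3"] K2[of "K1 + K2 + K3"] K3[of "K1 + K2 + K3"]
  have "prodc x y w (l + 1 + int k) q p = prodc x y w (l + int k) (q + 1) p - prodc x y w (l + int k) q (p + 1)" for k
    using prodc_rec[of x y w "l + int k" q p] by (simp add: add_ac)
  moreover have "(- 1 :: complex) powi (l + 1) = - ((- 1) powi l)"
    by (simp add: power_int_add)
  ultimately show ?thesis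
    using e by (simp add: W.scale_right_diff_distrib sum_subtractf)
qed

lemma opposite_eq_0: "(\<And>j. j \<ge> L \<Longrightarrow> Y y j w = 0) \<Longrightarrow> p \<ge> L \<Longrightarrow> opposite f x y w l p q = 0"
proof -
  assume "\<And>j. j \<ge> L \<Longrightarrow> Y y j w = 0" "p \<ge> L"
  then have "prodc x y w (l + int k) q p = 0" for k by (rule prodc_eq_0)
  then show ?thesis by (simp add: opposite_def)
qed

text \<open>Data \<open>(f\<^sub>i, x\<^sub>i, y\<^sub>i)\<close> with \<open>exp(x D) Y(u, -x) v = \<Sum> f\<^sub>i(x) Y(x\<^sub>i, x) y\<^sub>i\<close>.\<close>

definition "dsum ds n = (\<Sum>(f, x, y)\<leftarrow>ds. xmul s f (\<lambda>n. Y x n y) n)"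

definition "skew u v ds \<longleftrightarrow> (\<forall>n. opp u v n = dsum ds n)"

text \<open>Associativity with x1 and x2 exchanged turns each datum into an iterate at -x0 and x1.
  Skew symmetry sums these to \<open>Y(exp(-x0 D) Y(u, x0) v, x1)\<close>, and
  \<open>Y_dpow'\<close> replaces x1 by x1 - x0 = x2.\<close>

lemma opposite_iterc:
  assumes sk: "skew u v ds"
    and as: "\<And>f x y l p. (f, x, y) \<in> set ds \<Longrightarrow> prodc x y w l q p = iterc x y w l q p"
  shows "(\<Sum>(f, x, y)\<leftarrow>ds. opposite f x y w l p q) = - iterc u v w l p q"
proof -
  obtain M where M: "\<And>j. j \<ge> M \<Longrightarrow> Y u j v = 0" using Y_trunc by blast
  have "\<exists>N. \<forall>d\<in>set ds. \<forall>n\<ge>N. (case d of (f, x, y) \<Rightarrow> Y x n y = 0)"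
    by (rule ex_uniform_bound) (auto intro: Y_trunc)
  then obtain N where N: "\<And>f x y n. (f, x, y) \<in> set ds \<Longrightarrow> n \<ge> N \<Longrightarrow> Y x n y = 0" by fastforce
  define K where "K = nat (max M N - l)"
  have K: "M \<le> l + int K" "N \<le> l + int K" unfolding K_def by linarith+
  let ?c = "\<lambda>i. (of_int q gchoose i) :: complex"
  have opp: "opposite f x y w l p q
    = s ((- 1) powi l) (\<Sum>i<K. s (?c i) (Y (xmul s f (\<lambda>n. Y x n y) (l + int i)) (p + q - int i) w))"
    if d: "(f, x, y) \<in> set ds" for f x y
  proof -
    have z: "Y x (l + int (i + k)) y = 0" if "K \<le> i + k" for i k
      by (rule N[OF d]) (use that K in linarith)
    have it: "iterc x y w (l + int k) q p
        = (\<Sum>i<K. s (?c i) (Y (Y x (l + int k + int i) y) (q + p - int i) w))" for k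
      by (rule iterc_sum[OF N[OF d]]) (use K in auto)
    have "Sum_any (\<lambda>k. s (fps_nth f k) (prodc x y w (l + int k) q p))
      = (\<Sum>k<K. s (fps_nth f k) (prodc x y w (l + int k) q p))"
    proof (rule Sum_any_lessThan)
      fix k assume k: "K \<le> k"
      have "iterc x y w (l + int k) q p = 0"
        by (rule iterc_eq_0[OF N[OF d]]) (use k K in auto)
      then show "s (fps_nth f k) (prodc x y w (l + int k) q p) = 0" by (simp add: as[OF d])
    qed
    also have "\<dots> = (\<Sum>k<K. \<Sum>i<K. s (fps_nth f k * ?c i) (Y (Y x (l + int (i + k)) y) (p + q - int i) w))"
      by (simp add: as[OF d] it W.scale_sum_right add_ac)
    also have "\<dots> = (\<Sum>i<K. s (?c i) (Y (xmul s f (\<lambda>n. Y x n y) (l + int i)) (p + q - int i) w))"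
    proof (subst sum.swap, intro sum.cong refl)
      fix i
      have "xmul s f (\<lambda>n. Y x n y) (l + int i) = (\<Sum>k<K. s (fps_nth f k) (Y x (l + int i + int k) y))"
        by (rule W.xmul_sum[OF N[OF d]]) (use K in auto)
      then show "(\<Sum>k<K. s (fps_nth f k * ?c i) (Y (Y x (l + int (i + k)) y) (p + q - int i) w))
        = s (?c i) (Y (xmul s f (\<lambda>n. Y x n y) (l + int i)) (p + q - int i) w)"
        by (simp add: Y_sum1 Y_scale1 W.scale_sum_right mult.commute add.assoc)
    qed
    finally show ?thesis by (simp add: opposite_def)
  qed
  have "(\<Sum>(f, x, y)\<leftarrow>ds. opposite f x y w l p q)
    = (\<Sum>(f, x, y)\<leftarrow>ds. s ((- 1) powi l) (\<Sum>i<K. s (?c i) (Y (xmul s f (\<lambda>n. Y x n y) (l + int i)) (p + q - int i) w)))"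
    by (rule arg_cong[where f = sum_list], rule map_cong[OF refl]) (auto simp: opp)
  also have "\<dots> = s ((- 1) powi l) (\<Sum>i<K. s (?c i) (Y (dsum ds (l + int i)) (p + q - int i) w))"
    unfolding dsum_def
    by (induction ds) (auto simp: Y_add1 W.scale_right_distrib sum.distrib)
  also have "\<dots> = s ((- 1) powi l) (\<Sum>i<K. s (?c i) (Y (opp u v (l + int i)) (p + q - int i) w))"
    using sk by (simp add: skew_def)
  also have "\<dots> = (\<Sum>i<K. \<Sum>j<K. s (?c i * (- 1) powi l * (- 1) powi (l + int i + int j + 1) * bdiff (p + q - int i) j)
      (Y (Y u (l + int (i + j)) v) (p + q - int (i + j)) w))"
  proof -
    have "Y (opp u v (l + int i)) (p + q - int i) w
      = (\<Sum>j<K. s ((- 1) powi (l + int i + int j + 1) * bdiff (p + q - int i) j)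
         (Y (Y u (l + int (i + j)) v) (p + q - int (i + j)) w))" for i
    proof -
      have "opp u v (l + int i) = (\<Sum>j<K. s ((- 1) powi (l + int i + int j + 1)) (dpow j (Y u (l + int i + int j) v)))"
        by (rule eop_sum[OF M]) (use K in auto)
      then show ?thesis by (simp add: Y_sum1 Y_scale1 Y_dpow' add.assoc diff_diff_eq)
    qed
    then show ?thesis by (simp add: W.scale_sum_right mult_ac)
  qed
  also have "\<dots> = (\<Sum>(i, j)\<in>{..<K} \<times> {..<K}. s (- ((- 1) ^ (i + j)) * ?c i * bdiff (p + q - int i) j)
      (Y (Y u (l + int (i + j)) v) (p + q - int (i + j)) w))"
  proof -
    have "(- 1 :: complex) powi l * (- 1) powi (l + int i + int j + 1) = - ((- 1) ^ (i + j))" for i j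
    proof -
      have "(- 1 :: complex) powi (l + int i + int j + 1) = (- 1) powi l * (- 1) ^ (i + j) * (- 1)"
        by (simp add: power_int_add power_add)
      moreover have "(- 1 :: complex) powi l * (- 1) powi l = 1"
        by (simp flip: power_int_mult_distrib)
      ultimately show ?thesis by (simp flip: mult.assoc)
    qed
    then show ?thesis by (simp add: sum.cartesian_product mult_ac)
  qed
  also have "\<dots> = (\<Sum>(i, j)\<in>{(i, j). i + j < K}. s (- ((- 1) ^ (i + j)) * ?c i * bdiff (p + q - int i) j)
      (Y (Y u (l + int (i + j)) v) (p + q - int (i + j)) w))"
  proof (rule sum.mono_neutral_right)
    have "Y u (l + int (i + j)) v = 0" if "K \<le> i + j" for i j by (rule M) (use that K in linarith)
    then have "Y (Y u (l + int (i + j)) v) n w = 0" if "\<not> i + j < K" for i j n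
      using that by (simp add: not_less)
    then show "\<forall>ij\<in>{..<K} \<times> {..<K} - {(i, j). i + j < K}. (case ij of (i, j) \<Rightarrow>
       s (- ((- 1) ^ (i + j)) * ?c i * bdiff (p + q - int i) j) (Y (Y u (l + int (i + j)) v) (p + q - int (i + j)) w)) = 0"
      by (auto simp del: of_nat_add) blast
  qed auto
  also have "\<dots> = (\<Sum>r<K. \<Sum>i\<le>r. s (- ((- 1) ^ r) * ((?c i) * bdiff (p + q - int i) (r - i)))
      (Y (Y u (l + int r) v) (p + q - int r) w))"
    by (subst sum.triangle_reindex) (auto intro!: sum.cong simp: mult.assoc)
  also have "\<dots> = (\<Sum>r<K. s (- (of_int p gchoose r)) (Y (Y u (l + int r) v) (p + q - int r) w))"
  proof (intro sum.cong refl)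
    fix r
    \<comment> \<open>The binomials of \<open>q\<close> from the iterate and of \<open>p + q\<close>
      from D combine to the binomial of \<open>p\<close> required by \<open>iterc\<close>.\<close>
    have "- ((- 1) ^ r) * (\<Sum>i\<le>r. (?c i) * bdiff (p + q - int i) (r - i)) = - (of_int p gchoose r)"
      unfolding gbinomial_alternating_Vandermonde by (simp flip: mult.assoc power_mult_distrib)
    then show "(\<Sum>i\<le>r. s (- ((- 1) ^ r) * ((?c i) * bdiff (p + q - int i) (r - i))) (Y (Y u (l + int r) v) (p + q - int r) w))
      = s (- (of_int p gchoose r)) (Y (Y u (l + int r) v) (p + q - int r) w)"
      by (simp only: flip: W.scale_sum_left sum_distrib_left)
  qed
  also have "\<dots> = - iterc u v w l p q"
    by (subst iterc_sum[OF M K(1)]) (auto simp: sum_negf)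
  finally show ?thesis .
qed

text \<open>All three terms of the Jacobi identity satisfy the recursion expressing \<open>x\<^sub>0 = x\<^sub>1 - x\<^sub>2\<close>, so it
  suffices to verify it for large \<open>p\<close>, where the second term vanishes, and for large \<open>q\<close>, where the
  first one does.\<close>

theorem jacobi:
  assumes sk: "skew u v ds"
  shows "prodc u v w l p q - (\<Sum>(f, x, y)\<leftarrow>ds. opposite f x y w l p q) = iterc u v w l p q"
proof -
  define J where "J l p q = prodc u v w l p q - (\<Sum>(f, x, y)\<leftarrow>ds. opposite f x y w l p q) - iterc u v w l p q" for l p q
  have J_rec: "J (l + 1) p q = J l (p + 1) q - J l p (q + 1)" for l p q
  proof -
    have "(\<Sum>(f, x, y)\<leftarrow>ds. opposite f x y w (l + 1) p q)
      = (\<Sum>(f, x, y)\<leftarrow>ds. opposite f x y w l (p + 1) q) - (\<Sum>(f, x, y)\<leftarrow>ds. opposite f x y w l p (q + 1))"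
      by (induction ds) (auto simp: opposite_rec)
    then show ?thesis by (simp add: J_def prodc_rec iterc_rec)
  qed
  obtain P0 where P0: "\<And>p l q. p \<ge> P0 \<Longrightarrow> prodc u v w l p q = iterc u v w l p q" using prodc_iterc by blast
  have "\<exists>N. \<forall>d\<in>set ds. \<forall>n\<ge>N. (case d of (f, x, y) \<Rightarrow> Y y n w = 0)"
    by (rule ex_uniform_bound) (auto intro: Y_trunc)
  then obtain N where N: "\<And>f x y n. (f, x, y) \<in> set ds \<Longrightarrow> n \<ge> N \<Longrightarrow> Y y n w = 0" by fastforce
  have JP: "J l p q = 0" if "p \<ge> max P0 N" for l p q
  proof -
    have "(\<Sum>(f, x, y)\<leftarrow>ds. opposite f x y w l p q) = 0"
    proof -
      have "opposite f x y w l p q = 0" if "(f, x, y) \<in> set ds" for f x y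
        by (rule opposite_eq_0[OF N[OF that]]) (use \<open>p \<ge> max P0 N\<close> in auto)
      then have "map (\<lambda>(f, x, y). opposite f x y w l p q) ds = map (\<lambda>_. 0) ds" by auto
      then show ?thesis by (simp only: sum_list_0)
    qed
    then show ?thesis using P0 that by (simp add: J_def)
  qed
  obtain L where L: "\<And>j. j \<ge> L \<Longrightarrow> Y v j w = 0" using Y_trunc by blast
  have "\<exists>Q. \<forall>d\<in>set ds. \<forall>q\<ge>Q. (case d of (f, x, y) \<Rightarrow> \<forall>l p. prodc x y w l q p = iterc x y w l q p)"
    by (rule ex_uniform_bound) (auto intro: prodc_iterc)
  then obtain Q where Q: "\<And>f x y q l p. (f, x, y) \<in> set ds \<Longrightarrow> q \<ge> Q \<Longrightarrow> prodc x y w l q p = iterc x y w l q p"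
    by fastforce
  have JQ: "J l p q = 0" if "q \<ge> max L Q" for l p q
    using opposite_iterc[OF sk, of w q l p] Q that by (simp add: J_def prodc_eq_0[OF L])
  \<comment> \<open>If p + q is large, one of p and q is. Read as
    \<open>J l p q = J (l - 1) (p + 1) q - J (l - 1) p (q + 1)\<close>, the recursion lowers the
    bound on p + q one by one.\<close>
  have "\<forall>l p q. p + q \<ge> max P0 N + max L Q - int i \<longrightarrow> J l p q = 0" for i
  proof (induction i)
    case 0
    show ?case
    proof (intro allI impI)
      fix l p q assume "p + q \<ge> max P0 N + max L Q - int 0"
      then have "p \<ge> max P0 N \<or> q \<ge> max L Q" by linarith
      then show "J l p q = 0" using JP JQ by blast
    qed
  next
    case (Suc i)
    show ?case
    proof (intro allI impI)
      fix l p q assume "p + q \<ge> max P0 N + max L Q - int (Suc i)"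
      then have "J (l - 1) (p + 1) q = 0" "J (l - 1) p (q + 1) = 0"
        using Suc by (simp_all add: algebra_simps)
      then show "J l p q = 0" using J_rec[of "l - 1" p q] by simp
    qed
  qed
  moreover have "p + q \<ge> max P0 N + max L Q - int (nat (max P0 N + max L Q - (p + q)))" by linarith
  ultimately have "J l p q = 0" by blast
  then show ?thesis by (simp add: J_def)
qed

end

text \<open>The module over power series in x generated by \<open>B\<close>. The inductive form
  gives closure for free; explicit lists of data are recovered only at the end.\<close>

inductive_set xspan :: "(complex \<Rightarrow> 'w \<Rightarrow> 'w) \<Rightarrow> (int \<Rightarrow> 'w::ab_group_add) set \<Rightarrow> (int \<Rightarrow> 'w) set" for t B where
  xspan_base: "\<tau> \<in> B \<Longrightarrow> \<tau> \<in> xspan t B"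
| xspan_zero: "(\<lambda>_. 0) \<in> xspan t B"
| xspan_add: "\<tau> \<in> xspan t B \<Longrightarrow> \<tau>' \<in> xspan t B \<Longrightarrow> (\<lambda>n. \<tau> n + \<tau>' n) \<in> xspan t B"
| xspan_xmul: "\<tau> \<in> xspan t B \<Longrightarrow> xmul t f \<tau> \<in> xspan t B"

text \<open>A series in \<open>z\<close>, bounded below, with coefficients in \<open>xspan t B\<close>.\<close>

definition xfamily where
  "xfamily t B \<Gamma> \<longleftrightarrow> (\<forall>m. \<Gamma> m \<in> xspan t B) \<and> (\<exists>M. \<forall>m\<ge>M. \<forall>n. \<Gamma> m n = 0) \<and> bounded2 \<Gamma>"

context cspace
begin

lemma xspan_scale: "\<tau> \<in> xspan t B \<Longrightarrow> (\<lambda>n. t r (\<tau> n)) \<in> xspan t B"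
  using xspan_xmul[of \<tau> t B "fps_const r"] by (simp add: xmul_const[abs_def])

lemma xspan_trunc:
  assumes "\<tau> \<in> xspan t B" "\<And>\<tau>. \<tau> \<in> B \<Longrightarrow> \<exists>N. \<forall>n\<ge>N. \<tau> n = 0"
  shows "\<exists>N. \<forall>n\<ge>N. \<tau> n = 0"
  using assms(1)
proof induction
  case (xspan_add \<tau> \<tau>')
  then obtain N N' where "\<forall>n\<ge>N. \<tau> n = 0" "\<forall>n\<ge>N'. \<tau>' n = 0" by blast
  then have "\<forall>n\<ge>max N N'. \<tau> n + \<tau>' n = 0" by simp
  then show ?case ..
next
  case (xspan_xmul \<tau> f)
  then obtain N where N: "\<And>n. n \<ge> N \<Longrightarrow> \<tau> n = 0" by blast
  have "xmul t f \<tau> n = 0" if "n \<ge> N" for n by (rule xmul_eq_0[OF N that])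
  then show ?case by blast
qed (use assms(2) in auto)

lemma xspan_lincomb:
  assumes "\<And>i. i < M \<Longrightarrow> f i \<in> xspan t B"
  shows "(\<lambda>n. \<Sum>i<(M::nat). t (c i) (f i n)) \<in> xspan t B"
  using assms
proof (induction M)
  case 0
  show ?case by (simp add: xspan_zero)
next
  case (Suc M)
  then show ?case by (simp add: xspan_add xspan_scale)
qed

lemma
  assumes "xfamily t B f"
  shows xfamily_xspan: "f m \<in> xspan t B" and xfamily_top: "\<exists>M. \<forall>m\<ge>M. \<forall>n. f m n = 0"
    and xfamily_bounded2: "bounded2 f" and xfamily_vanish: "\<exists>N. vanish_above f m n N"
  using assms by (simp_all add: xfamily_def bounded2_def)

lemma xfamily_zero: "xfamily t B (\<lambda>_ _. 0)"
  by (simp add: xfamily_def xspan_zero bounded2_def vanish_above_def)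

lemma xfamily_add:
  assumes "xfamily t B f" "xfamily t B g"
  shows "xfamily t B (\<lambda>m n. f m n + g m n)"
proof -
  obtain M M' where "\<forall>m\<ge>M. \<forall>n. f m n = 0" "\<forall>m\<ge>M'. \<forall>n. g m n = 0"
    using assms[THEN xfamily_top] by blast
  then have "\<forall>m\<ge>max M M'. \<forall>n. f m n + g m n = 0" by simp
  moreover have "bounded2 (\<lambda>m n. f m n + g m n)"
    unfolding bounded2_def
  proof (intro allI)
    fix m n
    obtain N N' where "vanish_above f m n N" "vanish_above g m n N'"
      using assms[THEN xfamily_vanish] by blast
    then have "vanish_above (\<lambda>m n. f m n + g m n) m n (max N N')" by (simp add: vanish_above_def)
    then show "\<exists>N. vanish_above (\<lambda>m n. f m n + g m n) m n N" ..
  qed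
  ultimately show ?thesis using assms[THEN xfamily_xspan] xspan_add unfolding xfamily_def by blast
qed

lemma xfamily_xmul:
  assumes "xfamily t B f"
  shows "xfamily t B (\<lambda>m. xmul t g (f m))"
proof -
  obtain M where M: "\<And>m n. m \<ge> M \<Longrightarrow> f m n = 0" using xfamily_top[OF assms] by blast
  have "\<forall>m\<ge>M. \<forall>n. xmul t g (f m) n = 0" by (simp add: xmul_def M)
  moreover have "bounded2 (\<lambda>m. xmul t g (f m))"
    unfolding bounded2_def
  proof (intro allI)
    fix m n
    obtain N where N: "vanish_above f m n N" using xfamily_vanish[OF assms] by blast
    have "xmul t g (f (m + int i)) (n + int j) = 0" if "N \<le> i + j" for i j
    proof -
      have "f (m + int i) (n + int j + int k) = 0" for k
      proof -
        have "N \<le> i + (j + k)" using that by simp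
        then have "f (m + int i) (n + int (j + k)) = 0" using N unfolding vanish_above_def by blast
        then show ?thesis by (simp add: add.assoc)
      qed
      then show ?thesis by (simp add: xmul_def)
    qed
    then show "\<exists>N. vanish_above (\<lambda>m. xmul t g (f m)) m n N" by (auto simp: vanish_above_def)
  qed
  ultimately show ?thesis using assms by (auto simp: xfamily_def intro: xspan_xmul)
qed

text \<open>By \<open>fps_act_taylor\<close>; the bound on the first index keeps the combination of
  rows finite, so the row stays in the span.\<close>

lemma xfamily_fps_act:
  assumes "xfamily t B f"
  shows "fps_act t g e f m \<in> xspan t B"
proof -
  obtain M where M: "\<And>m n. m \<ge> M \<Longrightarrow> f m n = 0" using xfamily_top[OF assms] by blast
  have "f (m + int i) n = 0" if "i \<ge> nat (M - m)" for i n by (rule M) (use that in linarith)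
  then have "fps_act t g e f m n = (\<Sum>i<nat (M - m). t (e ^ i) (xmul t (fps_hasse i g) (f (m + int i)) n))" for n
    using assms by (intro fps_act_taylor) (auto simp: xfamily_def)
  then have "fps_act t g e f m = (\<lambda>n. \<Sum>i<nat (M - m). t (e ^ i) (xmul t (fps_hasse i g) (f (m + int i)) n))"
    by blast
  moreover have "\<dots> \<in> xspan t B"
    using assms by (intro xspan_lincomb xspan_xmul) (auto simp: xfamily_def)
  ultimately show ?thesis by simp
qed

lemma shift2_pow_eq_up:
  assumes "\<And>m n. (shift2 t e ^^ k) f m n = (shift2 t e ^^ k) g m n" "k \<le> k'"
  shows "(shift2 t e ^^ k') f m n = (shift2 t e ^^ k') g m n"
proof -
  have "(shift2 t e ^^ k) f = (shift2 t e ^^ k) g" using assms(1) by blast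
  moreover have "k' = (k' - k) + k" using assms(2) by simp
  ultimately show ?thesis by (metis funpow_add o_apply)
qed

lemma bounded2I':
  assumes "\<And>m n. n \<ge> N \<Longrightarrow> f m n = 0" "\<And>n. \<exists>J. \<forall>m\<ge>J. \<forall>k\<ge>n. f m k = 0"
  shows "bounded2 f"
proof -
  have "bounded2 (\<lambda>n m. f m n)"
    by (rule bounded2I[of N]) (use assms in \<open>auto, meson\<close>)
  then show ?thesis
    unfolding bounded2_def vanish_above_def by (metis add.commute)
qed

text \<open>An operation \<open>\<Phi>\<close> raising \<open>xspan t B\<close> to two variables takes values in families from \<open>xspan t B\<close>,
  up to a factor \<open>(x + e z)^k\<close>, if it does so on \<open>B\<close>.\<close>

lemma xspan_local:
  assumes \<tau>: "\<tau> \<in> xspan t B"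
    and B: "\<And>\<tau>. \<tau> \<in> B \<Longrightarrow> \<exists>N. \<forall>n\<ge>N. \<tau> n = 0"
    and base: "\<And>\<tau>. \<tau> \<in> B \<Longrightarrow>
      \<exists>\<Gamma> k. xfamily t B \<Gamma> \<and> (\<forall>m n. (shift2 t e ^^ k) (\<Phi> \<tau>) m n = (shift2 t e ^^ k) \<Gamma> m n)"
    and zero: "\<And>m n. \<Phi> (\<lambda>_. 0) m n = 0"
    and add: "\<And>\<tau> \<tau>' N N' m n. (\<And>n. n \<ge> N \<Longrightarrow> \<tau> n = 0) \<Longrightarrow> (\<And>n. n \<ge> N' \<Longrightarrow> \<tau>' n = 0) \<Longrightarrow>
      \<Phi> (\<lambda>n. \<tau> n + \<tau>' n) m n = \<Phi> \<tau> m n + \<Phi> \<tau>' m n"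
    and xmul: "\<And>f \<tau> N m n. (\<And>n. n \<ge> N \<Longrightarrow> \<tau> n = 0) \<Longrightarrow> \<Phi> (xmul t f \<tau>) m n = xmul t f (\<Phi> \<tau> m) n"
    and bnd: "\<And>\<tau> N. (\<And>n. n \<ge> N \<Longrightarrow> \<tau> n = 0) \<Longrightarrow> bounded2 (\<Phi> \<tau>)"
  shows "\<exists>\<Gamma> k. xfamily t B \<Gamma> \<and> (\<forall>m n. (shift2 t e ^^ k) (\<Phi> \<tau>) m n = (shift2 t e ^^ k) \<Gamma> m n)"
  using \<tau>
proof induction
  case xspan_zero
  have "\<forall>m n. (shift2 t e ^^ 0) (\<Phi> (\<lambda>_. 0)) m n = (shift2 t e ^^ 0) (\<lambda>_ _. 0) m n" by (simp add: zero)
  then show ?case using xfamily_zero by blast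
next
  case (xspan_add \<tau> \<tau>')
  from xspan_add obtain f k where f: "xfamily t B f" "\<And>m n. (shift2 t e ^^ k) (\<Phi> \<tau>) m n = (shift2 t e ^^ k) f m n"
    by blast
  from xspan_add obtain f' k' where f': "xfamily t B f'" "\<And>m n. (shift2 t e ^^ k') (\<Phi> \<tau>') m n = (shift2 t e ^^ k') f' m n"
    by blast
  obtain N N' where "\<And>n. n \<ge> N \<Longrightarrow> \<tau> n = 0" "\<And>n. n \<ge> N' \<Longrightarrow> \<tau>' n = 0"
    using xspan_trunc[OF xspan_add.hyps(1) B] xspan_trunc[OF xspan_add.hyps(2) B] by metis
  then have "\<Phi> (\<lambda>n. \<tau> n + \<tau>' n) m n = \<Phi> \<tau> m n + \<Phi> \<tau>' m n" for m n by (rule add)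
  then have "\<Phi> (\<lambda>n. \<tau> n + \<tau>' n) = (\<lambda>m n. \<Phi> \<tau> m n + \<Phi> \<tau>' m n)" by blast
  then have "(shift2 t e ^^ (k + k')) (\<Phi> (\<lambda>n. \<tau> n + \<tau>' n)) m n = (shift2 t e ^^ (k + k')) (\<lambda>m n. f m n + f' m n) m n" for m n
    using shift2_pow_eq_up[OF f(2), of "k + k'" m n] shift2_pow_eq_up[OF f'(2), of "k + k'" m n]
    by (simp add: shift2_pow_add)
  then show ?case using xfamily_add[OF f(1) f'(1)] by blast
next
  case (xspan_xmul \<tau> g)
  then obtain f k where f: "xfamily t B f" "\<And>m n. (shift2 t e ^^ k) (\<Phi> \<tau>) m n = (shift2 t e ^^ k) f m n"
    by blast
  obtain N where N: "\<And>n. n \<ge> N \<Longrightarrow> \<tau> n = 0" using xspan_trunc[OF xspan_xmul.hyps B] by blast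
  have "\<Phi> (xmul t g \<tau>) m n = xmul t g (\<Phi> \<tau> m) n" for m n by (rule xmul[OF N])
  then have 1: "\<Phi> (xmul t g \<tau>) = (\<lambda>m. xmul t g (\<Phi> \<tau> m))" by blast
  have "(shift2 t e ^^ k) (\<Phi> (xmul t g \<tau>)) m n = (shift2 t e ^^ k) (\<lambda>m. xmul t g (f m)) m n" for m n
  proof -
    have "(shift2 t e ^^ k) (\<Phi> (xmul t g \<tau>)) m n = xmul t g (\<lambda>n. (shift2 t e ^^ k) (\<Phi> \<tau>) m n) n"
      unfolding 1 by (rule xmul_shift2_pow[OF bnd[OF N]])
    also have "\<dots> = xmul t g (\<lambda>n. (shift2 t e ^^ k) f m n) n" by (simp only: f(2))
    also have "\<dots> = (shift2 t e ^^ k) (\<lambda>m. xmul t g (f m)) m n"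
      by (rule xmul_shift2_pow[symmetric]) (use f(1) in \<open>simp add: xfamily_def\<close>)
    finally show ?thesis .
  qed
  then show ?case using xfamily_xmul[OF f(1)] by blast
qed (rule base)

end

context VAh
begin

text \<open>\<open>SD\<close> consists of the admissible right-hand sides \<open>\<Sum> f\<^sub>i(x) Y(x\<^sub>i, x) y\<^sub>i\<close> of skew symmetry.\<close>

definition "modes = {\<lambda>n. Y x n y |x y. True}"

abbreviation "SD \<equiv> xspan s modes"

lemma modes_trunc: "\<tau> \<in> modes \<Longrightarrow> \<exists>N. \<forall>n\<ge>N. \<tau> n = 0"
  using Y_trunc by (auto simp: modes_def)

lemma modes_Y: "(\<lambda>n. Y x n y) \<in> SD"
  by (rule xspan_base) (auto simp: modes_def)

lemma dsum_trunc: "\<exists>N. \<forall>n\<ge>N. dsum ds n = 0"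
proof (induction ds)
  case Nil
  show ?case by (simp add: dsum_def)
next
  case (Cons d ds)
  obtain f x y where d: "d = (f, x, y)" by (cases d)
  obtain N where N: "\<And>n. n \<ge> N \<Longrightarrow> Y x n y = 0" using Y_trunc by blast
  obtain N' where N': "\<And>n. n \<ge> N' \<Longrightarrow> dsum ds n = 0" using Cons by blast
  have "dsum (d # ds) n = 0" if "n \<ge> max N N'" for n
    using W.xmul_eq_0[of N "\<lambda>n. Y x n y" n f] N N'[of n] that by (simp add: dsum_def d)
  then show ?case by blast
qed

lemma SD_dsum: "\<tau> \<in> SD \<Longrightarrow> \<exists>ds. \<tau> = dsum ds"
proof (induction rule: xspan.induct)
  case (xspan_base \<tau>)
  then obtain x y where "\<tau> = (\<lambda>n. Y x n y)" by (auto simp: modes_def)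
  then have "\<tau> = dsum [(1, x, y)]" by (simp add: dsum_def[abs_def] W.xmul_one)
  then show ?case ..
next
  case xspan_zero
  have "(\<lambda>_. 0) = dsum []" by (simp add: dsum_def[abs_def])
  then show ?case ..
next
  case (xspan_add \<tau> \<tau>')
  then obtain ds ds' where "\<tau> = dsum ds" "\<tau>' = dsum ds'" by blast
  then have "(\<lambda>n. \<tau> n + \<tau>' n) = dsum (ds @ ds')" by (simp add: dsum_def[abs_def])
  then show ?case ..
next
  case (xspan_xmul \<tau> g)
  then obtain ds where ds: "\<tau> = dsum ds" by blast
  have "xmul s g (dsum ds) n = dsum (map (\<lambda>(f, x, y). (g * f, x, y)) ds) n" for n
  proof (induction ds)
    case Nil
    show ?case by (simp add: dsum_def[abs_def] xmul_def)
  next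
    case (Cons d ds)
    obtain f x y where d: "d = (f, x, y)" by (cases d)
    obtain N where N: "\<And>n. n \<ge> N \<Longrightarrow> Y x n y = 0" using Y_trunc by blast
    obtain N' where N': "\<And>n. n \<ge> N' \<Longrightarrow> dsum ds n = 0" using dsum_trunc by blast
    have "dsum (d # ds) = (\<lambda>n. xmul s f (\<lambda>n. Y x n y) n + dsum ds n)"
      by (simp add: dsum_def[abs_def] d)
    then have "xmul s g (dsum (d # ds)) n = xmul s g (xmul s f (\<lambda>n. Y x n y)) n + xmul s g (dsum ds) n"
      using W.xmul_add[OF W.xmul_eq_0[OF N] N', where f = g and n = n] by simp
    also have "xmul s g (xmul s f (\<lambda>n. Y x n y)) n = xmul s (g * f) (\<lambda>n. Y x n y) n"
      by (rule W.xmul_mult[OF N])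
    finally show ?case using Cons by (simp add: d dsum_def)
  qed
  then have "xmul s g \<tau> = dsum (map (\<lambda>(f, x, y). (g * f, x, y)) ds)" unfolding ds by blast
  then show ?case ..
qed

lemma SD_imp_skew:
  assumes "opp u v \<in> SD"
  shows "\<exists>ds. skew u v ds"
proof -
  obtain ds where ds: "opp u v = dsum ds" using SD_dsum[OF assms] by blast
  have "skew u v ds" unfolding skew_def ds by simp
  then show ?thesis ..
qed

text \<open>\<open>exp(xD) Y(u,-x) 1 = exp(xD) exp(-xD) u = u\<close>, in coefficients the vanishing
  of alternating binomial sums.\<close>

lemma opp_vac_right: "opp u vac n = Y vac n u"
proof (cases "n \<ge> 0")
  case True
  have "opp u vac n = 0" by (rule eop_eq_0[of 0]) (use True in \<open>auto simp: Y_creation_0\<close>)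
  then show ?thesis using True by (simp add: Y_vac)
next
  case False
  define c where "c = nat (- 1 - n)"
  have n: "n = - 1 - int c" using False by (simp add: c_def)
  have "opp u vac n = (\<Sum>j<Suc c. s ((- 1) powi (n + int j + 1)) (dpow j (Y u (n + int j) vac)))"
    by (rule eop_sum[of 0]) (auto simp: Y_creation_0 n)
  also have "\<dots> = (\<Sum>j\<le>c. s ((- 1) ^ c * ((- 1) ^ j * of_nat (c choose j))) (dpow c u))"
    unfolding lessThan_Suc_atMost
  proof (intro sum.cong refl)
    fix j assume "j \<in> {..c}"
    then have j: "j \<le> c" by simp
    have e: "n + int j = - 1 - int (c - j)" using j by (simp add: n of_nat_diff)
    have "(- 1 :: complex) powi (n + int j + 1) = (- 1) ^ c * (- 1) ^ j"
    proof -
      have "n + int j + 1 = int j - int c" by (simp add: n)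
      then show ?thesis by (simp only: power_int_diff) (simp add: minus_one_power_iff)
    qed
    moreover have "dpow j (Y u (n + int j) vac) = s (of_nat (c choose j)) (dpow c u)"
      using dpow_dpow[of j "c - j" u] j unfolding e dpow_def[of "c - j", symmetric] by simp
    ultimately show "s ((- 1) powi (n + int j + 1)) (dpow j (Y u (n + int j) vac))
      = s ((- 1) ^ c * ((- 1) ^ j * of_nat (c choose j))) (dpow c u)" by (simp add: mult.assoc)
  qed
  also have "\<dots> = s ((- 1) ^ c * (\<Sum>j\<le>c. (- 1) ^ j * of_nat (c choose j))) (dpow c u)"
    by (simp add: sum_distrib_left flip: W.scale_sum_left)
  also have "\<dots> = Y vac n u"
  proof (cases "c = 0")
    case True
    then show ?thesis by (simp add: n Y_vac dpow_def Y_creation)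
  next
    case False
    then have "(\<Sum>j\<le>c. (- 1) ^ j * of_nat (c choose j) :: complex) = 0"
      using choose_alternating_sum[of c, where 'a = complex] by simp
    then show ?thesis using False by (simp add: n Y_vac)
  qed
  finally show ?thesis .
qed

text \<open>\<open>exp(xD) v = Y(v,x) 1\<close> by the definition of D.\<close>

lemma opp_vac_left: "opp vac v n = Y v n vac"
proof (cases "n \<ge> 0")
  case True
  have "opp vac v n = 0" by (rule eop_eq_0[of 0]) (use True in \<open>auto simp: Y_vac\<close>)
  then show ?thesis using True by (simp add: Y_creation_0)
next
  case False
  define c where "c = nat (- 1 - n)"
  have n: "n = - 1 - int c" using False by (simp add: c_def)
  have "opp vac v n = (\<Sum>j<Suc c. s ((- 1) powi (n + int j + 1)) (dpow j (Y vac (n + int j) v)))"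
    by (rule eop_sum[of 0]) (auto simp: Y_vac n)
  also have "\<dots> = dpow c v"
  proof -
    have "(\<Sum>j<c. s ((- 1) powi (n + int j + 1)) (dpow j (Y vac (n + int j) v))) = 0"
      by (rule sum.neutral) (auto simp: n Y_vac dpow_linear)
    then show ?thesis by (simp add: n Y_vac)
  qed
  finally show ?thesis by (simp add: dpow_def n)
qed

text \<open>Substituting -x for x turns x - z into -(x + z).\<close>

lemma eop_shift2_pow:
  assumes "\<And>m n. n \<ge> N \<Longrightarrow> f m n = 0"
  shows "eop ((shift2 s (- 1) ^^ r) f m) n = s ((- 1) ^ r) ((shift2 s 1 ^^ r) (\<lambda>m. eop (f m)) m n)"
proof -
  have "eop ((shift2 s (- 1) ^^ r) f m) n
    = (\<Sum>i<Suc r. s (of_nat (r choose i) * (- 1) ^ i) (eop (\<lambda>q. f (m + int i) (q + int (r - i))) n))"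
  proof (rule eop_lincomb[of N])
    show "f (m + int i) (k + int (r - i)) = 0" if "k \<ge> N" for i k using that by (simp add: assms)
  qed (simp add: W.shift2_pow_sum lessThan_Suc_atMost)
  also have "\<dots> = (\<Sum>i\<le>r. s ((- 1) ^ r) (s (of_nat (r choose i)) (eop (f (m + int i)) (n + int (r - i)))))"
    unfolding lessThan_Suc_atMost
  proof (intro sum.cong refl)
    fix i assume "i \<in> {..r}"
    then have "(- 1 :: complex) ^ i * (- 1) ^ (r - i) = (- 1) ^ r"
      by (simp flip: power_add)
    then show "s (of_nat (r choose i) * (- 1) ^ i) (eop (\<lambda>q. f (m + int i) (q + int (r - i))) n)
      = s ((- 1) ^ r) (s (of_nat (r choose i)) (eop (f (m + int i)) (n + int (r - i))))"
      unfolding eop_shift_pow by (simp add: mult_ac)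
  qed
  also have "\<dots> = s ((- 1) ^ r) ((shift2 s 1 ^^ r) (\<lambda>m. eop (f m)) m n)"
    by (simp add: W.shift2_pow_sum W.scale_sum_right mult_ac)
  finally show ?thesis .
qed

text \<open>The same substitution for power series: g(-t) at t = x - z becomes g(x + z).\<close>

lemma eop_fps_act:
  assumes f: "bounded2 f" and N: "\<And>m n. n \<ge> N \<Longrightarrow> f m n = 0"
  shows "eop (fps_act s (g oo (- fps_X)) (- 1) f m) n = fps_act s g 1 (\<lambda>m. eop (f m)) m n"
proof -
  obtain K where K: "vanish_above f m n K" using f by (auto simp: bounded2_def)
  have z: "(shift2 s (- 1) ^^ r) f m k = 0" if "k \<ge> N" for r k
    unfolding W.shift2_pow_sum by (rule sum.neutral) (use that in \<open>auto simp: N\<close>)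
  have e: "eop ((shift2 s (- 1) ^^ r) f m) n = s ((- 1) ^ r) ((shift2 s 1 ^^ r) (\<lambda>m. eop (f m)) m n)" for r
    by (rule eop_shift2_pow[OF N])
  have "eop (fps_act s (g oo (- fps_X)) (- 1) f m) n
    = (\<Sum>r<K. s (fps_nth (g oo (- fps_X)) r) (eop ((shift2 s (- 1) ^^ r) f m) n))"
  proof (rule eop_lincomb[of N])
    fix q assume "n \<le> q"
    then have q: "q = n + int (nat (q - n))" by simp
    have "vanish_above f (m + int 0) (n + int (nat (q - n))) K" by (rule vanish_above_shift[OF K])
    then have "vanish_above f m q K" using q by simp
    then show "fps_act s (g oo (- fps_X)) (- 1) f m q
      = (\<Sum>r<K. s (fps_nth (g oo (- fps_X)) r) ((shift2 s (- 1) ^^ r) f m q))"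
      by (rule W.fps_act_sum) simp
  qed (rule z)
  also have "\<dots> = (\<Sum>r<K. s (fps_nth g r) ((shift2 s 1 ^^ r) (\<lambda>m. eop (f m)) m n))"
    by (simp add: e fps_nth_compose_uminus_X mult_ac flip: power_mult_distrib)
  also have "\<dots> = fps_act s g 1 (\<lambda>m. eop (f m)) m n"
    unfolding fps_act_def
  proof (rule Sum_any_lessThan[symmetric])
    fix r assume r: "K \<le> r"
    have "eop ((shift2 s (- 1) ^^ r) f m) n = 0"
    proof (rule eop_eq_0[of n])
      fix k assume "n \<le> k"
      then have k: "k = n + int (nat (k - n))" by simp
      have "vanish_above f (m + int 0) (n + int (nat (k - n))) K" by (rule vanish_above_shift[OF K])
      then have "vanish_above f m k K" using k by simp
      then show "(shift2 s (- 1) ^^ r) f m k = 0" using r by (rule W.shift2_pow_eq_0)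
    qed simp
    then have "s ((- 1) ^ r) (s ((- 1) ^ r) ((shift2 s 1 ^^ r) (\<lambda>m. eop (f m)) m n)) = 0"
      unfolding e by simp
    then show "s (fps_nth g r) ((shift2 s 1 ^^ r) (\<lambda>m. eop (f m)) m n) = 0"
      by (simp flip: power_mult_distrib)
  qed
  finally show ?thesis .
qed


lemma op_bounded2:
  assumes "\<And>n. n \<ge> N \<Longrightarrow> \<tau> n = 0"
  shows "bounded2 (\<lambda>m n. a g m (\<tau> n))"
proof (rule W.bounded2I'[of N])
  fix n
  have "\<exists>J. \<forall>k\<in>{n..<N}. \<forall>m\<ge>J. a g m (\<tau> k) = 0"
    by (rule ex_uniform_bound) (auto intro: W.b_trunc)
  then obtain J where "\<forall>k\<in>{n..<N}. \<forall>m\<ge>J. a g m (\<tau> k) = 0" ..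
  then have "\<forall>m\<ge>J. \<forall>k\<ge>n. a g m (\<tau> k) = 0"
    using assms by (metis W.b_0 atLeastLessThan_iff not_less)
  then show "\<exists>J. \<forall>m\<ge>J. \<forall>k\<ge>n. a g m (\<tau> k) = 0" ..
qed (simp add: assms)

abbreviation "translate g \<tau> m n \<equiv> twist s (\<lambda>N j. a g N (\<tau> j)) m 0 n"

lemma translate_sum:
  assumes "\<And>n. n \<ge> N \<Longrightarrow> \<tau> n = 0" "N \<le> n + int K"
  shows "translate g \<tau> m n = (\<Sum>i<K. s (bdiff m i) (a g (m - int i) (\<tau> (n + int i))))"
  by (subst W.twist_sum[of N _ _ K]) (use assms in auto)

lemma translate_add:
  assumes "\<And>n. n \<ge> N \<Longrightarrow> \<tau> n = 0" "\<And>n. n \<ge> N' \<Longrightarrow> \<tau>' n = 0"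
  shows "translate g (\<lambda>n. \<tau> n + \<tau>' n) m n = translate g \<tau> m n + translate g \<tau>' m n"
proof -
  define K where "K = nat (max N N' - n)"
  have K: "max N N' \<le> n + int K" unfolding K_def by linarith
  have "translate g x m n = (\<Sum>i<K. s (bdiff m i) (a g (m - int i) (x (n + int i))))"
    if "x \<in> {\<tau>, \<tau>', \<lambda>n. \<tau> n + \<tau>' n}" for x
    by (rule translate_sum[OF _ K]) (use assms that in auto)
  from this[of \<tau>] this[of \<tau>'] this[of "\<lambda>n. \<tau> n + \<tau>' n"] show ?thesis
    by (simp only: insert_iff simp_thms) (simp add: W.b_add W.scale_right_distrib sum.distrib)
qed

lemma op_xmul:
  assumes N: "\<And>n. n \<ge> N \<Longrightarrow> \<tau> n = 0"
  shows "a g m (xmul s f \<tau> n) = xmul s f (\<lambda>n. a g m (\<tau> n)) n"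
proof -
  have K: "N \<le> n + int (nat (N - n))" by linarith
  have "a g m (xmul s f \<tau> n) = (\<Sum>k<nat (N - n). s (fps_nth f k) (a g m (\<tau> (n + int k))))"
    by (simp add: W.xmul_sum[OF N K] W.b_sum W.b_scale)
  also have "\<dots> = xmul s f (\<lambda>n. a g m (\<tau> n)) n"
    by (rule W.xmul_sum[symmetric, OF _ K]) (simp add: N)
  finally show ?thesis .
qed

lemma translate_xmul:
  assumes N: "\<And>n. n \<ge> N \<Longrightarrow> \<tau> n = 0"
  shows "translate g (xmul s f \<tau>) m n = xmul s f (translate g \<tau> m) n"
proof -
  define K where "K = nat (N - n)"
  have K: "N \<le> n + int K" "N \<le> n + int i + int K" for i unfolding K_def by linarith+
  have "translate g (xmul s f \<tau>) m n = (\<Sum>i<K. s (bdiff m i) (a g (m - int i) (xmul s f \<tau> (n + int i))))"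
    by (rule translate_sum[OF W.xmul_eq_0[OF N] K(1)])
  also have "\<dots> = (\<Sum>i<K. \<Sum>k<K. s (bdiff m i * fps_nth f k) (a g (m - int i) (\<tau> (n + int i + int k))))"
    by (simp add: W.xmul_sum[OF N K(2)] W.b_sum W.b_scale W.scale_sum_right)
  also have "\<dots> = (\<Sum>k<K. s (fps_nth f k) (translate g \<tau> m (n + int k)))"
  proof -
    have "translate g \<tau> m (n + int k) = (\<Sum>i<K. s (bdiff m i) (a g (m - int i) (\<tau> (n + int i + int k))))" for k
      using translate_sum[where g = g and m = m, OF N K(2)[of k]] by (simp add: add_ac)
    then show ?thesis by (subst sum.swap) (simp add: W.scale_sum_right mult.commute)
  qed
  also have "\<dots> = xmul s f (translate g \<tau> m) n"
    by (rule W.xmul_sum[symmetric, OF _ K(1)]) (rule W.twist_eq_0[of N], auto simp: N)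
  finally show ?thesis .
qed

lemma translate_bounded2:
  assumes N: "\<And>n. n \<ge> N \<Longrightarrow> \<tau> n = 0"
  shows "bounded2 (translate g \<tau>)"
proof (rule W.bounded2I'[of N])
  fix n
  have "\<exists>J. \<forall>k\<in>{n..<N}. \<forall>m\<ge>J. a g m (\<tau> k) = 0"
    by (rule ex_uniform_bound) (auto intro: W.b_trunc)
  then obtain J where "\<forall>k\<in>{n..<N}. \<forall>m\<ge>J. a g m (\<tau> k) = 0" ..
  then have J: "a g m (\<tau> k) = 0" if "m \<ge> J" "k \<ge> n" for m k
    using that N by (cases "k < N") auto
  define K where "K = nat (N - n)"
  have "translate g \<tau> m k = 0" if "m \<ge> J + int K" "k \<ge> n" for m k
  proof -
    have "translate g \<tau> m k = (\<Sum>i<K. s (bdiff m i) (a g (m - int i) (\<tau> (k + int i))))"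
    proof (rule translate_sum[OF N])
      show "N \<le> k + int K" using that unfolding K_def by linarith
    qed
    also have "\<dots> = 0"
    proof (rule sum.neutral, rule ballI)
      fix i assume "i \<in> {..<K}"
      then have "a g (m - int i) (\<tau> (k + int i)) = 0" by (intro J) (use that in auto)
      then show "s (bdiff m i) (a g (m - int i) (\<tau> (k + int i))) = 0" by simp
    qed
    finally show ?thesis .
  qed
  then show "\<exists>J. \<forall>m\<ge>J. \<forall>k\<ge>n. translate g \<tau> m k = 0" by blast
qed (rule W.twist_eq_0[of N], auto simp: N)

lemma modes_op_family:
  "xfamily s modes (\<lambda>m n. Y (a g m x) n y)"
  unfolding xfamily_def
proof (intro conjI allI)
  show "(\<lambda>n. Y (a g m x) n y) \<in> SD" for m by (rule modes_Y)
  obtain M where M: "\<And>m. m \<ge> M \<Longrightarrow> a g m x = 0" using W.b_trunc by blast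
  then have M': "Y (a g m x) n y = 0" if "m \<ge> M" for m n using that by simp
  then show "\<exists>M. \<forall>m\<ge>M. \<forall>n. Y (a g m x) n y = 0" by blast
  show "bounded2 (\<lambda>m n. Y (a g m x) n y)"
    by (rule bounded2I[of M, OF M' YV_trunc_op])
qed

text \<open>On a mode sequence this is associativity with a generator:
  \<open>g(z + x) Y(u,x) v\<close> and \<open>Y(g(z) u, x) v\<close> agree up to a power of z + x.
  The remaining goals propagate it through the span.\<close>

lemma SD_translate:
  assumes \<tau>: "\<tau> \<in> SD"
  shows "\<exists>\<Gamma> k. xfamily s modes \<Gamma> \<and> (\<forall>m n. (shift2 s 1 ^^ k) (translate g \<tau>) m n = (shift2 s 1 ^^ k) \<Gamma> m n)"
  using \<tau> modes_trunc
proof (rule W.xspan_local[where \<Phi> = "translate g"])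
  fix \<tau> assume "\<tau> \<in> modes"
  then obtain x y where \<tau>: "\<tau> = (\<lambda>n. Y x n y)" by (auto simp: modes_def)
  obtain l where l: "\<And>g n. n \<ge> int (glev l g) \<Longrightarrow> a g n y = 0" using ex_level by blast
  obtain L where L: "\<And>n. n \<ge> L \<Longrightarrow> Y x n y = 0" using Y_trunc by blast
  have "(shift2 s 1 ^^ glev l g) (translate g \<tau>) m n = (shift2 s 1 ^^ glev l g) (\<lambda>m n. Y (a g m x) n y) m n" for m n
  proof -
    have "(shift2 s 1 ^^ glev l g) (translate g \<tau>) m n = twist s (\<lambda>N j. a g N (\<tau> j)) m (0 + int (glev l g)) n"
      unfolding W.zbin_shift2[symmetric] by (rule W.zbin_twist[of L]) (simp add: \<tau> L)
    also have "\<dots> = zbin (glev l g) (\<lambda>m n. Y (a g m x) n y) m n"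
      unfolding \<tau> add_0_left by (rule Y_assoc_gen[OF l order_refl])
    finally show ?thesis by (simp add: W.zbin_shift2)
  qed
  then show "\<exists>\<Gamma> k. xfamily s modes \<Gamma> \<and> (\<forall>m n. (shift2 s 1 ^^ k) (translate g \<tau>) m n = (shift2 s 1 ^^ k) \<Gamma> m n)"
    using modes_op_family by blast
qed (assumption, simp add: twist_def, (rule translate_add translate_xmul translate_bounded2; assumption)+)

text \<open>A family depending on \<open>n + m\<close> only is a delta function times a field. After
  x becomes -x it is supported at z = -x, so one factor z + x kills it.\<close>

lemma eop_index_shift: "(shift2 s 1 ^^ Suc k) (\<lambda>m. eop (\<lambda>n. X (n + m))) m n = 0"
proof -
  have "shift2 s 1 (\<lambda>m. eop (\<lambda>n. X (n + m))) = (\<lambda>_ _. 0)"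
  proof (intro ext)
    fix m n
    show "shift2 s 1 (\<lambda>m. eop (\<lambda>n. X (n + m))) m n = 0"
      using eop_shift[of "\<lambda>n. X (n + m)" n] by (simp add: shift2_def add_ac)
  qed
  then show ?thesis
    unfolding funpow_Suc_right o_apply W.shift2_pow_sum by simp
qed

text \<open>Moving \<open>g(-x)\<close> past \<open>g'(z)\<close> produces the factor \<open>gfac h g g' (z + x)\<close> and a delta function that is
  killed by \<open>z + x\<close>; the remaining factor \<open>(z + x)^k\<close> can be cancelled, as both sides are bounded below in
  \<open>z\<close>.\<close>

lemma opp_gen: "opp (a g (-1) vac) v \<in> SD"
  using V
proof (induction v rule: VAh_induct)
  case vac
  show ?case by (simp only: opp_vac_right modes_Y)
next
  case (add x y)
  obtain N N' where "\<And>n. n \<ge> N \<Longrightarrow> Y (a g (-1) vac) n x = 0" "\<And>n. n \<ge> N' \<Longrightarrow> Y (a g (-1) vac) n y = 0"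
    using Y_trunc by metis
  then have "opp (a g (-1) vac) (x + y) n = opp (a g (-1) vac) x n + opp (a g (-1) vac) y n" for n
    unfolding Y_add2 by (rule eop_add)
  then show ?case using xspan_add[OF add] by simp
next
  case (scale r x)
  obtain N where "\<And>n. n \<ge> N \<Longrightarrow> Y (a g (-1) vac) n x = 0" using Y_trunc by blast
  then have "opp (a g (-1) vac) (s r x) n = s r (opp (a g (-1) vac) x n)" for n
    unfolding Y_scale2 by (rule eop_scale)
  then show ?case using W.xspan_scale[OF scale] by simp
next
  case (op g' m0 v)
  let ?\<tau> = "opp (a g (-1) vac) v"
  let ?R = "gfac h g g'"
  let ?f = "\<lambda>m n. a g' m (a g n v)"
  let ?X = "\<lambda>n. s (geps g g') (a Psi n v)"
  obtain \<Gamma> k where \<Gamma>: "xfamily s modes \<Gamma>"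
    and k: "\<And>m n. (shift2 s 1 ^^ k) (translate g' ?\<tau>) m n = (shift2 s 1 ^^ k) \<Gamma> m n"
    using SD_translate[OF op] by blast
  obtain N where N: "\<And>n. n \<ge> N \<Longrightarrow> a g n v = 0" using W.b_trunc by blast
  have fN: "?f m n = 0" if "n \<ge> N" for m n using N[OF that] by simp
  have fb: "bounded2 ?f" by (rule op_bounded2[OF N])
  have tr: "translate g' ?\<tau> = (\<lambda>m. eop (?f m))"
  proof (intro ext)
    fix m n
    show "translate g' ?\<tau> m n = eop (?f m) n"
      using eop_op[where g = g' and m = m and n = n, OF N] by (simp add: Y_gen)
  qed
  have trb: "bounded2 (translate g' ?\<tau>)"
    by (rule translate_bounded2[of N]) (simp add: eop_eq_0[of N] Y_gen N)
  have a1: "opp (a g (-1) vac) (a g' m v) n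
    = fps_act s ?R 1 (translate g' ?\<tau>) m n + eop (\<lambda>n. ?X (n + m)) n" for m n
  proof -
    have "a g q (a g' m v) = fps_act s (?R oo (- fps_X)) (- 1) ?f m q + ?X (q + m)" for q
      using W.rel[of g q g' m v] W.fps_act_transpose[of ?R ?f q m] by simp
    then have "opp (a g (-1) vac) (a g' m v) n
      = eop (\<lambda>q. fps_act s (?R oo (- fps_X)) (- 1) ?f m q + ?X (q + m)) n"
      by (simp add: Y_gen)
    also have "\<dots> = eop (fps_act s (?R oo (- fps_X)) (- 1) ?f m) n + eop (\<lambda>q. ?X (q + m)) n"
    proof -
      obtain J where J: "vanish_above (fps_act s (?R oo (- fps_X)) (- 1) ?f) m 0 J"
        using W.bounded2_fps_act[OF fb] unfolding bounded2_def by blast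
      have z1: "fps_act s (?R oo (- fps_X)) (- 1) ?f m q = 0" if "q \<ge> int J" for q
      proof -
        have "fps_act s (?R oo (- fps_X)) (- 1) ?f (m + int 0) (0 + int (nat q)) = 0"
        proof -
          have "J \<le> 0 + nat q" using that by simp
          then show ?thesis using J unfolding vanish_above_def by blast
        qed
        then show ?thesis using that by simp
      qed
      obtain M where "\<And>n. n \<ge> M \<Longrightarrow> a Psi n v = 0" using W.b_trunc by blast
      then have z2: "?X (q + m) = 0" if "q \<ge> M - m" for q using that by simp
      show ?thesis by (rule eop_add[OF z1 z2])
    qed
    also have "eop (fps_act s (?R oo (- fps_X)) (- 1) ?f m) n = fps_act s ?R 1 (\<lambda>m. eop (?f m)) m n"
      by (rule eop_fps_act[OF fb fN])
    finally show ?thesis unfolding tr .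
  qed
  obtain M where M: "\<And>m n. m \<ge> M \<Longrightarrow> \<Gamma> m n = 0" using W.xfamily_top[OF \<Gamma>] by blast
  obtain M' where M': "\<And>m. m \<ge> M' \<Longrightarrow> a g' m v = 0" using W.b_trunc by blast
  have "opp (a g (-1) vac) (a g' m v) n = fps_act s ?R 1 \<Gamma> m n" for m n
  \<comment> \<open>The power \<open>k\<close> handles the translated field, and one more factor z +
    x removes the delta term.\<close>
  proof (rule W.shift2_pow_inj[where e = 1 and k = "Suc k"])
    fix m n
    have "(shift2 s 1 ^^ Suc k) (\<lambda>m. opp (a g (-1) vac) (a g' m v)) m n
      = (shift2 s 1 ^^ Suc k) (fps_act s ?R 1 (translate g' ?\<tau>)) m n
        + (shift2 s 1 ^^ Suc k) (\<lambda>m. eop (\<lambda>n. ?X (n + m))) m n"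
      unfolding W.shift2_pow_add[symmetric] by (rule W.shift2_pow_cong) (rule a1)
    also have "\<dots> = fps_act s ?R 1 ((shift2 s 1 ^^ Suc k) (translate g' ?\<tau>)) m n"
    proof -
      have "(shift2 s 1 ^^ Suc k) (\<lambda>m. eop (\<lambda>n. ?X (n + m))) m n = 0" by (rule eop_index_shift)
      then show ?thesis by (simp only: W.shift2_pow_fps_act[OF trb] add_0_right)
    qed
    also have "(shift2 s 1 ^^ Suc k) (translate g' ?\<tau>) = (shift2 s 1 ^^ Suc k) \<Gamma>"
      by (intro ext W.shift2_pow_eq_up[OF k]) simp
    also have "fps_act s ?R 1 \<dots> m n = (shift2 s 1 ^^ Suc k) (fps_act s ?R 1 \<Gamma>) m n"
      by (rule W.shift2_pow_fps_act[OF W.xfamily_bounded2[OF \<Gamma>], symmetric])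
    finally show "(shift2 s 1 ^^ Suc k) (\<lambda>m. opp (a g (-1) vac) (a g' m v)) m n
      = (shift2 s 1 ^^ Suc k) (fps_act s ?R 1 \<Gamma>) m n" .
  next
    fix m n assume "m \<ge> M'"
    then show "opp (a g (-1) vac) (a g' m v) n = 0"
      using eop_eq_0[of n "\<lambda>_. 0" n] by (simp add: M')
  next
    fix m n assume m: "m \<ge> M"
    have "(shift2 s 1 ^^ r) \<Gamma> m n = 0" for r
      unfolding W.shift2_pow_sum by (rule sum.neutral) (use m in \<open>auto simp: M\<close>)
    then show "fps_act s ?R 1 \<Gamma> m n = 0" by (simp add: fps_act_def)
  qed
  then have "opp (a g (-1) vac) (a g' m0 v) = fps_act s ?R 1 \<Gamma> m0" by blast
  then show ?case using W.xfamily_fps_act[OF \<Gamma>] by simp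
qed

lemma opposite_fps_act: "opposite f x y w 0 p q = fps_act s f (- 1) (\<lambda>p q. Y x q (Y y p w)) p q"
proof -
  have 0: "prodc x y w 0 q p = Y x q (Y y p w)" for p q
  proof -
    obtain L where "\<And>j. j \<ge> L \<Longrightarrow> Y y j w = 0" using Y_trunc by blast
    then show ?thesis unfolding prodc_def by (intro W.twist_0[of L]) simp
  qed
  have "prodc x y w (int k) q p = (shift2 s (- 1) ^^ k) (\<lambda>p q. Y x q (Y y p w)) p q" for k
  proof (induction k arbitrary: p q)
    case (Suc k)
    then show ?case using prodc_rec[of x y w "int k" q p] by (simp add: shift2_def add.commute)
  qed (simp add: 0)
  then show ?thesis by (simp add: opposite_def fps_act_def)
qed

text \<open>At \<open>l = 0\<close> the second Jacobi term is f(x2 - x1) acting on a product of two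
  fields; for each mode of the inner field the outer one is a single mode sequence, so
  \<open>xfamily_fps_act\<close> applies.\<close>

lemma opposite_xfamily: "xfamily s modes (opposite f x y w 0)"
proof -
  let ?F = "\<lambda>p q. Y x q (Y y p w)"
  obtain M where M: "\<And>p. p \<ge> M \<Longrightarrow> Y y p w = 0" using Y_trunc by blast
  have "\<exists>J. \<forall>p\<ge>m. \<forall>q\<ge>J. ?F p q = 0" for m
  proof -
    have "\<exists>J. \<forall>p\<in>{m..<M}. \<forall>q\<ge>J. ?F p q = 0" by (rule ex_uniform_bound) (auto intro: Y_trunc)
    then obtain J where "\<forall>p\<in>{m..<M}. \<forall>q\<ge>J. ?F p q = 0" ..
    then have "?F p q = 0" if "p \<ge> m" "q \<ge> J" for p q
      using that M[of p] by (cases "p < M") auto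
    then show ?thesis by blast
  qed
  then have b: "bounded2 ?F" by (intro bounded2I[of M]) (auto simp: M)
  have F: "xfamily s modes ?F"
    unfolding xfamily_def
  proof (intro conjI allI)
    show "\<exists>M. \<forall>p\<ge>M. \<forall>q. ?F p q = 0" using M by (intro exI[of _ M]) simp
  qed (rule modes_Y, rule b)
  have e: "opposite f x y w 0 = fps_act s f (- 1) ?F" by (intro ext) (rule opposite_fps_act)
  have "\<forall>p\<ge>M. \<forall>q. opposite f x y w 0 p q = 0" using opposite_eq_0[OF M] by blast
  moreover have "opposite f x y w 0 p \<in> SD" for p unfolding e by (rule W.xfamily_fps_act[OF F])
  moreover have "bounded2 (opposite f x y w 0)" unfolding e by (rule W.bounded2_fps_act[OF b])
  ultimately show ?thesis unfolding xfamily_def by blast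
qed

text \<open>On a mode sequence \<open>Y(x, \<sqdot>) y\<close> this is the locality of \<open>g\<close> and \<open>x\<close>, by the Jacobi identity for the already
  known case of skew symmetry.\<close>

lemma SD_op:
  assumes \<tau>: "\<tau> \<in> SD"
  shows "\<exists>\<Gamma> k. xfamily s modes \<Gamma> \<and>
    (\<forall>m n. (shift2 s (- 1) ^^ k) (\<lambda>m n. a g m (\<tau> n)) m n = (shift2 s (- 1) ^^ k) \<Gamma> m n)"
  using \<tau> modes_trunc
proof (rule W.xspan_local[where \<Phi> = "\<lambda>\<tau> m n. a g m (\<tau> n)"])
  fix \<tau> assume "\<tau> \<in> modes"
  then obtain x y where \<tau>: "\<tau> = (\<lambda>n. Y x n y)" by (auto simp: modes_def)
  let ?u = "a g (-1) vac"
  obtain ds where ds: "skew ?u x ds" using SD_imp_skew[OF opp_gen] by blast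
  let ?O = "\<lambda>l p q. \<Sum>(f, x', y')\<leftarrow>ds. opposite f x' y' y l p q"
  obtain M where M: "\<And>j. j \<ge> M \<Longrightarrow> Y ?u j x = 0" using Y_trunc by blast
  \<comment> \<open>With \<open>k \<ge> M\<close> the factor \<open>x0^k\<close> annihilates the
    iterate, so the Jacobi identity reduces to locality.\<close>
  define k where "k = nat M"
  have "prodc ?u x y (int k) p q = ?O (int k) p q" for p q
  proof -
    have "iterc ?u x y (int k) p q = 0" by (rule iterc_eq_0[OF M]) (auto simp: k_def)
    then show ?thesis using jacobi[OF ds, of y "int k" p q] by simp
  qed
  moreover have "(shift2 s (- 1) ^^ k) (prodc ?u x y 0) p q = s ((- 1) ^ k) (prodc ?u x y (0 + int k) p q)" for p q
    by (rule W.shift2_pow_rec) (rule prodc_rec)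
  moreover have "(shift2 s (- 1) ^^ k) (?O 0) p q = s ((- 1) ^ k) (?O (0 + int k) p q)" for p q
  proof (rule W.shift2_pow_rec)
    show "?O (l + 1) p q = ?O l (p + 1) q - ?O l p (q + 1)" for l p q
      by (induction ds) (auto simp: opposite_rec)
  qed
  ultimately have "(shift2 s (- 1) ^^ k) (prodc ?u x y 0) p q = (shift2 s (- 1) ^^ k) (?O 0) p q" for p q
    by simp
  moreover have "prodc ?u x y 0 = (\<lambda>m n. a g m (\<tau> n))"
  proof (intro ext)
    fix m n
    obtain L where "\<And>j. j \<ge> L \<Longrightarrow> Y x j y = 0" using Y_trunc by blast
    then have "prodc ?u x y 0 m n = Y ?u m (Y x n y)" unfolding prodc_def by (intro W.twist_0[of L]) simp
    then show "prodc ?u x y 0 m n = a g m (\<tau> n)" by (simp add: Y_gen \<tau>)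
  qed
  moreover have "xfamily s modes (?O 0)"
  proof (induction ds)
    case (Cons d ds)
    obtain f x' y' where d: "d = (f, x', y')" by (cases d)
    show ?case using W.xfamily_add[OF opposite_xfamily Cons] by (simp add: d)
  qed (simp add: W.xfamily_zero)
  ultimately show "\<exists>\<Gamma> k. xfamily s modes \<Gamma> \<and>
    (\<forall>m n. (shift2 s (- 1) ^^ k) (\<lambda>m n. a g m (\<tau> n)) m n = (shift2 s (- 1) ^^ k) \<Gamma> m n)"
    by metis
qed (assumption, simp, simp add: W.b_add, (rule op_xmul op_bounded2; assumption)+)

text \<open>Weak associativity of \<open>g\<close>, \<open>u\<close>, \<open>v\<close> says that \<open>g(z) exp(x D) Y(u, -x) v\<close> and \<open>exp(x D) Y(g(z) u, -x) v\<close>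
  agree after multiplication by a power of \<open>z - x\<close>.\<close>

lemma opp_SD: "opp u v \<in> SD"
  using V
proof (induction u rule: VAh_induct)
  case vac
  show ?case by (simp only: opp_vac_left modes_Y)
next
  case (add x y)
  obtain N N' where "\<And>n. n \<ge> N \<Longrightarrow> Y x n v = 0" "\<And>n. n \<ge> N' \<Longrightarrow> Y y n v = 0"
    using Y_trunc by metis
  then have "opp (x + y) v n = opp x v n + opp y v n" for n
    unfolding Y_add1 by (rule eop_add)
  then show ?case using xspan_add[OF add] by simp
next
  case (scale r x)
  obtain N where "\<And>n. n \<ge> N \<Longrightarrow> Y x n v = 0" using Y_trunc by blast
  then have "opp (s r x) v n = s r (opp x v n)" for n
    unfolding Y_scale1 by (rule eop_scale)
  then show ?case using W.xspan_scale[OF scale] by simp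
next
  case (op g m0 u)
  let ?g = "a g (-1) vac"
  obtain \<Gamma> k where \<Gamma>: "xfamily s modes \<Gamma>"
    and k: "\<And>m n. (shift2 s (- 1) ^^ k) (\<lambda>m n. a g m (opp u v n)) m n = (shift2 s (- 1) ^^ k) \<Gamma> m n"
    using SD_op[OF op] by blast
  obtain L where L: "\<And>n. n \<ge> L \<Longrightarrow> Y u n v = 0" using Y_trunc by blast
  define D where "D m p q = prodc ?g u v m p q - iterc ?g u v m p q" for m p q
  have D_rec: "D (m + 1) p q = D m (p + 1) q - D m p (q + 1)" for m p q
    by (simp add: D_def prodc_rec iterc_rec)
  have it0: "\<exists>N. \<forall>q\<ge>N. iterc ?g u v m p q = 0" for m p
  proof -
    obtain J where J: "vanish_above (\<lambda>l q. iterc ?g u v l p q) m 0 J"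
      using iterc_bounded2[of ?g u v p] unfolding bounded2_def by blast
    have "iterc ?g u v m p q = 0" if "q \<ge> int J" for q
    proof -
      have "J \<le> 0 + nat q" using that by simp
      then have "iterc ?g u v (m + int 0) p (0 + int (nat q)) = 0" using J unfolding vanish_above_def by blast
      then show ?thesis using that by simp
    qed
    then show ?thesis by blast
  qed
  have D0: "\<exists>N. \<forall>q\<ge>N. D m p q = 0" for m p
  proof -
    obtain N where "\<forall>q\<ge>N. iterc ?g u v m p q = 0" using it0 by blast
    then have "\<forall>q\<ge>max N L. D m p q = 0" using prodc_eq_0[OF L] by (simp add: D_def)
    then show ?thesis ..
  qed
  \<comment> \<open>Under \<open>eop\<close> the variable x2 becomes -x, hence x1 = x0 + x2 becomes
    z - x. So raising \<open>p\<close> multiplies \<open>\<Delta>\<close> by z - x, and the power of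
    x1 that kills \<open>D\<close> gives a power of z - x that kills
    \<open>\<Delta> 0\<close>.\<close>
  define \<Delta> where "\<Delta> p m = eop (D m p)" for p m
  have \<Delta>_rec: "\<Delta> (p + 1) m n = - shift2 s (- 1) (\<Delta> p) m n" for p m n
  proof -
    obtain N where N: "\<And>q. q \<ge> N \<Longrightarrow> D (m + 1) p q = 0" using D0 by blast
    obtain N' where N': "\<And>q. q \<ge> N' \<Longrightarrow> D m p (q + 1) = 0" using D0[of m p] by (metis add_increasing2 zero_le_one)
    have "D m (p + 1) = (\<lambda>q. D (m + 1) p q + D m p (q + 1))" by (intro ext) (simp add: D_rec)
    then have "\<Delta> (p + 1) m n = eop (\<lambda>q. D (m + 1) p q + D m p (q + 1)) n" by (simp only: \<Delta>_def)
    also have "\<dots> = eop (D (m + 1) p) n + eop (\<lambda>q. D m p (q + 1)) n" by (rule eop_add[OF N N'])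
    also have "\<dots> = - shift2 s (- 1) (\<Delta> p) m n"
      unfolding eop_shift by (simp add: \<Delta>_def shift2_def)
    finally show ?thesis .
  qed
  have \<Delta>_pow: "(shift2 s (- 1) ^^ j) (\<Delta> 0) m n = s ((- 1) ^ j) (\<Delta> (int j) m n)" for j m n
  proof (induction j arbitrary: m n)
    case (Suc j)
    have 2: "(shift2 s (- 1) ^^ j) (\<Delta> 0) = (\<lambda>m n. s ((- 1) ^ j) (\<Delta> (int j) m n))" by (intro ext Suc)
    have 1: "\<Delta> (int (Suc j)) m n = - shift2 s (- 1) (\<Delta> (int j)) m n"
      using \<Delta>_rec[of "int j" m n] by (simp add: add.commute)
    show ?case
      by (simp only: funpow.simps o_apply 1 2) (simp add: shift2_def W.scale_right_diff_distrib)
  qed simp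
  obtain P where P: "\<And>p l q. p \<ge> P \<Longrightarrow> prodc ?g u v l p q = iterc ?g u v l p q" using prodc_iterc by blast
  have \<Delta>P: "\<Delta> (int (nat P)) m n = 0" for m n
    using P eop_eq_0[of n "D m (int (nat P))" n] by (simp add: \<Delta>_def D_def)
  have \<Theta>: "a g m (opp u v n) = opp (a g m u) v n + \<Delta> 0 m n" for m n
  proof -
    obtain N where N: "\<And>q. q \<ge> N \<Longrightarrow> D m 0 q = 0" using D0 by blast
    obtain N' where N': "\<And>q. q \<ge> N' \<Longrightarrow> iterc ?g u v m 0 q = 0" using it0 by blast
    have i: "iterc ?g u v m 0 q = Y (a g m u) q v" for q
    proof -
      obtain M where "\<And>j. j \<ge> M \<Longrightarrow> a g j u = 0" using W.b_trunc by blast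
      then have "iterc ?g u v m 0 q = Y (Y ?g m u) q v" unfolding iterc_def by (intro W.iter_0[of M]) (simp add: Y_gen)
      then show ?thesis by (simp add: Y_gen)
    qed
    have "a g m (opp u v n) = eop (prodc ?g u v m 0) n"
    proof -
      have "prodc ?g u v m 0 = translate g (\<lambda>j. Y u j v) m" by (intro ext) (simp add: prodc_def Y_gen)
      moreover have "a g m (opp u v n) = eop (translate g (\<lambda>j. Y u j v) m) n" by (rule op_eop[OF L])
      ultimately show ?thesis by simp
    qed
    also have "\<dots> = eop (\<lambda>q. iterc ?g u v m 0 q + D m 0 q) n" by (simp add: D_def)
    also have "\<dots> = eop (iterc ?g u v m 0) n + \<Delta> 0 m n" unfolding \<Delta>_def by (rule eop_add[OF N' N])
    also have "eop (iterc ?g u v m 0) n = opp (a g m u) v n"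
    proof -
      have "iterc ?g u v m 0 = (\<lambda>q. Y (a g m u) q v)" by (intro ext i)
      then show ?thesis by simp
    qed
    finally show ?thesis .
  qed
  have eq1: "(shift2 s (- 1) ^^ nat P) (\<lambda>m n. a g m (opp u v n)) m n
    = (shift2 s (- 1) ^^ nat P) (\<lambda>m. opp (a g m u) v) m n" for m n
  proof -
    have "(shift2 s (- 1) ^^ nat P) (\<lambda>m n. a g m (opp u v n)) m n
      = (shift2 s (- 1) ^^ nat P) (\<lambda>m n. opp (a g m u) v n + \<Delta> 0 m n) m n" by (simp only: \<Theta>)
    also have "\<dots> = (shift2 s (- 1) ^^ nat P) (\<lambda>m. opp (a g m u) v) m n + (shift2 s (- 1) ^^ nat P) (\<Delta> 0) m n"
      by (rule W.shift2_pow_add)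
    finally show ?thesis unfolding \<Delta>_pow \<Delta>P by simp
  qed
  obtain M where M: "\<And>m n. m \<ge> M \<Longrightarrow> \<Gamma> m n = 0" using W.xfamily_top[OF \<Gamma>] by blast
  obtain M' where M': "\<And>m. m \<ge> M' \<Longrightarrow> a g m u = 0" using W.b_trunc by blast
  have "opp (a g m u) v n = \<Gamma> m n" for m n
  proof (rule W.shift2_pow_inj[where e = "- 1" and k = "nat P + k", OF _ _ M])
    show "(shift2 s (- 1) ^^ (nat P + k)) (\<lambda>m. opp (a g m u) v) m n = (shift2 s (- 1) ^^ (nat P + k)) \<Gamma> m n" for m n
      using W.shift2_pow_eq_up[OF eq1, of "nat P + k" m n] W.shift2_pow_eq_up[OF k, of "nat P + k" m n] by simp
    show "opp (a g m u) v n = 0" if "m \<ge> M'" for m n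
      using eop_eq_0[of n "\<lambda>_. 0" n] that by (simp add: M')
  qed auto
  then have "opp (a g m0 u) v = \<Gamma> m0" by blast
  then show ?case using W.xfamily_xspan[OF \<Gamma>] by simp
qed

end

section \<open>Existence and uniqueness\<close>

lemma linear_imp_0: "Vector_Spaces.linear s t f \<Longrightarrow> f 0 = 0"
  unfolding Vector_Spaces.linear_iff by (metis add_cancel_right_right add_0)

lemma field_map_0:
  assumes "field_map s t Y"
  shows "Y 0 n w = 0" "Y v n 0 = 0"
  using assms linear_imp_0[of s t "\<lambda>v. Y v n w"] linear_imp_0[of t t "Y v n"] by (simp_all add: field_map_def)

context cspace
begin

text \<open>Passes from exponents to mode indices: multiplying by a variable lowers the exponent
  read off and raises the mode.\<close>

lemma mult_bsum_zbin:
  "mult_bsum t l G b c = zbin l (\<lambda>m q. G (- m - 1) (- q - 1)) (- b - 1) (- c - 1)"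
proof -
  have "mult_bsum t l G b c
    = (\<Sum>j\<in>{0..l}. t (of_nat (l choose j)) (G (b - int (l - j)) (c - int j)))"
    by (simp add: mult_bsum_def atLeast0AtMost)
  also have "\<dots> = (\<Sum>i\<in>{0..l}. t (of_nat (l choose (l - i))) (G (b - int (l - (l - i))) (c - int (l - i))))"
    by (subst sum.atLeastAtMost_rev) simp
  also have "\<dots> = zbin l (\<lambda>m q. G (- m - 1) (- q - 1)) (- b - 1) (- c - 1)"
    unfolding zbin_sum atLeast0AtMost
    by (intro sum.cong refl) (auto simp: binomial_symmetric[symmetric] algebra_simps)
  finally show ?thesis .
qed

lemma assoc_product_twist:
  "assoc_product t YW u v w b c = twist t (\<lambda>N j. YW u N (YW v j w)) (- b - 1) 0 (- c - 1)"
proof -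
  have "bdiff (- b - 1) i = (of_int (b + int i) gchoose i)" for i
    using bdiff_neg[of i "b + int i"] by (simp add: algebra_simps)
  moreover have "- (b + int i) - 1 = 0 + (- b - 1) - int i" "- (c - int i) - 1 = - c - 1 + int i" for i by simp_all
  ultimately show ?thesis unfolding assoc_product_def twist_def by (simp only:)
qed

text \<open>Multiplication by \<open>(x0 + x2)^l\<close> is the functional \<open>x1^l\<close> on
  both sides, so the module axiom with exponent l is the equality at \<open>p = l\<close>.\<close>

lemma weak_assoc_iff:
  assumes YW: "\<And>j. j \<ge> L \<Longrightarrow> YW v j w = 0" "\<And>m. YW u m 0 = 0"
    and Y: "\<And>j. j \<ge> M \<Longrightarrow> Y u j v = 0" "\<And>m. YW 0 m w = 0"
  shows "mult_bsum t l (assoc_product t YW u v w) = mult_bsum t l (assoc_iterate Y YW u v w) \<longleftrightarrow>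
    (\<forall>m q. twist t (\<lambda>N j. YW u N (YW v j w)) m (int l) q = iter t (\<lambda>j n. YW (Y u j v) n w) m (int l) q)"
proof -
  let ?T = "twist t (\<lambda>N j. YW u N (YW v j w))"
  let ?K = "\<lambda>j n. YW (Y u j v) n w"
  have 1: "mult_bsum t l (assoc_product t YW u v w) b c = ?T (- b - 1) (int l) (- c - 1)" for b c
  proof -
    have "zbin l (\<lambda>m q. ?T m 0 q) (- b - 1) (- c - 1) = ?T (- b - 1) (0 + int l) (- c - 1)"
      by (rule zbin_twist[of L]) (simp add: YW)
    then show ?thesis by (simp add: mult_bsum_zbin assoc_product_twist)
  qed
  have 2: "mult_bsum t l (assoc_iterate Y YW u v w) b c = iter t ?K (- b - 1) (int l) (- c - 1)" for b c
  proof -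
    have "zbin l ?K (- b - 1) (- c - 1) = iter t ?K (- b - 1) (int l) (- c - 1)"
      by (rule zbin_iter[of M]) (simp add: Y)
    then show ?thesis by (simp add: mult_bsum_zbin assoc_iterate_def)
  qed
  show ?thesis
  proof
    assume eq: "mult_bsum t l (assoc_product t YW u v w) = mult_bsum t l (assoc_iterate Y YW u v w)"
    show "\<forall>m q. ?T m (int l) q = iter t ?K m (int l) q"
    proof (intro allI)
      fix m q
      show "?T m (int l) q = iter t ?K m (int l) q"
        using 1[of "- m - 1" "- q - 1"] 2[of "- m - 1" "- q - 1"] eq by simp
    qed
  next
    assume "\<forall>m q. ?T m (int l) q = iter t ?K m (int l) q"
    then show "mult_bsum t l (assoc_product t YW u v w) = mult_bsum t l (assoc_iterate Y YW u v w)"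
      by (intro ext) (simp only: 1 2)
  qed
qed

end

context VAh_pair
begin

text \<open>Associativity with a generator determines \<open>Y\<^sub>W(g\<^sub>m u, x)\<close> from \<open>Y\<^sub>W(u, x)\<close>.\<close>

lemma Y_unique:
  assumes fm: "field_map s t YW" and vac: "\<And>n w. YW vac n w = (if n = -1 then w else 0)"
    and as: "\<And>g u w. \<exists>P. \<forall>p\<ge>P. \<forall>l q.
      twist t (\<lambda>N j. b g N (YW u j w)) l p q = iter t (\<lambda>j n. YW (a g j u) n w) l p q"
  shows "YW = Y"
proof (intro ext)
  have lin: "Vector_Spaces.linear s t (\<lambda>v. YW v n w)" for n w using fm by (simp add: field_map_def)
  have YW_add: "YW (x + y) n w = YW x n w + YW y n w" and YW_scale: "YW (s r x) n w = t r (YW x n w)"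
    for x y r n w
    using lin[of n w] by (simp_all add: Vector_Spaces.linear_iff)
  fix v n w
  have "\<forall>n. YW v n w = Y v n w"
    using V
  proof (induction v rule: VAh_induct)
    case vac
    show ?case by (simp add: assms(2) Y_vac)
  next
    case (op g m u)
    obtain P where P: "\<And>p l q. p \<ge> P \<Longrightarrow>
        twist t (\<lambda>N j. b g N (YW u j w)) l p q = iter t (\<lambda>j n. YW (a g j u) n w) l p q"
      using as by blast
    obtain P' where P': "\<And>p l q. p \<ge> P' \<Longrightarrow> prodc (a g (-1) vac) u w l p q = iterc (a g (-1) vac) u w l p q"
      using prodc_iterc by blast
    let ?p = "max P P'"
    obtain M where M: "\<And>j. j \<ge> M \<Longrightarrow> a g j u = 0" using V.b_trunc by blast
    have eq: "iter t (\<lambda>j n. YW (a g j u) n w) l ?p q = iter t (\<lambda>j n. Y (a g j u) n w) l ?p q" for l q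
      using P[of ?p l q] P'[of ?p l q] op by (simp add: prodc_def iterc_def Y_gen YV_gen)
    have "YW (a g m u) n w - Y (a g m u) n w = 0" for n
    proof (rule W.iter_inj[where p = ?p])
      show "YW (a g j u) n w - Y (a g j u) n w = 0" if "j \<ge> M" for j n
        using M[OF that] by (simp add: field_map_0[OF fm])
      show "iter t (\<lambda>j n. YW (a g j u) n w - Y (a g j u) n w) l ?p q = 0" for l q
        by (subst W.iter_diff[where M = M and M' = M]) (simp_all add: M field_map_0[OF fm] eq)
    qed
    then show ?case by simp
  qed (simp_all add: YW_add YW_scale Y_add1 Y_scale1)
  then show "YW v n w = Y v n w" ..
qed

text \<open>Existence and uniqueness in one equivalence: \<open>prodc_iterc\<close> supplies the
  axiom for \<open>Y\<close>. Conversely, the axiom with a generator in front, extended to larger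
  exponents by \<open>twist_iter_up\<close>, is what \<open>Y_unique\<close> requires.\<close>

lemma wqva_module_iff:
  "wqva_module s YV vac t YW \<and> (\<forall>g. YW (a g (-1) vac) = b g) \<longleftrightarrow> YW = Y"
proof
  assume YW: "YW = Y"
  have "\<exists>l. mult_bsum t l (assoc_product t Y u v w) = mult_bsum t l (assoc_iterate YV Y u v w)" for u v w
  proof -
    obtain L where L: "\<And>j. j \<ge> L \<Longrightarrow> Y v j w = 0" using Y_trunc by blast
    obtain M where M: "\<And>j. j \<ge> M \<Longrightarrow> YV u j v = 0" using YV_trunc by blast
    obtain P where P: "\<And>p l q. p \<ge> P \<Longrightarrow> prodc u v w l p q = iterc u v w l p q" using prodc_iterc by blast
    have "\<forall>m q. prodc u v w m (int (nat P)) q = iterc u v w m (int (nat P)) q" using P by simp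
    then have "mult_bsum t (nat P) (assoc_product t Y u v w) = mult_bsum t (nat P) (assoc_iterate YV Y u v w)"
      unfolding prodc_def iterc_def by (subst W.weak_assoc_iff[where L = L and M = M]) (simp_all add: L M)
    then show ?thesis by (rule exI[of _ "nat P"])
  qed
  then show "wqva_module s YV vac t YW \<and> (\<forall>g. YW (a g (-1) vac) = b g)"
    unfolding YW by (auto simp: wqva_module_def W.vector_space_axioms Y_field_map Y_vac Y_gen fun_eq_iff)
next
  assume *: "wqva_module s YV vac t YW \<and> (\<forall>g. YW (a g (-1) vac) = b g)"
  then have fm: "field_map s t YW" and YW_vac: "\<And>n w. YW vac n w = (if n = -1 then w else 0)"
    and as: "\<And>u v w. \<exists>l. mult_bsum t l (assoc_product t YW u v w) = mult_bsum t l (assoc_iterate YV YW u v w)"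
    and gen: "\<And>g. YW (a g (-1) vac) = b g"
    by (auto simp: wqva_module_def)
  show "YW = Y"
  proof (rule Y_unique[OF fm YW_vac])
    fix g u w
    obtain L where L: "\<And>j. j \<ge> L \<Longrightarrow> YW u j w = 0" using fm unfolding field_map_def by blast
    obtain M where M: "\<And>j. j \<ge> M \<Longrightarrow> a g j u = 0" using V.b_trunc by blast
    obtain l where l: "mult_bsum t l (assoc_product t YW (a g (-1) vac) u w)
        = mult_bsum t l (assoc_iterate YV YW (a g (-1) vac) u w)" using as by blast
    have eq: "twist t (\<lambda>N j. b g N (YW u j w)) m (int l) q = iter t (\<lambda>j n. YW (a g j u) n w) m (int l) q" for m q
    proof -
      have "\<forall>m q. twist t (\<lambda>N j. YW (a g (-1) vac) N (YW u j w)) m (int l) q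
          = iter t (\<lambda>j n. YW (YV (a g (-1) vac) j u) n w) m (int l) q"
        by (rule iffD1[OF W.weak_assoc_iff[where L = L and M = M] l])
          (simp_all add: L M gen YV_gen field_map_0[OF fm])
      then show ?thesis by (simp add: gen YV_gen)
    qed
    have "twist t (\<lambda>N j. b g N (YW u j w)) m p q = iter t (\<lambda>j n. YW (a g j u) n w) m p q" if "p \<ge> int l" for m p q
      by (rule W.twist_iter_up[where L = L and M = M, OF _ _ eq that]) (simp_all add: L M field_map_0[OF fm])
    then show "\<exists>P. \<forall>p\<ge>P. \<forall>l q. twist t (\<lambda>N j. b g N (YW u j w)) l p q = iter t (\<lambda>j n. YW (a g j u) n w) l p q"
      by blast
  qed
qed

end

context VAh
begin

text \<open>The data of the second Jacobi term for \<open>Y\<close> come from skew symmetry. For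
  uniqueness, any Jacobi identity yields associativity for large \<open>p\<close>.\<close>

lemma weak_quantum_vertex_algebra_iff:
  "weak_quantum_vertex_algebra s Y' vac \<and> (\<forall>g. Y' (a g (-1) vac) = a g) \<longleftrightarrow> Y' = Y"
proof
  assume Y': "Y' = Y"
  have "\<exists>(r::nat) v' u' f. \<forall>l p q w.
      jacobi_1 s Y u v l p q w - (\<Sum>i<r. jacobi_2 s Y (f i) (v' i) (u' i) l p q w) = jacobi_3 s Y u v l p q w" for u v
  proof -
    obtain ds where ds: "skew u v ds" using SD_imp_skew[OF opp_SD] by blast
    let ?f = "\<lambda>i. fps_to_fls (fst (ds ! i))" and ?v = "\<lambda>i. fst (snd (ds ! i))" and ?u = "\<lambda>i. snd (snd (ds ! i))"
    have "jacobi_1 s Y u v l p q w - (\<Sum>i<length ds. jacobi_2 s Y (?f i) (?v i) (?u i) l p q w)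
        = jacobi_3 s Y u v l p q w" for l p q w
    proof -
      have "jacobi_1 s Y u v l p q w = prodc u v w l p q" by (simp add: jacobi_1_def prodc_def twist_def)
      moreover have "jacobi_3 s Y u v l p q w = iterc u v w l p q" by (simp add: jacobi_3_def iterc_def iter_def)
      moreover have "(\<Sum>i<length ds. jacobi_2 s Y (?f i) (?v i) (?u i) l p q w)
          = (\<Sum>(f, x, y)\<leftarrow>ds. opposite f x y w l p q)"
        by (simp add: jacobi_2_eq sum_list_sum_nth atLeast0LessThan case_prod_beta)
      ultimately show ?thesis by (simp only: jacobi[OF ds])
    qed
    then show ?thesis
      by (intro exI[of _ "length ds"] exI[of _ ?v] exI[of _ ?u] exI[of _ ?f]) blast
  qed
  then show "weak_quantum_vertex_algebra s Y' vac \<and> (\<forall>g. Y' (a g (-1) vac) = a g)"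
    unfolding Y' weak_quantum_vertex_algebra_def
    by (simp add: W.vector_space_axioms Y_field_map Y_vac Y_creation Y_creation_0 Y_gen fun_eq_iff)
next
  assume *: "weak_quantum_vertex_algebra s Y' vac \<and> (\<forall>g. Y' (a g (-1) vac) = a g)"
  then have fm: "field_map s s Y'" and vac: "\<And>n w. Y' vac n w = (if n = -1 then w else 0)"
    and gen: "\<And>g. Y' (a g (-1) vac) = a g"
    by (auto simp: weak_quantum_vertex_algebra_def)
  show "Y' = Y"
  proof (rule Y_unique[OF fm vac])
    fix g u w
    obtain r :: nat and v' u' f where J: "\<forall>l p q w.
        jacobi_1 s Y' (a g (-1) vac) u l p q w - (\<Sum>i<r. jacobi_2 s Y' (f i) (v' i) (u' i) l p q w)
        = jacobi_3 s Y' (a g (-1) vac) u l p q w"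
    proof -
      have "\<exists>(r::nat) v' u' f. \<forall>l p q w. jacobi_1 s Y' (a g (-1) vac) u l p q w
          - (\<Sum>i<r. jacobi_2 s Y' (f i) (v' i) (u' i) l p q w) = jacobi_3 s Y' (a g (-1) vac) u l p q w"
        using * unfolding weak_quantum_vertex_algebra_def by simp
      then show ?thesis by (elim exE) (rule that, assumption)
    qed
    \<comment> \<open>In the second Jacobi term the inner operators have index at least
      \<open>p\<close>; for large \<open>p\<close> they all kill w, and only the product and the
      iterate remain.\<close>
    have "\<exists>P. \<forall>i\<in>{..<r}. \<forall>p\<ge>P. Y' (u' i) p w = 0"
      by (rule ex_uniform_bound) (use fm in \<open>auto simp: field_map_def\<close>)
    then obtain P where P: "\<And>i p. i < r \<Longrightarrow> p \<ge> P \<Longrightarrow> Y' (u' i) p w = 0" by auto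
    have "twist s (\<lambda>N j. a g N (Y' u j w)) l p q = iter s (\<lambda>j n. Y' (a g j u) n w) l p q" if "p \<ge> P" for l p q
    proof -
      have "jacobi_2 s Y' (f i) (v' i) (u' i) l p q w = 0" if "i < r" for i
        using P[OF that] \<open>p \<ge> P\<close> by (simp add: jacobi_2_def field_map_0[OF fm] case_prod_beta)
      then show ?thesis
        using J[rule_format, of l p q w] by (simp add: jacobi_1_def jacobi_3_def gen twist_def iter_def)
    qed
    then show "\<exists>P. \<forall>p\<ge>P. \<forall>l q. twist s (\<lambda>N j. a g N (Y' u j w)) l p q = iter s (\<lambda>j n. Y' (a g j u) n w) l p q"
      by blast
  qed
qed

end

theorem theorem3p8:
  fixes h :: "complex fps"
    and s :: "complex \<Rightarrow> 'v::ab_group_add \<Rightarrow> 'v"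
    and a :: "gen \<Rightarrow> int \<Rightarrow> 'v \<Rightarrow> 'v"
    and vac :: 'v
  assumes h: "h * (h oo (- fps_X)) = 1"
    and V: "is_VAh h s a vac"
  shows "\<exists>Y.
    (weak_quantum_vertex_algebra s Y vac \<and> (\<forall>g. Y (a g (-1) vac) = a g)) \<and>
    (\<forall>Y'. weak_quantum_vertex_algebra s Y' vac \<and> (\<forall>g. Y' (a g (-1) vac) = a g) \<longrightarrow> Y' = Y) \<and>
    (\<forall>(t :: complex \<Rightarrow> 'w::ab_group_add \<Rightarrow> 'w) b. restricted_Ah_module h t b \<longrightarrow>
      (\<exists>!YW. wqva_module s Y vac t YW \<and> (\<forall>g. YW (a g (-1) vac) = b g)))"
proof -
  interpret VAh h s a vac by unfold_locales (rule h, rule V)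
  have "\<exists>!YW. wqva_module s Y vac t YW \<and> (\<forall>g. YW (a g (-1) vac) = b g)"
    if W: "restricted_Ah_module h t b" for t :: "complex \<Rightarrow> 'w \<Rightarrow> 'w" and b
  proof -
    have "VAh_pair h s a vac t b"
      by (intro VAh_pair.intro VAh_pair_axioms.intro restricted_imp_Ah_module[OF h W] h V)
    \<comment> \<open>The algebra structure in this equivalence is \<open>vop s a vac s a\<close>,
      the same map for every module.\<close>
    from VAh_pair.wqva_module_iff[OF this] show ?thesis by simp
  qed
  then show ?thesis
    using weak_quantum_vertex_algebra_iff by (intro exI[of _ Y]) blast
qed

end
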